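(* Let $w_1,\ldots,w_\ell\in\mathbf{F}_r$ be all different from $1$, such that the total unsigned exponent of each $x\in B$ in $w_1,\ldots,w_\ell$ is even; denote it $2L_x$, and let $N=\max\{L_x : x\in B\}$. Then there is a computable rational function $\overline{\mathcal{T}r^{\mathrm{O}}_{w_1,\ldots,w_\ell}}\in\mathbf{Q}(n)$ such that for every integer $n\ge N$, $\mathcal{T}r^{\mathrm{O}}_{w_1,\ldots,w_\ell}(n)$ is given by evaluating $\overline{\mathcal{T}r^{\mathrm{O}}_{w_1,\ldots,w_\ell}}$ at $n$.
   Context: $\mathbf{F}_r$ is the free group with basis $B=\{x_1,\ldots,x_r\}$; $w(g_1,\ldots,g_r)$ is obtained by substituting $g_i$ for $x_i$. The total unsigned exponent of $x\in B$ in $w_1,\ldots,w_\ell$ is the total number of occurrences of $x$ and $x^{-1}$ in the reduced forms of $w_1,\ldots,w_\ell$. With $\mu_n$ the Haar probability measure on the real orthogonal group $\mathrm{O}(n)$, $\mathcal{T}r^{\mathrm{O}}_{w_1,\ldots,w_\ell}(n)=\int_{\mathrm{O}(n)^r}\prod_{j=1}^{\ell}\mathrm{tr}(w_j(g_1,\ldots,g_r))\,d\mu_n(g_1)\cdots d\mu_n(g_r)$. $\mathbf{Q}(n)$ is the field of rational functions in $n$ with rational coefficients; "computable" means that it can be computed from the words by an explicit algorithm in finitely many steps. *)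

theory Defs
  imports
    "HOL-Probability.Probability"
    "HOL-Computational_Algebra.Computational_Algebra"
    "HOL-Computational_Algebra.Field_as_Ring"
    "HOL-Library.Nat_Bijection"
    "HOL-Algebra.Group"
    "Jordan_Normal_Form.Matrix"
begin

section \<open>Free groups\<close>

text \<open>The letter \<open>(i, True)\<close> is the basis element with index \<open>i\<close> and \<open>(i, False)\<close> is its
  inverse. The free group of rank \<open>r\<close> consists of the reduced words in the letters with index
  below \<open>r\<close>.\<close>

type_synonym letter = "nat \<times> bool"
type_synonym word = "letter list"

definition inv_letter :: "letter \<Rightarrow> letter" where
  "inv_letter a = (fst a, \<not> snd a)"

definition reduced :: "word \<Rightarrow> bool" where
  "reduced w \<longleftrightarrow> (\<forall>k. Suc k < length w \<longrightarrow> w ! Suc k \<noteq> inv_letter (w ! k))"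

fun reduced_Cons :: "letter \<Rightarrow> word \<Rightarrow> word" where
  "reduced_Cons a [] = [a]"
| "reduced_Cons a (b # w) = (if b = inv_letter a then w else a # b # w)"

definition free_group :: "nat \<Rightarrow> word monoid" where
  "free_group r =
    \<lparr>carrier = {w. reduced w \<and> (\<forall>a\<in>set w. fst a < r)},
     monoid.mult = (\<lambda>u v. foldr reduced_Cons u v),
     one = []\<rparr>"

lemma inv_letter_inv_letter [simp]: "inv_letter (inv_letter a) = a"
  by (simp add: inv_letter_def)

lemma fst_inv_letter [simp]: "fst (inv_letter a) = fst a"
  by (simp add: inv_letter_def)

lemma inv_letter_neq [simp]: "inv_letter a \<noteq> a"
  by (cases a) (simp add: inv_letter_def)

lemma reduced_Nil [simp]: "reduced []"
  by (simp add: reduced_def)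

lemma reduced_single [simp]: "reduced [a]"
  by (simp add: reduced_def)

lemma reduced_Cons_Cons [simp]:
  "reduced (a # b # w) \<longleftrightarrow> b \<noteq> inv_letter a \<and> reduced (b # w)"
  unfolding reduced_def
  by (auto simp: nth_Cons split: nat.splits)

lemma reduced_tl: "reduced (a # w) \<Longrightarrow> reduced w"
  by (cases w) auto

lemma reduced_reduced_Cons: "reduced w \<Longrightarrow> reduced (reduced_Cons a w)"
  by (cases w) (auto dest: reduced_tl)

lemma reduced_foldr: "reduced v \<Longrightarrow> reduced (foldr reduced_Cons u v)"
  by (induction u) (auto intro: reduced_reduced_Cons)

lemma set_reduced_Cons: "set (reduced_Cons a w) \<subseteq> insert a (set w)"
  by (cases w) auto

lemma set_foldr_reduced_Cons: "set (foldr reduced_Cons u v) \<subseteq> set u \<union> set v"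
  by (induction u) (use set_reduced_Cons in fastforce)+

lemma reduced_Cons_cancel:
  "reduced w \<Longrightarrow> reduced_Cons a (reduced_Cons (inv_letter a) w) = w"
proof (cases w)
  case (Cons b v)
  assume "reduced w"
  then show ?thesis using Cons by (cases v) auto
qed auto

lemma foldr_reduced_Cons_push:
  assumes "reduced v" "reduced w"
  shows "foldr reduced_Cons (reduced_Cons a v) w = reduced_Cons a (foldr reduced_Cons v w)"
proof (cases v)
  case (Cons b v')
  show ?thesis
  proof (cases "b = inv_letter a")
    case True
    then show ?thesis
      using Cons reduced_Cons_cancel[OF reduced_foldr[OF assms(2)], of a v'] by simp
  qed (use Cons in simp)
qed simp

lemma foldr_reduced_Cons_assoc:
  assumes "reduced v" "reduced w"
  shows "foldr reduced_Cons (foldr reduced_Cons u v) w = foldr reduced_Cons u (foldr reduced_Cons v w)"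
  by (induction u) (simp_all add: foldr_reduced_Cons_push reduced_foldr assms)

lemma foldr_reduced_Cons_Nil: "reduced w \<Longrightarrow> foldr reduced_Cons w [] = w"
proof (induction w)
  case (Cons a w)
  then have "foldr reduced_Cons w [] = w" by (blast dest: reduced_tl)
  with Cons.prems show ?case by (cases w) auto
qed simp

lemma foldr_inverse_word:
  "reduced v \<Longrightarrow> foldr reduced_Cons (rev (map inv_letter w)) (foldr reduced_Cons w v) = v"
proof (induction w)
  case (Cons a w)
  have "reduced_Cons (inv_letter a) (reduced_Cons a (foldr reduced_Cons w v)) = foldr reduced_Cons w v"
    using reduced_Cons_cancel[OF reduced_foldr[OF Cons.prems], of "inv_letter a" w] by simp
  with Cons show ?case by simp
qed simp

lemma group_free_group: "group (free_group r)"
proof (rule groupI)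
  fix u v assume "u \<in> carrier (free_group r)" "v \<in> carrier (free_group r)"
  then show "u \<otimes>\<^bsub>free_group r\<^esub> v \<in> carrier (free_group r)"
    using set_foldr_reduced_Cons[of u v] by (auto simp: free_group_def intro: reduced_foldr)
next
  fix u assume u: "u \<in> carrier (free_group r)"
  define v where "v = foldr reduced_Cons (rev (map inv_letter u)) []"
  have "v \<in> carrier (free_group r)"
    using u set_foldr_reduced_Cons[of "rev (map inv_letter u)" "[]"]
    by (fastforce simp: free_group_def v_def intro: reduced_foldr)
  moreover have "foldr reduced_Cons v u = []"
  proof -
    have "foldr reduced_Cons v u = foldr reduced_Cons (rev (map inv_letter u)) (foldr reduced_Cons u [])"
      using u foldr_reduced_Cons_assoc[of "[]" u]
      by (simp add: v_def free_group_def foldr_reduced_Cons_Nil)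
    then show ?thesis by (simp add: foldr_inverse_word)
  qed
  ultimately show "\<exists>v\<in>carrier (free_group r). v \<otimes>\<^bsub>free_group r\<^esub> u = \<one>\<^bsub>free_group r\<^esub>"
    by (auto simp: free_group_def)
qed (auto simp: free_group_def foldr_reduced_Cons_assoc)

definition word_eval :: "('a, 'b) monoid_scheme \<Rightarrow> (nat \<Rightarrow> 'a) \<Rightarrow> word \<Rightarrow> 'a" where
  "word_eval G g w =
    foldr (\<lambda>(i, s) h. (if s then g i else inv\<^bsub>G\<^esub> (g i)) \<otimes>\<^bsub>G\<^esub> h) w \<one>\<^bsub>G\<^esub>"

definition total_unsigned_exponent :: "nat \<Rightarrow> word list \<Rightarrow> nat" where
  "total_unsigned_exponent i ws = (\<Sum>w\<leftarrow>ws. length (filter (\<lambda>a. fst a = i) w))"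

text \<open>The element \<open>0\<close> is inserted only to cover \<open>r = 0\<close>.\<close>

definition max_half_exponent :: "nat \<Rightarrow> word list \<Rightarrow> nat" where
  "max_half_exponent r ws = Max (insert 0 ((\<lambda>i. total_unsigned_exponent i ws div 2) ` {..<r}))"


section \<open>Integration over the orthogonal group\<close>

definition orthogonal_group :: "nat \<Rightarrow> real mat monoid" where
  "orthogonal_group n =
    \<lparr>carrier = {A \<in> carrier_mat n n. transpose_mat A * A = 1\<^sub>m n},
     monoid.mult = (*),
     one = 1\<^sub>m n\<rparr>"

definition mat_trace :: "'a::comm_monoid_add mat \<Rightarrow> 'a" where
  "mat_trace A = (\<Sum>i<dim_row A. A $$ (i, i))"

text \<open>The Borel sets of the orthogonal group, as a subspace of the space of \<open>n \<times> n\<close> matrices,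
  are those generated by the matrix entries.\<close>

definition borel_orthogonal_group :: "nat \<Rightarrow> real mat measure" where
  "borel_orthogonal_group n =
    vimage_algebra (carrier (orthogonal_group n))
      (\<lambda>A. \<lambda>p\<in>{..<n} \<times> {..<n}. A $$ p) (\<Pi>\<^sub>M p\<in>{..<n} \<times> {..<n}. borel)"

definition haar_prob_orthogonal :: "nat \<Rightarrow> real mat measure \<Rightarrow> bool" where
  "haar_prob_orthogonal n \<mu> \<longleftrightarrow>
    prob_space \<mu> \<and> space \<mu> = carrier (orthogonal_group n) \<and> sets \<mu> = sets (borel_orthogonal_group n) \<and>
    (\<forall>g\<in>carrier (orthogonal_group n). distr \<mu> \<mu> (\<lambda>h. g \<otimes>\<^bsub>orthogonal_group n\<^esub> h) = \<mu>)"

definition trace_integral :: "nat \<Rightarrow> word list \<Rightarrow> nat \<Rightarrow> real mat measure \<Rightarrow> real" where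
  "trace_integral r ws n \<mu> =
    (\<integral>g. (\<Prod>w\<leftarrow>ws. mat_trace (word_eval (orthogonal_group n) g w)) \<partial>(\<Pi>\<^sub>M i\<in>{..<r}. \<mu>))"


section \<open>Rational functions\<close>

text \<open>Rational functions are evaluated through their representation in lowest terms.\<close>

definition ratfun_defined_at :: "rat poly fract \<Rightarrow> rat \<Rightarrow> bool" where
  "ratfun_defined_at f x \<longleftrightarrow> poly (snd (quot_of_fract f)) x \<noteq> 0"

definition ratfun_eval :: "rat poly fract \<Rightarrow> rat \<Rightarrow> rat" where
  "ratfun_eval f x = poly (fst (quot_of_fract f)) x / poly (snd (quot_of_fract f)) x"


section \<open>Computability\<close>

text \<open>Kleene's partial recursive functions: \<open>computes p xs y\<close> says that the program \<open>p\<close> halts on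
  the arguments \<open>xs\<close> with the value \<open>y\<close>.\<close>

datatype recf =
    Zero
  | Succ
  | Proj nat
  | Comp recf "recf list"
  | PrimRec recf recf
  | Mu recf

inductive computes :: "recf \<Rightarrow> nat list \<Rightarrow> nat \<Rightarrow> bool" where
  Zero: "computes Zero xs 0"
| Succ: "computes Succ [x] (Suc x)"
| Proj: "i < length xs \<Longrightarrow> computes (Proj i) xs (xs ! i)"
| Comp: "list_all2 (\<lambda>g y. computes g xs y) gs ys \<Longrightarrow> computes f ys z \<Longrightarrow> computes (Comp f gs) xs z"
| PrimRec_0: "computes f xs y \<Longrightarrow> computes (PrimRec f g) (0 # xs) y"
| PrimRec_Suc: "computes (PrimRec f g) (n # xs) y \<Longrightarrow> computes g (n # y # xs) z \<Longrightarrow>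
    computes (PrimRec f g) (Suc n # xs) z"
| Mu: "computes f (n # xs) 0 \<Longrightarrow> (\<And>m. m < n \<Longrightarrow> \<exists>k. computes f (m # xs) (Suc k)) \<Longrightarrow>
    computes (Mu f) xs n"

inductive_cases computes_ZeroE: "computes Zero xs y"
inductive_cases computes_SuccE: "computes Succ xs y"
inductive_cases computes_ProjE: "computes (Proj i) xs y"
inductive_cases computes_CompE: "computes (Comp f gs) xs y"
inductive_cases computes_PrimRec_0E: "computes (PrimRec f g) (0 # xs) y"
inductive_cases computes_PrimRec_SucE: "computes (PrimRec f g) (Suc n # xs) y"
inductive_cases computes_MuE: "computes (Mu f) xs y"

lemma computes_deterministic: "computes p xs y \<Longrightarrow> computes p xs z \<Longrightarrow> y = z"
proof (induction p xs y arbitrary: z rule: computes.induct)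
  case (Comp xs gs ys f y)
  from Comp.prems obtain ys' where ys': "list_all2 (\<lambda>g y. computes g xs y) gs ys'" "computes f ys' z"
    by (blast elim: computes_CompE)
  have "ys = ys'"
    using Comp.IH(1) ys'(1) by (auto simp: list_all2_conv_all_nth intro!: nth_equalityI)
  with ys' Comp.IH(2) show ?case by blast
next
  case (PrimRec_Suc f g n xs y u)
  from PrimRec_Suc.prems obtain y' where "computes (PrimRec f g) (n # xs) y'" "computes g (n # y' # xs) z"
    by (blast elim: computes_PrimRec_SucE)
  with PrimRec_Suc.IH show ?case by blast
next
  case (Mu f n xs)
  have z: "computes f (z # xs) 0" "\<And>m. m < z \<Longrightarrow> \<exists>k. computes f (m # xs) (Suc k)"
    using computes_MuE[OF Mu.prems] by metis+
  show ?case
  proof (rule linorder_cases)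
    assume "n < z"
    with z(2) Mu.IH(1) show ?thesis by fastforce
  next
    assume "z < n"
    with z(1) Mu.IH(2) show ?thesis by fastforce
  qed
qed (blast elim: computes_ZeroE computes_SuccE computes_ProjE computes_PrimRec_0E)+

definition total_recursive :: "(nat \<Rightarrow> nat) \<Rightarrow> bool" where
  "total_recursive f \<longleftrightarrow> (\<exists>p. \<forall>x. computes p [x] (f x))"

definition encode_letter :: "letter \<Rightarrow> nat" where
  "encode_letter a = prod_encode (fst a, of_bool (snd a))"

definition encode_words :: "word list \<Rightarrow> nat" where
  "encode_words ws = list_encode (map (\<lambda>w. list_encode (map encode_letter w)) ws)"

text \<open>A code for a rational function lists the integer coefficients of a numerator and of a
  denominator; every element of \<open>\<rat>(n)\<close> has such a code.\<close>

definition decode_int_poly :: "nat \<Rightarrow> rat poly" where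
  "decode_int_poly c = Poly (map (\<lambda>k. of_int (int_decode k)) (list_decode c))"

definition decode_ratfun :: "nat \<Rightarrow> rat poly fract" where
  "decode_ratfun c = (case prod_decode c of (a, b) \<Rightarrow> Fract (decode_int_poly a) (decode_int_poly b))"

definition computable_from_words :: "(word list \<Rightarrow> rat poly fract) \<Rightarrow> bool" where
  "computable_from_words F \<longleftrightarrow>
    (\<exists>f. total_recursive f \<and> (\<forall>ws. F ws = decode_ratfun (f (encode_words ws))))"

end

theory Submission
  imports Defs "Jordan_Normal_Form.Determinant"
begin

text \<open>Expanding the traces turns the integrand into a sum, over indices attached to the letters of
  the words, of products of matrix entries. For a fixed column index, left invariance of the Haar
  measure makes the moments an invariant tensor in the row index; such a tensor is a linear combination
  of the tensors \<open>\<delta>\<^sub>p\<close> given by the label-preserving pairings \<open>p\<close> of the letters. Orthogonality of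
  the columns then determines the coefficients by a linear system with the Gram matrix
  \<open>G(p, q) = n ^ k(p, q)\<close> of the \<open>\<delta>\<^sub>p\<close>, which for \<open>n \<ge> N\<close> are linearly independent because there is an
  index taking different values on different pairs. Hence the integral is a rational function with
  denominator \<open>det G\<close>. It is computed by an unbounded search for polynomials \<open>D \<noteq> 0\<close> and \<open>V\<close> with
  \<open>V G = D\<close>.\<close>

subsection \<open>Recursive functions of several arguments\<close>

text \<open>The range \<open>n \<ge> N\<close> shapes the argument. The description of the
  invariants uses three kinds of test matrices, chosen separately for each label: permutations make
  a tensor depend only on which positions share a value, sign changes kill odd fibers, and one
  orthogonal block with entries 3/5 and 4/5 splits fibers of four or more positions. Splitting needs
  a free value, and an index that separates pairs needs one value per pair; both are available when
  no label occupies more than \<open>2 * n\<close> positions. Labels never compete for values, hence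
  a maximum over the basis and not a sum. Computability asks for one algorithm for all words.
  Checking \<open>V G = D\<close> at enough integers takes only bounded sums and comparisons, so no
  determinant has to be computed; the adjugate merely shows that the search ends. The
  \<open>D\<close> that is found need not be \<open>det G\<close>, so the quotient has to be
  compared with the one given by the adjugate.\<close>

definition recursive_fun :: "nat \<Rightarrow> (nat list \<Rightarrow> nat) \<Rightarrow> bool" where
  "recursive_fun k f \<longleftrightarrow> (\<exists>p. \<forall>xs. length xs = k \<longrightarrow> computes p xs (f xs))"

lemma recursive_fun_0: "recursive_fun k (\<lambda>_. 0)"
  unfolding recursive_fun_def by (blast intro: computes.Zero)

lemma recursive_fun_nth: "i < k \<Longrightarrow> recursive_fun k (\<lambda>xs. xs ! i)"
  unfolding recursive_fun_def by (blast intro: computes.Proj)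

lemma recursive_fun_comp:
  assumes "recursive_fun (length gs) f" "\<And>g. g \<in> set gs \<Longrightarrow> recursive_fun k g"
  shows "recursive_fun k (\<lambda>xs. f (map (\<lambda>g. g xs) gs))"
proof -
  obtain p where p: "\<And>xs. length xs = length gs \<Longrightarrow> computes p xs (f xs)"
    using assms(1) by (auto simp: recursive_fun_def)
  obtain q where q: "\<And>g xs. g \<in> set gs \<Longrightarrow> length xs = k \<Longrightarrow> computes (q g) xs (g xs)"
    using assms(2) unfolding recursive_fun_def by metis
  have "computes (Comp p (map q gs)) xs (f (map (\<lambda>g. g xs) gs))" if "length xs = k" for xs
    by (rule computes.Comp[where ys = "map (\<lambda>g. g xs) gs"])
       (use that p q in \<open>auto simp: list_all2_conv_all_nth\<close>)
  then show ?thesis unfolding recursive_fun_def by blast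
qed

lemma recursive_fun_comp1:
  "recursive_fun 1 (\<lambda>xs. f (xs ! 0)) \<Longrightarrow> recursive_fun k g \<Longrightarrow> recursive_fun k (\<lambda>xs. f (g xs))"
  using recursive_fun_comp[of "[g]" "\<lambda>xs. f (xs ! 0)" k] by simp

lemma recursive_fun_comp2:
  "recursive_fun 2 (\<lambda>xs. f (xs ! 0) (xs ! 1)) \<Longrightarrow> recursive_fun k g \<Longrightarrow> recursive_fun k h \<Longrightarrow>
    recursive_fun k (\<lambda>xs. f (g xs) (h xs))"
  using recursive_fun_comp[of "[g, h]" "\<lambda>xs. f (xs ! 0) (xs ! 1)" k] by (auto simp: numeral_2_eq_2)

lemma recursive_fun_Suc: "recursive_fun k f \<Longrightarrow> recursive_fun k (\<lambda>xs. Suc (f xs))"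
proof (rule recursive_fun_comp1[of Suc])
  have "computes Succ xs (Suc (xs ! 0))" if "length xs = 1" for xs
    using that computes.Succ by (cases xs) auto
  then show "recursive_fun 1 (\<lambda>xs. Suc (xs ! 0))" unfolding recursive_fun_def by blast
qed

lemma recursive_fun_rec_nat_1:
  assumes "recursive_fun 2 (\<lambda>xs. g (xs ! 0) (xs ! 1))"
  shows "recursive_fun 1 (\<lambda>xs. rec_nat 0 g (xs ! 0))"
proof -
  obtain q where q: "\<And>xs. length xs = 2 \<Longrightarrow> computes q xs (g (xs ! 0) (xs ! 1))"
    using assms unfolding recursive_fun_def by metis
  have "computes (PrimRec Zero q) [n] (rec_nat 0 g n)" for n
  proof (induction n)
    case (Suc n)
    from computes.PrimRec_Suc[OF Suc] q[of "[n, rec_nat 0 g n]"] show ?case by simp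
  qed (auto intro: computes.intros)
  then have "computes (PrimRec Zero q) xs (rec_nat 0 g (xs ! 0))" if "length xs = 1" for xs
    using that by (cases xs) auto
  then show ?thesis unfolding recursive_fun_def by blast
qed

lemma recursive_fun_rec_nat_2:
  assumes "recursive_fun 1 (\<lambda>xs. f (xs ! 0))" "recursive_fun 3 (\<lambda>xs. g (xs ! 0) (xs ! 1) (xs ! 2))"
  shows "recursive_fun 2 (\<lambda>xs. rec_nat (f (xs ! 1)) (\<lambda>n y. g n y (xs ! 1)) (xs ! 0))"
proof -
  obtain p where p: "\<And>xs. length xs = 1 \<Longrightarrow> computes p xs (f (xs ! 0))"
    using assms unfolding recursive_fun_def by metis
  obtain q where q: "\<And>xs. length xs = 3 \<Longrightarrow> computes q xs (g (xs ! 0) (xs ! 1) (xs ! 2))"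
    using assms unfolding recursive_fun_def by metis
  have "computes (PrimRec p q) [n, x] (rec_nat (f x) (\<lambda>n y. g n y x) n)" for n x
  proof (induction n)
    case 0
    from computes.PrimRec_0[OF p[of "[x]"]] show ?case by simp
  next
    case (Suc n)
    from computes.PrimRec_Suc[OF Suc] q[of "[n, rec_nat (f x) (\<lambda>n y. g n y x) n, x]"]
    show ?case by simp
  qed
  then have "computes (PrimRec p q) xs (rec_nat (f (xs ! 1)) (\<lambda>n y. g n y (xs ! 1)) (xs ! 0))"
    if "length xs = 2" for xs
    using that by (cases xs; cases "tl xs") auto
  then show ?thesis unfolding recursive_fun_def by blast
qed

text \<open>Existence of a zero makes the unbounded search total. Below the least zero every value
  is a successor, which is what the rule for \<open>Mu\<close> demands.\<close>

lemma recursive_fun_Least: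
  assumes "recursive_fun 2 (\<lambda>xs. f (xs ! 0) (xs ! 1))" "\<And>x. \<exists>n. f n x = 0"
  shows "recursive_fun 1 (\<lambda>xs. LEAST n. f n (xs ! 0) = 0)"
proof -
  obtain q where q: "\<And>xs. length xs = 2 \<Longrightarrow> computes q xs (f (xs ! 0) (xs ! 1))"
    using assms unfolding recursive_fun_def by metis
  have "computes (Mu q) [x] (LEAST n. f n x = 0)" for x
  proof (rule computes.Mu)
    show "computes q [LEAST n. f n x = 0, x] 0"
      using q[of "[LEAST n. f n x = 0, x]"] LeastI_ex[OF assms(2), of x] by simp
  next
    fix m assume "m < (LEAST n. f n x = 0)"
    then obtain k where "f m x = Suc k" using not_less_Least not0_implies_Suc by blast
    then show "\<exists>k. computes q [m, x] (Suc k)" using q[of "[m, x]"] by auto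
  qed
  then have "computes (Mu q) xs (LEAST n. f n (xs ! 0) = 0)" if "length xs = 1" for xs
    using that by (cases xs) auto
  then show ?thesis unfolding recursive_fun_def by blast
qed

lemma recursive_fun_add:
  assumes "recursive_fun k f" "recursive_fun k g"
  shows "recursive_fun k (\<lambda>xs. f xs + g xs)"
proof -
  have eq: "a + b = rec_nat b (\<lambda>n y. Suc y) a" for a b :: nat by (induction a) auto
  have "recursive_fun 2 (\<lambda>xs. rec_nat (xs ! 1) (\<lambda>n y. Suc y) (xs ! 0))"
    by (rule recursive_fun_rec_nat_2[where f = "\<lambda>x. x" and g = "\<lambda>n y x. Suc y"])
       (intro recursive_fun_Suc recursive_fun_nth; simp)+
  then show ?thesis unfolding eq by (rule recursive_fun_comp2) (use assms in auto)
qed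

lemma recursive_fun_diff:
  assumes "recursive_fun k f" "recursive_fun k g"
  shows "recursive_fun k (\<lambda>xs. f xs - g xs)"
proof -
  \<comment> \<open>Truncated subtraction is an iterated predecessor, and the predecessor is a
    recursion that discards its accumulator and returns the counter.\<close>
  have pred: "a - 1 = rec_nat 0 (\<lambda>n y. n) a" for a :: nat by (cases a) auto
  have "recursive_fun 1 (\<lambda>xs. rec_nat 0 (\<lambda>n y. n) (xs ! 0))"
    by (rule recursive_fun_rec_nat_1) (auto intro: recursive_fun_nth)
  then have 1: "recursive_fun k f \<Longrightarrow> recursive_fun k (\<lambda>xs. f xs - 1)" for k f
    unfolding pred by (rule recursive_fun_comp1)
  have eq: "rec_nat b (\<lambda>n y. y - 1) a = b - a" for a b :: nat by (induction a) auto
  have "recursive_fun 2 (\<lambda>xs. rec_nat (xs ! 1) (\<lambda>n y. y - 1) (xs ! 0))"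
    by (rule recursive_fun_rec_nat_2[where f = "\<lambda>x. x" and g = "\<lambda>n y x. y - 1"])
       (intro 1 recursive_fun_nth; simp)+
  from this[unfolded eq] show ?thesis by (rule recursive_fun_comp2) (use assms in auto)
qed

lemma recursive_fun_triangle:
  assumes "recursive_fun k f"
  shows "recursive_fun k (\<lambda>xs. triangle (f xs))"
proof -
  have eq: "triangle a = rec_nat 0 (\<lambda>n y. y + Suc n) a" for a :: nat by (induction a) auto
  have "recursive_fun 1 (\<lambda>xs. rec_nat 0 (\<lambda>n y. y + Suc n) (xs ! 0))"
    by (rule recursive_fun_rec_nat_1)
       (auto intro!: recursive_fun_nth recursive_fun_add recursive_fun_Suc)
  then show ?thesis unfolding eq by (rule recursive_fun_comp1) (use assms in auto)
qed

subsection \<open>Total recursive functions of one argument\<close>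

abbreviation pair :: "nat \<Rightarrow> nat \<Rightarrow> nat" where "pair a b \<equiv> prod_encode (a, b)"
definition pfst :: "nat \<Rightarrow> nat" where "pfst z = fst (prod_decode z)"
definition psnd :: "nat \<Rightarrow> nat" where "psnd z = snd (prod_decode z)"

lemma pfst_pair [simp]: "pfst (pair a b) = a"
  and psnd_pair [simp]: "psnd (pair a b) = b"
  and pair_pfst_psnd [simp]: "pair (pfst z) (psnd z) = z"
  by (simp_all add: pfst_def psnd_def)

lemma total_recursive_iff: "total_recursive f \<longleftrightarrow> recursive_fun 1 (\<lambda>xs. f (xs ! 0))"
proof
  assume "total_recursive f"
  then obtain p where p: "\<And>x. computes p [x] (f x)" by (auto simp: total_recursive_def)
  have "computes p xs (f (xs ! 0))" if "length xs = 1" for xs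
    using that p by (cases xs) auto
  then show "recursive_fun 1 (\<lambda>xs. f (xs ! 0))" unfolding recursive_fun_def by blast
next
  assume "recursive_fun 1 (\<lambda>xs. f (xs ! 0))"
  then obtain p where p: "\<And>xs. length xs = 1 \<Longrightarrow> computes p xs (f (xs ! 0))"
    by (auto simp: recursive_fun_def)
  from p[of "[x]" for x] show "total_recursive f" by (auto simp: total_recursive_def)
qed

text \<open>Inverts \<open>pair a b = triangle (a + b) + a\<close>: the diagonal
  \<open>a + b\<close> is the least \<open>s\<close> with \<open>z < triangle (Suc s)\<close>. The
  truncated difference states this inequality in the form that minimization accepts.\<close>

lemma triangle_root:
  "(LEAST s. Suc z - triangle (Suc s) = 0) = pfst z + psnd z"
proof (rule Least_equality)
  have z: "z = triangle (pfst z + psnd z) + pfst z"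
    using pair_pfst_psnd[of z] unfolding prod_encode_def by simp
  then show "Suc z - triangle (Suc (pfst z + psnd z)) = 0" by simp
  fix s assume "Suc z - triangle (Suc s) = 0"
  then have s: "z < triangle (Suc s)" by simp
  have mono: "triangle a \<le> triangle b" if "a \<le> b" for a b
    using that by (induction rule: dec_induct) auto
  show "pfst z + psnd z \<le> s"
  proof (rule ccontr)
    assume "\<not> pfst z + psnd z \<le> s"
    then have "triangle (Suc s) \<le> triangle (pfst z + psnd z)" by (intro mono) simp
    with s z show False by simp
  qed
qed

lemma total_recursive_pfst: "total_recursive pfst"
  and total_recursive_psnd: "total_recursive psnd"
proof -
  have r: "recursive_fun 1 (\<lambda>xs. LEAST s. Suc (xs ! 0) - triangle (Suc s) = 0)"
  proof (rule recursive_fun_Least)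
    show "\<exists>n. Suc x - triangle (Suc n) = 0" for x by (rule exI[of _ x]) simp
  qed (intro recursive_fun_diff recursive_fun_Suc recursive_fun_triangle recursive_fun_nth; simp)+
  have 1: "pfst z = z - triangle (LEAST s. Suc z - triangle (Suc s) = 0)" for z
    unfolding triangle_root using pair_pfst_psnd[of z] unfolding prod_encode_def by simp
  have 2: "psnd z = (LEAST s. Suc z - triangle (Suc s) = 0) - pfst z" for z
    unfolding triangle_root by simp
  show *: "total_recursive pfst"
    unfolding total_recursive_iff 1
    by (intro recursive_fun_diff recursive_fun_nth recursive_fun_triangle r) auto
  show "total_recursive psnd"
    unfolding total_recursive_iff 2
    by (intro recursive_fun_diff recursive_fun_nth r *[unfolded total_recursive_iff])
qed

text \<open>The closure rules collected here follow the syntax of a term. A binder adds its variable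
  to the single argument by pairing, so its body becomes a function of \<open>pfst z\<close> and
  \<open>psnd z\<close>.\<close>

named_theorems rec_intros

lemma total_recursive_comp: "total_recursive f \<Longrightarrow> total_recursive g \<Longrightarrow> total_recursive (\<lambda>x. f (g x))"
  unfolding total_recursive_iff by (rule recursive_fun_comp1)

lemma total_recursive_id [rec_intros]: "total_recursive (\<lambda>x. x)"
  by (simp add: total_recursive_iff recursive_fun_nth)

lemma total_recursive_Suc [rec_intros]: "total_recursive f \<Longrightarrow> total_recursive (\<lambda>x. Suc (f x))"
  by (simp add: total_recursive_iff recursive_fun_Suc)

lemma total_recursive_const [rec_intros]: "total_recursive (\<lambda>x. c)"
  by (induction c) (auto simp: total_recursive_iff recursive_fun_Suc recursive_fun_0)

lemma total_recursive_add [rec_intros]: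
  "total_recursive f \<Longrightarrow> total_recursive g \<Longrightarrow> total_recursive (\<lambda>x. f x + g x)"
  by (simp add: total_recursive_iff recursive_fun_add)

lemma total_recursive_diff [rec_intros]:
  "total_recursive f \<Longrightarrow> total_recursive g \<Longrightarrow> total_recursive (\<lambda>x. f x - g x)"
  by (simp add: total_recursive_iff recursive_fun_diff)

lemma total_recursive_pair [rec_intros]:
  "total_recursive f \<Longrightarrow> total_recursive g \<Longrightarrow> total_recursive (\<lambda>x. pair (f x) (g x))"
  by (simp add: total_recursive_iff prod_encode_def recursive_fun_add recursive_fun_triangle)

lemmas total_recursive_pfst' [rec_intros] = total_recursive_comp[OF total_recursive_pfst]
lemmas total_recursive_psnd' [rec_intros] = total_recursive_comp[OF total_recursive_psnd]

text \<open>Parameter, counter and accumulator travel in one number,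
  \<open>pair (pair x i) y\<close>, which makes recursion with a parameter available to unary
  functions.\<close>

lemma total_recursive_rec_nat [rec_intros]:
  assumes f: "total_recursive f" and n: "total_recursive n"
    and g: "total_recursive (\<lambda>z. g (pfst (pfst z)) (psnd (pfst z)) (psnd z))"
  shows "total_recursive (\<lambda>x. rec_nat (f x) (\<lambda>i y. g x i y) (n x))"
proof -
  have r: "recursive_fun 3 (\<lambda>xs. g (xs ! 2) (xs ! 0) (xs ! 1))"
  proof -
    let ?z = "\<lambda>xs. pair (pair (xs ! 2) (xs ! 0)) (xs ! 1)"
    have "recursive_fun 3 (\<lambda>xs. (\<lambda>z. g (pfst (pfst z)) (psnd (pfst z)) (psnd z)) (?z xs))"
      by (rule recursive_fun_comp1[OF g[unfolded total_recursive_iff]])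
         (auto simp: prod_encode_def intro!: recursive_fun_add recursive_fun_triangle recursive_fun_nth)
    then show ?thesis by simp
  qed
  have "recursive_fun 2 (\<lambda>xs. rec_nat (f (xs ! 1)) (\<lambda>i y. g (xs ! 1) i y) (xs ! 0))"
    by (rule recursive_fun_rec_nat_2[OF f[unfolded total_recursive_iff], of "\<lambda>n y x. g x n y"]) (rule r)
  from recursive_fun_comp2[OF this n[unfolded total_recursive_iff] total_recursive_id[unfolded total_recursive_iff]]
  show ?thesis by (simp add: total_recursive_iff)
qed

lemma total_recursive_Least:
  assumes f: "total_recursive (\<lambda>z. f (pfst z) (psnd z))" and ex: "\<And>x. \<exists>n. f x n = 0"
  shows "total_recursive (\<lambda>x. LEAST n. f x n = 0)"
proof -
  have "recursive_fun 2 (\<lambda>xs. (\<lambda>z. f (pfst z) (psnd z)) (pair (xs ! 1) (xs ! 0)))"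
    by (rule recursive_fun_comp1[OF f[unfolded total_recursive_iff]])
       (auto simp: prod_encode_def intro!: recursive_fun_add recursive_fun_triangle recursive_fun_nth)
  then have "recursive_fun 2 (\<lambda>xs. (\<lambda>n x. f x n) (xs ! 0) (xs ! 1))" by simp
  from recursive_fun_Least[OF this ex] show ?thesis by (simp add: total_recursive_iff)
qed

lemma total_recursive_sum [rec_intros]:
  assumes "total_recursive n" "total_recursive (\<lambda>z. f (pfst z) (psnd z))"
  shows "total_recursive (\<lambda>x. \<Sum>i<n x. f x i)"
proof -
  have eq: "(\<Sum>i<m. f x i) = rec_nat 0 (\<lambda>i y. y + f x i) m" for x m
    by (induction m) auto
  have "total_recursive (\<lambda>x. f (pfst (pfst x)) (psnd (pfst x)))"
    using total_recursive_comp[OF assms(2) total_recursive_pfst] .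
  then show ?thesis unfolding eq by (intro rec_intros assms)
qed

lemma total_recursive_mult [rec_intros]:
  assumes "total_recursive f" "total_recursive g"
  shows "total_recursive (\<lambda>x. f x * g x)"
proof -
  have eq: "f x * g x = (\<Sum>i<f x. g x)" for x by simp
  show ?thesis unfolding eq by (intro rec_intros assms assms[THEN total_recursive_comp])
qed

lemma total_recursive_power [rec_intros]:
  assumes "total_recursive f" "total_recursive g"
  shows "total_recursive (\<lambda>x. f x ^ g x)"
proof -
  have eq: "a ^ b = rec_nat 1 (\<lambda>_ y. a * y) b" for a b :: nat by (induction b) auto
  show ?thesis unfolding eq by (intro rec_intros assms assms[THEN total_recursive_comp])
qed

subsection \<open>Decidable predicates\<close>

definition decidable :: "(nat \<Rightarrow> bool) \<Rightarrow> bool" where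
  "decidable P \<longleftrightarrow> total_recursive (\<lambda>x. of_bool (P x))"

lemma total_recursive_of_bool [rec_intros]:
  "decidable P \<Longrightarrow> total_recursive (\<lambda>x. of_bool (P x))"
  by (simp add: decidable_def)

lemma decidable_le [rec_intros]:
  assumes "total_recursive f" "total_recursive g" shows "decidable (\<lambda>x. f x \<le> g x)"
proof -
  have eq: "of_bool (f x \<le> g x) = 1 - (f x - g x)" for x by auto
  show ?thesis unfolding decidable_def eq by (intro rec_intros assms)
qed

lemma decidable_less [rec_intros]:
  "total_recursive f \<Longrightarrow> total_recursive g \<Longrightarrow> decidable (\<lambda>x. f x < g x)"
  unfolding Suc_le_eq[symmetric] by (intro rec_intros)

lemma decidable_not [rec_intros]:
  assumes "decidable P" shows "decidable (\<lambda>x. \<not> P x)"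
proof -
  have eq: "of_bool (\<not> P x) = 1 - (of_bool (P x) :: nat)" for x by auto
  show ?thesis unfolding decidable_def eq by (intro rec_intros assms)
qed

lemma decidable_conj [rec_intros]:
  assumes "decidable P" "decidable Q" shows "decidable (\<lambda>x. P x \<and> Q x)"
  unfolding decidable_def of_bool_conj by (intro rec_intros assms)

lemma decidable_disj [rec_intros]:
  assumes "decidable P" "decidable Q" shows "decidable (\<lambda>x. P x \<or> Q x)"
proof -
  have eq: "P x \<or> Q x \<longleftrightarrow> \<not> (\<not> P x \<and> \<not> Q x)" for x by auto
  show ?thesis unfolding eq by (intro rec_intros assms)
qed

lemma decidable_imp [rec_intros]:
  assumes "decidable P" "decidable Q" shows "decidable (\<lambda>x. P x \<longrightarrow> Q x)"
  unfolding imp_conv_disj by (intro rec_intros assms)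

lemma decidable_if [rec_intros]:
  assumes "decidable P" "decidable Q" "decidable R"
  shows "decidable (\<lambda>x. if P x then Q x else R x)"
  unfolding if_bool_eq_conj by (intro rec_intros assms)

lemma decidable_eq [rec_intros]:
  assumes "total_recursive f" "total_recursive g" shows "decidable (\<lambda>x. f x = g x)"
  unfolding eq_iff by (intro rec_intros assms)

lemma decidable_ball [rec_intros]:
  assumes "total_recursive n" "decidable (\<lambda>z. P (pfst z) (psnd z))"
  shows "decidable (\<lambda>x. \<forall>i<n x. P x i)"
proof -
  have eq: "(\<forall>i<n x. P x i) \<longleftrightarrow> (\<Sum>i<n x. of_bool (\<not> P x i)) = (0 :: nat)" for x by auto
  show ?thesis unfolding eq by (intro rec_intros assms)
qed

lemma decidable_bex [rec_intros]:
  assumes "total_recursive n" "decidable (\<lambda>z. P (pfst z) (psnd z))"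
  shows "decidable (\<lambda>x. \<exists>i<n x. P x i)"
proof -
  have eq: "(\<exists>i<n x. P x i) \<longleftrightarrow> \<not> (\<forall>i<n x. \<not> P x i)" for x by auto
  show ?thesis unfolding eq by (intro rec_intros assms)
qed

lemma total_recursive_if [rec_intros]:
  assumes "decidable P" "total_recursive f" "total_recursive g"
  shows "total_recursive (\<lambda>x. if P x then f x else g x)"
proof -
  have eq: "(if P x then f x else g x) = of_bool (P x) * f x + of_bool (\<not> P x) * g x" for x by auto
  show ?thesis unfolding eq by (intro rec_intros assms)
qed

lemma total_recursive_div [rec_intros]:
  assumes "total_recursive f" "total_recursive g" shows "total_recursive (\<lambda>x. f x div g x)"
proof -
  \<comment> \<open>The quotient counts the positive multiples of \<open>b\<close> up to
    \<open>a\<close>, of which there are at most \<open>a\<close> when \<open>b > 0\<close>.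
    Division by \<open>0\<close> has the value \<open>0\<close>.\<close>
  have eq: "a div b = (if b = 0 then 0 else (\<Sum>i<a. of_bool (Suc i * b \<le> a)))" for a b :: nat
  proof (cases "b = 0")
    case False
    have le: "Suc i * b \<le> a \<longleftrightarrow> i < a div b" for i
      using less_eq_div_iff_mult_less_eq[of b "Suc i" a] False by linarith
    have "{i. i < a \<and> Suc i * b \<le> a} = {..<a div b}"
      unfolding le by (auto intro: less_le_trans[OF _ div_le_dividend])
    then have "card {i. i < a \<and> Suc i * b \<le> a} = a div b" by simp
    moreover have "(\<Sum>i<a. of_bool (Suc i * b \<le> a)) = card {i. i < a \<and> Suc i * b \<le> a}"
      by (subst sum_of_bool_eq) (auto intro: arg_cong[where f = card])
    ultimately show ?thesis using False by simp
  qed simp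
  show ?thesis unfolding eq by (intro rec_intros assms assms[THEN total_recursive_comp])
qed

lemma total_recursive_mod [rec_intros]:
  assumes "total_recursive f" "total_recursive g" shows "total_recursive (\<lambda>x. f x mod g x)"
  unfolding minus_mult_div_eq_mod[symmetric] by (intro rec_intros assms)

lemma total_recursive_LEAST:
  assumes "decidable (\<lambda>z. P (pfst z) (psnd z))" "\<And>x. \<exists>n. P x n"
  shows "total_recursive (\<lambda>x. LEAST n. P x n)"
  using total_recursive_Least[of "\<lambda>x n. of_bool (\<not> P x n)"] assms
  by (simp add: decidable_not flip: decidable_def)

subsection \<open>Integer-valued recursive functions\<close>

text \<open>As differences of natural numbers, integers need no sign coding: sums and products stay
  differences, and equality becomes an equation between natural numbers.\<close>

definition recursive_int :: "(nat \<Rightarrow> int) \<Rightarrow> bool" where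
  "recursive_int f \<longleftrightarrow> (\<exists>a b. total_recursive a \<and> total_recursive b \<and> (\<forall>x. f x = int (a x) - int (b x)))"

lemma recursive_intI:
  "total_recursive a \<Longrightarrow> total_recursive b \<Longrightarrow> (\<And>x. f x = int (a x) - int (b x)) \<Longrightarrow> recursive_int f"
  by (auto simp: recursive_int_def)

lemma recursive_intE:
  assumes "recursive_int f"
  obtains a b where "total_recursive a" "total_recursive b" "\<And>x. f x = int (a x) - int (b x)"
  using assms by (auto simp: recursive_int_def)

lemma recursive_int_of_nat [rec_intros]: "total_recursive f \<Longrightarrow> recursive_int (\<lambda>x. int (f x))"
  by (rule recursive_intI[of f "\<lambda>_. 0"]) (auto intro: rec_intros)

lemma recursive_int_0 [rec_intros]: "recursive_int (\<lambda>x. 0)"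
  by (rule recursive_intI[of "\<lambda>_. 0" "\<lambda>_. 0"]) (auto intro: rec_intros)

lemma recursive_int_of_bool [rec_intros]: "decidable P \<Longrightarrow> recursive_int (\<lambda>x. of_bool (P x))"
  by (rule recursive_intI[of "\<lambda>x. of_bool (P x)" "\<lambda>_. 0"]) (auto intro: rec_intros)

lemma recursive_int_mult [rec_intros]:
  assumes "recursive_int f" "recursive_int g" shows "recursive_int (\<lambda>x. f x * g x)"
  using assms
proof (elim recursive_intE)
  fix a b c d assume *: "total_recursive a" "total_recursive b" "\<And>x. f x = int (a x) - int (b x)"
    "total_recursive c" "total_recursive d" "\<And>x. g x = int (c x) - int (d x)"
  show ?thesis
  proof (rule recursive_intI)
    show "total_recursive (\<lambda>x. a x * c x + b x * d x)" "total_recursive (\<lambda>x. a x * d x + b x * c x)"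
      by (intro rec_intros *)+
  qed (simp add: * algebra_simps)
qed

lemma recursive_int_sum [rec_intros]:
  assumes n: "total_recursive n" and f: "recursive_int (\<lambda>z. f (pfst z) (psnd z))"
  shows "recursive_int (\<lambda>x. \<Sum>i<n x. f x i)"
  using f
proof (rule recursive_intE)
  fix a b assume *: "total_recursive a" "total_recursive b"
    "\<And>z. f (pfst z) (psnd z) = int (a z) - int (b z)"
  have eq: "f x i = int (a (pair x i)) - int (b (pair x i))" for x i
    using *(3)[of "pair x i"] by simp
  show ?thesis
  proof (rule recursive_intI)
    show "total_recursive (\<lambda>x. \<Sum>i<n x. a (pair x i))" "total_recursive (\<lambda>x. \<Sum>i<n x. b (pair x i))"
      by (intro rec_intros n *(1,2)[THEN total_recursive_comp])+
  qed (simp add: eq sum_subtractf)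
qed

lemma decidable_int_eq [rec_intros]:
  assumes "recursive_int f" "recursive_int g" shows "decidable (\<lambda>x. f x = g x)"
  using assms
proof (elim recursive_intE)
  fix a b c d assume *: "total_recursive a" "total_recursive b" "\<And>x. f x = int (a x) - int (b x)"
    "total_recursive c" "total_recursive d" "\<And>x. g x = int (c x) - int (d x)"
  have eq: "f x = g x \<longleftrightarrow> a x + d x = c x + b x" for x unfolding * by auto
  show ?thesis unfolding eq by (intro rec_intros *)
qed

lemma recursive_int_int_decode [rec_intros]:
  assumes "total_recursive f" shows "recursive_int (\<lambda>x. int_decode (f x))"
proof (rule recursive_intI)
  \<comment> \<open>Even codes \<open>2 * k\<close> stand for \<open>k\<close>, odd codes
    \<open>2 * k + 1\<close> for \<open>- k - 1\<close>.\<close>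
  show "int_decode (f x) = int (if f x mod 2 = 0 then f x div 2 else 0)
      - int (if f x mod 2 = 0 then 0 else Suc (f x div 2))" for x
    by (simp add: int_decode_def sum_decode_def even_iff_mod_2_eq_zero)
qed (intro rec_intros assms)+

subsection \<open>List codes\<close>

text \<open>A nonempty list has the code \<open>Suc (pair x c)\<close> with head \<open>x\<close>
  and tail code \<open>c\<close>; the empty list has code \<open>0\<close>. Since
  \<open>psnd (0 - 1) = 0\<close>, dropping too many elements gives \<open>0\<close>.\<close>

definition drop_code :: "nat \<Rightarrow> nat \<Rightarrow> nat" where
  "drop_code c k = ((\<lambda>y. psnd (y - 1)) ^^ k) c"

definition nth_code :: "nat \<Rightarrow> nat \<Rightarrow> nat" where
  "nth_code c k = pfst (drop_code c k - 1)"

lemma total_recursive_drop_code [rec_intros]: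
  assumes "total_recursive f" "total_recursive g" shows "total_recursive (\<lambda>x. drop_code (f x) (g x))"
proof -
  have eq: "drop_code c k = rec_nat c (\<lambda>_ y. psnd (y - 1)) k" for c k
    by (induction k) (simp_all add: drop_code_def)
  show ?thesis unfolding eq by (intro rec_intros assms)
qed

lemma total_recursive_nth_code [rec_intros]:
  "total_recursive f \<Longrightarrow> total_recursive g \<Longrightarrow> total_recursive (\<lambda>x. nth_code (f x) (g x))"
  unfolding nth_code_def by (intro rec_intros)

lemma prod_decode_0 [simp]: "prod_decode 0 = (0, 0)"
  using prod_encode_inverse[of "(0, 0)"] by (simp add: prod_encode_def)

lemma drop_code_list_encode: "drop_code (list_encode xs) k = list_encode (drop k xs)"
proof (induction k arbitrary: xs)
  case (Suc k)
  show ?case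
  proof (cases xs)
    case Nil
    then show ?thesis using Suc[of "[]"] by (simp add: drop_code_def funpow_Suc_right psnd_def del: funpow.simps)
  next
    case (Cons y ys)
    then show ?thesis using Suc[of ys] by (simp add: drop_code_def funpow_Suc_right del: funpow.simps)
  qed
qed (simp add: drop_code_def)

lemma drop_code_neq_0_iff: "drop_code c k \<noteq> 0 \<longleftrightarrow> k < length (list_decode c)"
proof -
  have *: "list_encode ys = 0 \<longleftrightarrow> ys = []" for ys by (cases ys) auto
  show ?thesis using drop_code_list_encode[of "list_decode c" k] by (simp add: * not_le)
qed

lemma drop_code_eq_0_iff: "drop_code c k = 0 \<longleftrightarrow> length (list_decode c) \<le> k"
  using drop_code_neq_0_iff[of c k] by linarith

lemma nth_code_list_encode:
  "nth_code (list_encode xs) k = (if k < length xs then xs ! k else 0)"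
  by (auto simp: nth_code_def drop_code_list_encode Cons_nth_drop_Suc[symmetric] pfst_def)

lemma nth_code_eq: "nth_code c k = (if k < length (list_decode c) then list_decode c ! k else 0)"
  using nth_code_list_encode[of "list_decode c" k] by simp

lemma length_le_list_encode: "length xs \<le> list_encode xs"
proof (induction xs)
  case (Cons x xs)
  have "list_encode xs \<le> pair x (list_encode xs)" by (rule le_prod_encode_2)
  with Cons show ?case by simp
qed simp

lemma length_list_decode_le: "length (list_decode c) \<le> c"
  using length_le_list_encode[of "list_decode c"] by simp

text \<open>A code bounds everything stored in it. This later bounds the positions of a coded word
  and the degrees in a certificate.\<close>

lemma nth_code_le: "nth_code c k \<le> c"
proof -
  have 1: "pfst z \<le> z" "psnd z \<le> z" for z
    using le_prod_encode_1[of "pfst z" "psnd z"] le_prod_encode_2[of "psnd z" "pfst z"] by simp_all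
  have "drop_code c k \<le> c"
    by (induction k) (auto simp: drop_code_def intro: order.trans[OF 1(2)])
  then show ?thesis unfolding nth_code_def using 1(1)[of "drop_code c k - 1"] by linarith
qed

text \<open>Finite functions with values below \<open>b\<close> are coded by expansions in base
  \<open>b\<close>, which turns quantifiers and sums over functions into bounded ones over
  numbers.\<close>

definition digit :: "nat \<Rightarrow> nat \<Rightarrow> nat \<Rightarrow> nat" where
  "digit b c t = (c div b ^ t) mod b"

lemma total_recursive_digit [rec_intros]:
  "total_recursive f \<Longrightarrow> total_recursive g \<Longrightarrow> total_recursive h \<Longrightarrow>
    total_recursive (\<lambda>x. digit (f x) (g x) (h x))"
  unfolding digit_def by (intro rec_intros)

text \<open>The bound \<open>c\<close> is at least the length of the coefficient list; beyond its
  end \<open>nth_code\<close> gives \<open>0\<close>, the code of the coefficient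
  \<open>0\<close>.\<close>

definition poly_code :: "nat \<Rightarrow> nat \<Rightarrow> int" where
  "poly_code c n = (\<Sum>k<c. int_decode (nth_code c k) * int (n ^ k))"

lemma recursive_int_poly_code [rec_intros]:
  assumes "total_recursive f" "total_recursive g" shows "recursive_int (\<lambda>x. poly_code (f x) (g x))"
  unfolding poly_code_def by (intro rec_intros assms assms[THEN total_recursive_comp])

subsection \<open>Pairings\<close>

text \<open>A perfect matching is represented by its fixed-point-free involution. Extensionality
  outside \<open>P\<close> gives each matching a single representative.\<close>

definition pairings :: "nat set \<Rightarrow> (nat \<Rightarrow> nat) \<Rightarrow> (nat \<Rightarrow> nat) set" where
  "pairings P lab = {p \<in> P \<rightarrow>\<^sub>E P. \<forall>t\<in>P. p t \<noteq> t \<and> p (p t) = t \<and> lab (p t) = lab t}"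

lemma finite_pairings: "finite P \<Longrightarrow> finite (pairings P lab)"
  unfolding pairings_def by (rule finite_subset[OF _ finite_PiE]) auto

lemma pairingsD:
  assumes "p \<in> pairings P lab" "t \<in> P"
  shows "p t \<in> P" "p t \<noteq> t" "p (p t) = t" "lab (p t) = lab t"
  using assms by (auto simp: pairings_def)

lemma pairings_eqI:
  "p \<in> pairings P lab \<Longrightarrow> q \<in> pairings P lab \<Longrightarrow> (\<And>t. t \<in> P \<Longrightarrow> p t = q t) \<Longrightarrow> p = q"
  by (auto simp: pairings_def intro: PiE_ext)

text \<open>The smaller elements of the pairs form a transversal, so products over \<open>P\<close>
  can be taken pair by pair.\<close>

lemma pairing_transversal:
  assumes "p \<in> pairings P lab"
  defines "R \<equiv> {t \<in> P. t < p t}"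
  shows "P = R \<union> p ` R" "R \<inter> p ` R = {}" "inj_on p R"
proof -
  note p = pairingsD[OF assms(1)]
  show "R \<inter> p ` R = {}" by (auto simp: R_def p)
  show "inj_on p R" by (rule inj_on_inverseI[of _ p]) (auto simp: R_def p)
  have "t \<in> p ` R" if "t \<in> P" "t \<notin> R" for t
    using that p(1-3)[OF that(1)] by (intro image_eqI[of _ _ "p t"]) (auto simp: R_def)
  then show "P = R \<union> p ` R" using p(1) by (auto simp: R_def)
qed

lemma pairing_restrict:
  assumes "p \<in> pairings P lab"
  shows "restrict p {t \<in> P. lab t = x} \<in> pairings {t \<in> P. lab t = x} lab"
  using pairingsD[OF assms] by (auto simp: pairings_def)

text \<open>The fibers of \<open>I\<close> within a label are exactly the pairs of \<open>p\<close>.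
  Values may recur under different labels, so the dimension has to match only the label with the
  most pairs.\<close>

definition adapted :: "nat set \<Rightarrow> (nat \<Rightarrow> nat) \<Rightarrow> (nat \<Rightarrow> nat) \<Rightarrow> (nat \<Rightarrow> nat) \<Rightarrow> bool" where
  "adapted P lab p I \<longleftrightarrow>
    (\<forall>s\<in>P. \<forall>t\<in>P. lab s = lab t \<longrightarrow> (I s = I t \<longleftrightarrow> s = t \<or> s = p t))"

lemma adaptedD:
  "adapted P lab p I \<Longrightarrow> s \<in> P \<Longrightarrow> t \<in> P \<Longrightarrow> lab s = lab t \<Longrightarrow> I s = I t \<longleftrightarrow> s = t \<or> s = p t"
  by (auto simp: adapted_def)

text \<open>Makes adapted indices dual to the tensors of the pairings: evaluation at the index
  adapted to \<open>p\<close> isolates the coefficient of \<open>p\<close>.\<close>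

lemma adapted_compatible_iff:
  assumes "adapted P lab p I" "p \<in> pairings P lab" "q \<in> pairings P lab"
  shows "(\<forall>t\<in>P. I (q t) = I t) \<longleftrightarrow> q = p"
proof -
  have "I (q t) = I t \<longleftrightarrow> q t = p t" if "t \<in> P" for t
    using adaptedD[OF assms(1), of "q t" t] pairingsD[OF assms(3) that] that by auto
  then show ?thesis using pairings_eqI[OF assms(3,2)] by auto
qed

lemma adapted_index_exists:
  assumes fin: "finite P" and p: "p \<in> pairings P lab"
    and n: "\<And>x. card {t \<in> P. lab t = x} \<le> 2 * n"
  obtains I where "I \<in> P \<rightarrow>\<^sub>E {..<n}" "adapted P lab p I"
proof -
  define C where "C x = {t \<in> P. lab t = x}" for x
  define R where "R x = {t \<in> C x. t < p t}" for x
  note pD = pairingsD[OF p]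
  have "card (R x) \<le> n" for x
  proof -
    let ?q = "restrict p (C x)"
    have q: "?q \<in> pairings (C x) lab" unfolding C_def by (rule pairing_restrict[OF p])
    have R: "{t \<in> C x. t < ?q t} = R x" by (auto simp: R_def)
    note tr = pairing_transversal[OF q, unfolded R]
    have finR: "finite (R x)" using fin by (simp add: R_def C_def)
    have "card (C x) = card (R x) + card (?q ` R x)"
      by (subst tr(1), rule card_Un_disjoint) (use finR tr(2) in auto)
    also have "card (?q ` R x) = card (R x)" by (rule card_image[OF tr(3)])
    finally show ?thesis using n[of x] by (simp add: C_def)
  qed
  \<comment> \<open>At most \<open>2 * n\<close> positions of a label form at most \<open>n\<close>
    pairs, so distinct pairs can receive distinct values below \<open>n\<close>.\<close>
  then have "\<exists>f. f ` R x \<subseteq> {..<n} \<and> inj_on f (R x)" for x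
    using fin by (intro card_le_inj) (auto simp: R_def C_def card_lessThan)
  then obtain f where f: "\<And>x. inj_on (f x) (R x)" "\<And>x. f x ` R x \<subseteq> {..<n}" by metis
  define I where "I = (\<lambda>t\<in>P. f (lab t) (min t (p t)))"
  have mem: "min t (p t) \<in> R (lab t)" if "t \<in> P" for t
    using pD[OF that] that by (auto simp: R_def C_def min_def)
  show thesis
  proof
    show "I \<in> P \<rightarrow>\<^sub>E {..<n}" using mem f(2) by (fastforce simp: I_def)
    show "adapted P lab p I" unfolding adapted_def
    proof (intro ballI impI)
      fix s t assume st: "s \<in> P" "t \<in> P" "lab s = lab t"
      have "I s = I t \<longleftrightarrow> min s (p s) = min t (p t)"
        using inj_on_eq_iff[OF f(1) mem[OF st(1)], of "min t (p t)"] mem[OF st(2)] st by (simp add: I_def)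
      also have "\<dots> \<longleftrightarrow> s = t \<or> s = p t"
        using pD(3)[OF st(1)] pD(3)[OF st(2)] by (metis min.commute min_def)
      finally show "I s = I t \<longleftrightarrow> s = t \<or> s = p t" .
    qed
  qed
qed

text \<open>The matrix entry at \<open>t\<close> has its row index at position
  \<open>\<rho> t\<close> and its column index at \<open>\<kappa> t\<close>; \<open>p\<close>
  constrains the rows and \<open>q\<close> the columns. Identity maps give the inner product of the
  two pairing tensors.\<close>

definition index_count :: "nat set \<Rightarrow> (nat \<Rightarrow> nat) \<Rightarrow> (nat \<Rightarrow> nat) \<Rightarrow> nat \<Rightarrow> (nat \<Rightarrow> nat) \<Rightarrow> (nat \<Rightarrow> nat) \<Rightarrow> nat" where
  "index_count P \<rho> \<kappa> n p q =
    card {i \<in> P \<rightarrow>\<^sub>E {..<n}. \<forall>t\<in>P. i (\<rho> (p t)) = i (\<rho> t) \<and> i (\<kappa> (q t)) = i (\<kappa> t)}"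

abbreviation gram :: "nat set \<Rightarrow> nat \<Rightarrow> (nat \<Rightarrow> nat) \<Rightarrow> (nat \<Rightarrow> nat) \<Rightarrow> nat" where
  "gram P \<equiv> index_count P (\<lambda>t. t) (\<lambda>t. t)"

text \<open>The exponent is the number of connected components of the graph with edges
  \<open>E\<close>, hence independent of \<open>n\<close>. The induction contracts one edge with
  distinct ends at a time; if none is left, every function is allowed.\<close>

lemma card_functions_constant_on_edges:
  assumes "finite P" "E \<subseteq> P \<times> P"
  shows "\<exists>k\<le>card P. \<forall>n. card {i \<in> P \<rightarrow>\<^sub>E {..<n::nat}. \<forall>(a, b)\<in>E. i a = i b} = n ^ k"
  using assms
proof (induction "card P" arbitrary: P E)
  case 0
  then have "P = {}" "E = {}" by auto
  then show ?case by (intro exI[of _ 0]) auto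
next
  case (Suc m)
  show ?case
  proof (cases "E \<subseteq> Id")
    case True
    then have "{i \<in> P \<rightarrow>\<^sub>E {..<n::nat}. \<forall>(a, b)\<in>E. i a = i b} = P \<rightarrow>\<^sub>E {..<n}" for n by auto
    then show ?thesis using Suc.prems(1) by (intro exI[of _ "card P"]) (auto simp: card_PiE)
  next
    case False
    then obtain a b where ab: "(a, b) \<in> E" "a \<noteq> b" by auto
    with Suc.prems have abP: "a \<in> P" "b \<in> P" by auto
    \<comment> \<open>\<open>\<sigma>\<close> contracts the edge: the removed vertex
      \<open>a\<close> is identified with \<open>b\<close>, whose value it must share.\<close>
    define \<sigma> where "\<sigma> c = (if c = a then b else c)" for c
    define Q where "Q = P - {a}"
    define F where "F = (\<lambda>(c, d). (\<sigma> c, \<sigma> d)) ` E"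
    have "m = card Q" "finite Q" using Suc.hyps(2) Suc.prems(1) abP by (auto simp: Q_def)
    moreover have "F \<subseteq> Q \<times> Q"
      using Suc.prems(2) abP ab by (auto simp: F_def Q_def \<sigma>_def split: if_splits)
    ultimately obtain k where k: "k \<le> card Q"
      "\<And>n. card {i \<in> Q \<rightarrow>\<^sub>E {..<n::nat}. \<forall>(a, b)\<in>F. i a = i b} = n ^ k"
      using Suc.hyps(1)[of Q F] by auto
    have "card {i \<in> P \<rightarrow>\<^sub>E {..<n::nat}. \<forall>(a, b)\<in>E. i a = i b} =
        card {i \<in> Q \<rightarrow>\<^sub>E {..<n::nat}. \<forall>(a, b)\<in>F. i a = i b}" for n
    proof (rule bij_betw_same_card[of "\<lambda>i. restrict i Q"], rule bij_betw_byWitness)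
      let ?A = "{i \<in> P \<rightarrow>\<^sub>E {..<n::nat}. \<forall>(a, b)\<in>E. i a = i b}"
      let ?B = "{i \<in> Q \<rightarrow>\<^sub>E {..<n::nat}. \<forall>(a, b)\<in>F. i a = i b}"
      let ?g = "\<lambda>j. restrict (\<lambda>t. j (\<sigma> t)) P"
      have \<sigma>: "\<sigma> c \<in> Q" if "c \<in> P" for c using that abP ab by (auto simp: \<sigma>_def Q_def)
      have \<sigma>Q: "\<sigma> c = c" "c \<in> P" if "c \<in> Q" for c using that by (auto simp: \<sigma>_def Q_def)
      have i\<sigma>: "i (\<sigma> c) = i c" if "i \<in> ?A" for i c using that ab by (auto simp: \<sigma>_def)
      show "\<forall>i\<in>?A. ?g (restrict i Q) = i"
      proof
        fix i assume i: "i \<in> ?A"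
        then have "i \<in> P \<rightarrow>\<^sub>E {..<n}" by simp
        then show "?g (restrict i Q) = i"
          by (intro PiE_ext[of _ P "\<lambda>_. {..<n}"]) (auto simp: \<sigma> i\<sigma>[OF i])
      qed
      show "\<forall>j\<in>?B. restrict (?g j) Q = j"
      proof
        fix j assume "j \<in> ?B"
        then have "j \<in> Q \<rightarrow>\<^sub>E {..<n}" by simp
        then show "restrict (?g j) Q = j"
          by (intro PiE_ext[of _ Q "\<lambda>_. {..<n}"]) (auto simp: \<sigma>Q)
      qed
      show "(\<lambda>i. restrict i Q) ` ?A \<subseteq> ?B"
      proof
        fix j assume "j \<in> (\<lambda>i. restrict i Q) ` ?A"
        then obtain i where i: "i \<in> ?A" and j: "j = restrict i Q" by auto
        have "j c = j d" if "(c, d) \<in> F" for c d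
        proof -
          obtain c' d' where cd: "(c', d') \<in> E" "c = \<sigma> c'" "d = \<sigma> d'" using \<open>(c, d) \<in> F\<close> by (auto simp: F_def)
          then have "c' \<in> P" "d' \<in> P" using Suc.prems(2) by auto
          then have "j c = i c'" "j d = i d'" using cd \<sigma> i\<sigma>[OF i] j by auto
          moreover have "i c' = i d'" using i cd by auto
          ultimately show ?thesis by simp
        qed
        moreover have "j \<in> Q \<rightarrow>\<^sub>E {..<n}" using i by (auto simp: j Q_def)
        ultimately show "j \<in> ?B" by auto
      qed
      show "?g ` ?B \<subseteq> ?A"
      proof
        fix i assume "i \<in> ?g ` ?B"
        then obtain j where j: "j \<in> ?B" and i: "i = ?g j" by auto
        have "i c = i d" if "(c, d) \<in> E" for c d
        proof -
          have "(\<sigma> c, \<sigma> d) \<in> F" using that by (auto simp: F_def)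
          then have "j (\<sigma> c) = j (\<sigma> d)" using j by auto
          then show ?thesis using that Suc.prems(2) by (auto simp: i)
        qed
        moreover have "i \<in> P \<rightarrow>\<^sub>E {..<n}" using j \<sigma> by (auto simp: i)
        ultimately show "i \<in> ?A" by auto
      qed
    qed
    with k show ?thesis using Suc.hyps(2) \<open>m = card Q\<close> by (intro exI[of _ k]) auto
  qed
qed

lemma index_count_eq_power:
  assumes "finite P" "\<rho> ` P \<subseteq> P" "\<kappa> ` P \<subseteq> P" "p \<in> pairings P lab" "q \<in> pairings P lab"
  shows "\<exists>k\<le>card P. \<forall>n. index_count P \<rho> \<kappa> n p q = n ^ k"
proof -
  define E where "E = (\<lambda>t. (\<rho> (p t), \<rho> t)) ` P \<union> (\<lambda>t. (\<kappa> (q t), \<kappa> t)) ` P"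
  have eq: "{i \<in> P \<rightarrow>\<^sub>E {..<n}. \<forall>t\<in>P. i (\<rho> (p t)) = i (\<rho> t) \<and> i (\<kappa> (q t)) = i (\<kappa> t)} =
      {i \<in> P \<rightarrow>\<^sub>E {..<n}. \<forall>(a, b)\<in>E. i a = i b}" for n
    unfolding E_def by auto
  have "E \<subseteq> P \<times> P" 
    using assms(2,3) by (auto simp: E_def image_subset_iff pairingsD(1)[OF assms(4)] pairingsD(1)[OF assms(5)])
  then show ?thesis
    unfolding index_count_def eq by (rule card_functions_constant_on_edges[OF assms(1)])
qed

lemma index_count_eq_sum:
  assumes "finite P"
  shows "real (index_count P \<rho> \<kappa> n p q) = (\<Sum>i\<in>P \<rightarrow>\<^sub>E {..<n}.
    of_bool (\<forall>t\<in>P. i (\<rho> (p t)) = i (\<rho> t)) * of_bool (\<forall>t\<in>P. i (\<kappa> (q t)) = i (\<kappa> t)))"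
proof -
  have "real (index_count P \<rho> \<kappa> n p q) = (\<Sum>i\<in>P \<rightarrow>\<^sub>E {..<n}.
      of_bool ((\<forall>t\<in>P. i (\<rho> (p t)) = i (\<rho> t)) \<and> (\<forall>t\<in>P. i (\<kappa> (q t)) = i (\<kappa> t))))"
    unfolding index_count_def
    by (subst sum_of_bool_eq) (use assms in \<open>auto intro!: finite_PiE arg_cong[where f = card]\<close>)
  then show ?thesis by (simp only: of_bool_conj)
qed

text \<open>The quadratic form of the Gram matrix at \<open>v\<close> is a sum of squares of the
  values of the tensor with coefficients \<open>v\<close>, so a kernel vector gives the zero tensor.
  Its value at an index adapted to \<open>p\<close> is \<open>v p\<close>.\<close>

lemma gram_nondegenerate:
  fixes v :: "(nat \<Rightarrow> nat) \<Rightarrow> int"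
  assumes fin: "finite P" and n: "\<And>x. card {t \<in> P. lab t = x} \<le> 2 * n"
    and v: "\<And>p. p \<in> pairings P lab \<Longrightarrow> (\<Sum>q\<in>pairings P lab. int (gram P n p q) * v q) = 0"
    and p: "p \<in> pairings P lab"
  shows "v p = 0"
proof -
  let ?X = "pairings P lab"
  define \<delta> :: "(nat \<Rightarrow> nat) \<Rightarrow> (nat \<Rightarrow> nat) \<Rightarrow> real"
    where "\<delta> p I = of_bool (\<forall>t\<in>P. I (p t) = I t)" for p I
  have finX: "finite ?X" and finI: "finite (P \<rightarrow>\<^sub>E {..<n})"
    using fin by (auto intro: finite_pairings finite_PiE)
  have v': "(\<Sum>q\<in>?X. real (gram P n p q) * v q) = 0" if "p \<in> ?X" for p
    using arg_cong[OF v[OF that], of real_of_int] by simp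
  have "(\<Sum>I\<in>P \<rightarrow>\<^sub>E {..<n}. (\<Sum>q\<in>?X. v q * \<delta> q I)\<^sup>2) =
      (\<Sum>I\<in>P \<rightarrow>\<^sub>E {..<n}. \<Sum>p\<in>?X. \<Sum>q\<in>?X. v p * (\<delta> p I * \<delta> q I * v q))"
    by (simp add: power2_eq_square sum_product mult_ac)
  also have "\<dots> = (\<Sum>p\<in>?X. \<Sum>q\<in>?X. \<Sum>I\<in>P \<rightarrow>\<^sub>E {..<n}. v p * (\<delta> p I * \<delta> q I * v q))"
    by (subst sum.swap, rule sum.cong[OF refl], rule sum.swap)
  also have "\<dots> = (\<Sum>p\<in>?X. v p * (\<Sum>q\<in>?X. real (gram P n p q) * v q))"
    unfolding index_count_eq_sum[OF fin] \<delta>_def by (simp add: sum_distrib_left sum_distrib_right)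
  also have "\<dots> = 0" by (simp add: v')
  finally have "\<forall>I\<in>P \<rightarrow>\<^sub>E {..<n}. (\<Sum>q\<in>?X. v q * \<delta> q I) = 0"
    by (subst (asm) sum_nonneg_eq_0_iff[OF finI]) auto
  moreover obtain I where I: "I \<in> P \<rightarrow>\<^sub>E {..<n}" "adapted P lab p I"
    using adapted_index_exists[OF fin p n] by blast
  have "\<delta> q I = of_bool (q = p)" if q: "q \<in> ?X" for q
    unfolding \<delta>_def using adapted_compatible_iff[OF I(2) p q] by simp
  then have "(\<Sum>q\<in>?X. v q * \<delta> q I) = (\<Sum>q\<in>?X. real_of_int (v q) * of_bool (q = p))" by (intro sum.cong) auto
  moreover have "\<dots> = v p" using finX p by (simp add: of_bool_def if_distrib cong: if_cong)
  ultimately show ?thesis using I(1) by simp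
qed

subsection \<open>Adjugates over a finite index set\<close>

text \<open>\<open>D\<close> is the determinant and \<open>V\<close> the adjugate. The identity with
  \<open>V\<close> on the right later serves to compare two left inverses; the last clause turns a
  zero of \<open>D\<close> into an integral kernel vector of the evaluated matrix.\<close>

lemma adjugate_finite_index:
  fixes M :: "'i \<Rightarrow> 'i \<Rightarrow> int poly"
  assumes "finite X"
  obtains D V where
    "\<And>p s. p \<in> X \<Longrightarrow> s \<in> X \<Longrightarrow> (\<Sum>q\<in>X. V p q * M q s) = (if p = s then D else 0)"
    "\<And>p s. p \<in> X \<Longrightarrow> s \<in> X \<Longrightarrow> (\<Sum>q\<in>X. M p q * V q s) = (if p = s then D else 0)"
    "\<And>n. poly D n = 0 \<Longrightarrow>
      \<exists>v. (\<exists>p\<in>X. v p \<noteq> 0) \<and> (\<forall>p\<in>X. (\<Sum>q\<in>X. poly (M p q) n * v q) = 0)"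
proof -
  define N where "N = card X"
  obtain e where e: "bij_betw e {0..<N} X" using ex_bij_betw_nat_finite[OF assms] N_def by auto
  define A where "A = mat N N (\<lambda>(i, j). M (e i) (e j))"
  define d where "d = inv_into {0..<N} e"
  have dN: "d p < N" and ed: "e (d p) = p" if "p \<in> X" for p
    using that bij_betw_inv_into_right[OF e] inv_into_into[of p e "{0..<N}"] e
    by (auto simp: d_def bij_betw_def)
  have de: "d (e i) = i" and eX: "e i \<in> X" if "i < N" for i
    using that bij_betw_inv_into_left[OF e] e by (auto simp: d_def bij_betw_def)
  have dinj: "d p = d q \<longleftrightarrow> p = q" if "p \<in> X" "q \<in> X" for p q using that ed by metis
  have reindex: "(\<Sum>q\<in>X. f q) = (\<Sum>i = 0..<N. f (e i))" for f :: "'i \<Rightarrow> 'b :: comm_monoid_add"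
    using sum.reindex_bij_betw[OF e, of f] by simp
  have A: "A \<in> carrier_mat N N" by (simp add: A_def)
  note adj = adj_mat[OF A]
  define V where "V p q = adj_mat A $$ (d p, d q)" for p q
  show thesis
  proof
    fix p s assume ps: "p \<in> X" "s \<in> X"
    have "(\<Sum>q\<in>X. V p q * M q s) = (adj_mat A * A) $$ (d p, d s)"
      using adj(1) A ps dN[OF ps(1)] dN[OF ps(2)]
      by (auto simp: reindex V_def scalar_prod_def de A_def ed intro!: sum.cong)
    then show "(\<Sum>q\<in>X. V p q * M q s) = (if p = s then det A else 0)"
      using dN[OF ps(1)] dN[OF ps(2)] ps by (simp add: adj(3) dinj)
    have "(\<Sum>q\<in>X. M p q * V q s) = (A * adj_mat A) $$ (d p, d s)"
      using adj(1) A ps dN[OF ps(1)] dN[OF ps(2)]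
      by (auto simp: reindex V_def scalar_prod_def de A_def ed intro!: sum.cong)
    then show "(\<Sum>q\<in>X. M p q * V q s) = (if p = s then det A else 0)"
      using dN[OF ps(1)] dN[OF ps(2)] ps by (simp add: adj(2) dinj)
  next
    fix n :: int assume 0: "poly (det A) n = 0"
    interpret poly_hom: comm_ring_hom "\<lambda>p. poly p n" by unfold_locales auto
    have "det (map_mat (\<lambda>p. poly p n) A) = 0" using 0 by simp
    moreover have A': "map_mat (\<lambda>p. poly p n) A \<in> carrier_mat N N" using A by simp
    ultimately obtain v where v: "v \<in> carrier_vec N" "v \<noteq> 0\<^sub>v N" "map_mat (\<lambda>p. poly p n) A *\<^sub>v v = 0\<^sub>v N"
      using det_0_iff_vec_prod_zero[OF A'] by auto
    have "\<exists>i<N. v $ i \<noteq> 0" using v(1,2) by (metis carrier_vecD eq_vecI index_zero_vec)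
    then have "\<exists>p\<in>X. v $ d p \<noteq> 0" using de eX by metis
    moreover have "(\<Sum>q\<in>X. poly (M p q) n * v $ d q) = 0" if p: "p \<in> X" for p
    proof -
      have "(\<Sum>q\<in>X. poly (M p q) n * v $ d q) = (map_mat (\<lambda>p. poly p n) A *\<^sub>v v) $ d p"
        using A v(1) dN[OF p] p
        by (auto simp: reindex scalar_prod_def de A_def ed intro!: sum.cong)
      then show ?thesis using v(3) dN[OF p] by simp
    qed
    ultimately show "\<exists>v. (\<exists>p\<in>X. v p \<noteq> 0) \<and> (\<forall>p\<in>X. (\<Sum>q\<in>X. poly (M p q) n * v q) = 0)"
      by (intro exI[of _ "\<lambda>q. v $ d q"]) auto
  qed
qed

subsection \<open>Tensors invariant under the orthogonal groups\<close>

definition row_orthonormal :: "nat \<Rightarrow> (nat \<Rightarrow> nat \<Rightarrow> real) \<Rightarrow> bool" where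
  "row_orthonormal n h \<longleftrightarrow> (\<forall>i<n. \<forall>j<n. (\<Sum>k<n. h i k * h j k) = of_bool (i = j))"

lemma prod_of_bool:
  "finite A \<Longrightarrow> (\<Prod>t\<in>A. of_bool (Q t) :: 'a :: {comm_semiring_1}) = of_bool (\<forall>t\<in>A. Q t)"
  by (induction rule: finite_induct) auto

text \<open>A compatible \<open>J\<close> is a free choice of one value per pair, so the sum factors
  over pairs. Each factor is the inner product of two rows of a single matrix, because a pairing
  preserves labels.\<close>

lemma sum_compatible_indices:
  assumes fin: "finite P" and p: "p \<in> pairings P lab"
    and h: "\<And>x. row_orthonormal n (h x)" and I: "I \<in> P \<rightarrow>\<^sub>E {..<n}"
  shows "(\<Sum>J\<in>P \<rightarrow>\<^sub>E {..<n}. (\<Prod>t\<in>P. h (lab t) (I t) (J t)) * of_bool (\<forall>t\<in>P. J (p t) = J t))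
    = of_bool (\<forall>t\<in>P. I (p t) = I t)"
proof -
  define R where "R = {t \<in> P. t < p t}"
  note tr = pairing_transversal[OF p, folded R_def]
  note pD = pairingsD[OF p]
  have finR: "finite R" and RP: "R \<subseteq> P" using fin by (auto simp: R_def)
  have split: "(\<Prod>t\<in>P. f t) = (\<Prod>t\<in>R. f t * f (p t))" for f :: "nat \<Rightarrow> real"
  proof -
    have "prod f P = prod f R * prod f (p ` R)"
      by (subst tr(1), rule prod.union_disjoint) (use finR tr(2) in auto)
    also have "prod f (p ` R) = (\<Prod>t\<in>R. f (p t))" by (simp add: prod.reindex[OF tr(3)])
    finally show ?thesis by (simp add: prod.distrib)
  qed
  let ?C = "{J \<in> P \<rightarrow>\<^sub>E {..<n}. \<forall>t\<in>P. J (p t) = J t}"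
  have bij: "bij_betw (\<lambda>J. restrict J R) ?C (R \<rightarrow>\<^sub>E {..<n})"
  proof (rule bij_betw_byWitness)
    let ?e = "\<lambda>K. \<lambda>t\<in>P. K (if t \<in> R then t else p t)"
    have pR: "p t \<in> R" if "t \<in> P" "t \<notin> R" for t
      using that pD(1-3)[OF that(1)] by (auto simp: R_def)
    have Rp: "p t \<notin> R" if "t \<in> R" for t using that tr(2) by auto
    show "\<forall>J\<in>?C. ?e (restrict J R) = J"
    proof
      fix J assume "J \<in> ?C"
      then show "?e (restrict J R) = J"
        by (intro PiE_ext[of _ P "\<lambda>_. {..<n}"]) (auto simp: pR PiE_iff pD(1))
    qed
    show "\<forall>K\<in>R \<rightarrow>\<^sub>E {..<n}. restrict (?e K) R = K"
    proof
      fix K assume "K \<in> R \<rightarrow>\<^sub>E {..<n}"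
      then show "restrict (?e K) R = K"
        using RP by (intro PiE_ext[of _ R "\<lambda>_. {..<n}"]) auto
    qed
    show "(\<lambda>J. restrict J R) ` ?C \<subseteq> R \<rightarrow>\<^sub>E {..<n}" using RP by auto
    show "?e ` (R \<rightarrow>\<^sub>E {..<n}) \<subseteq> ?C"
    proof (intro image_subsetI CollectI conjI ballI)
      fix K assume K: "K \<in> R \<rightarrow>\<^sub>E {..<n}"
      show "?e K \<in> P \<rightarrow>\<^sub>E {..<n}" using K pR by (auto simp: PiE_iff)
      fix t assume t: "t \<in> P"
      show "?e K (p t) = ?e K t"
        using t pD(1)[OF t] pD(3)[OF t] pR[OF t] Rp[of t] by (cases "t \<in> R") auto
    qed
  qed
  have "(\<Sum>J\<in>P \<rightarrow>\<^sub>E {..<n}. (\<Prod>t\<in>P. h (lab t) (I t) (J t)) * of_bool (\<forall>t\<in>P. J (p t) = J t))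
      = (\<Sum>J\<in>?C. \<Prod>t\<in>P. h (lab t) (I t) (J t))"
    by (rule sum.mono_neutral_cong_right) (use fin in \<open>auto intro: finite_PiE\<close>)
  also have "\<dots> = (\<Sum>J\<in>?C. \<Prod>t\<in>R. h (lab t) (I t) (restrict J R t) * h (lab t) (I (p t)) (restrict J R t))"
  proof (rule sum.cong[OF refl])
    fix J assume "J \<in> ?C"
    then show "(\<Prod>t\<in>P. h (lab t) (I t) (J t)) =
        (\<Prod>t\<in>R. h (lab t) (I t) (restrict J R t) * h (lab t) (I (p t)) (restrict J R t))"
      unfolding split using pD(4) RP by (intro prod.cong) auto
  qed
  also have "\<dots> = (\<Sum>K\<in>R \<rightarrow>\<^sub>E {..<n}. \<Prod>t\<in>R. h (lab t) (I t) (K t) * h (lab t) (I (p t)) (K t))"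
    by (rule sum.reindex_bij_betw[OF bij,
          where g = "\<lambda>K. \<Prod>t\<in>R. h (lab t) (I t) (K t) * h (lab t) (I (p t)) (K t)"])
  also have "\<dots> = (\<Prod>t\<in>R. \<Sum>k<n. h (lab t) (I t) k * h (lab t) (I (p t)) k)"
    by (rule prod_sum_PiE[symmetric]) (use finR in auto)
  also have "\<dots> = (\<Prod>t\<in>R. of_bool (I t = I (p t)))"
  proof (rule prod.cong[OF refl])
    fix t assume "t \<in> R"
    then have "I t < n" "I (p t) < n" using I RP pD(1) by auto
    then show "(\<Sum>k<n. h (lab t) (I t) k * h (lab t) (I (p t)) k) = of_bool (I t = I (p t))"
      using h by (simp add: row_orthonormal_def)
  qed
  also have "\<dots> = of_bool (\<forall>t\<in>R. I t = I (p t))" using finR by (rule prod_of_bool)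
  also have "(\<forall>t\<in>R. I t = I (p t)) \<longleftrightarrow> (\<forall>t\<in>P. I (p t) = I t)"
  proof
    assume *: "\<forall>t\<in>R. I t = I (p t)"
    show "\<forall>t\<in>P. I (p t) = I t"
    proof
      fix t assume t: "t \<in> P"
      show "I (p t) = I t"
      proof (cases "t \<in> R")
        case False
        then have "p t \<in> R" using t pD(1-3)[OF t] by (auto simp: R_def)
        then show ?thesis using * pD(3)[OF t] by auto
      qed (use * in auto)
    qed
  qed (use RP in auto)
  finally show ?thesis .
qed

text \<open>Invariance under a product of orthogonal groups: each label has its own matrix
  \<open>h x\<close>, chosen independently of the others.\<close>

definition invariant_tensor :: "nat set \<Rightarrow> (nat \<Rightarrow> nat) \<Rightarrow> nat \<Rightarrow> ((nat \<Rightarrow> nat) \<Rightarrow> real) \<Rightarrow> bool" where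
  "invariant_tensor P lab n T \<longleftrightarrow> (\<forall>h. (\<forall>x. row_orthonormal n (h x)) \<longrightarrow>
    (\<forall>I\<in>P \<rightarrow>\<^sub>E {..<n}. T I = (\<Sum>J\<in>P \<rightarrow>\<^sub>E {..<n}. (\<Prod>t\<in>P. h (lab t) (I t) (J t)) * T J)))"

lemma invariant_tensorD:
  assumes "invariant_tensor P lab n T" "\<And>x. row_orthonormal n (h x)" "I \<in> P \<rightarrow>\<^sub>E {..<n}"
  shows "T I = (\<Sum>J\<in>P \<rightarrow>\<^sub>E {..<n}. (\<Prod>t\<in>P. h (lab t) (I t) (J t)) * T J)"
  using assms by (auto simp: invariant_tensor_def)

lemma invariant_tensor_diff_sum:
  assumes "finite P" "invariant_tensor P lab n T"
  shows "invariant_tensor P lab n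
    (\<lambda>I. T I - (\<Sum>p\<in>pairings P lab. a p * of_bool (\<forall>t\<in>P. I (p t) = I t)))"
  unfolding invariant_tensor_def
proof (intro allI impI ballI)
  fix h :: "nat \<Rightarrow> nat \<Rightarrow> nat \<Rightarrow> real" and I assume h: "\<forall>x. row_orthonormal n (h x)" and I: "I \<in> P \<rightarrow>\<^sub>E {..<n}"
  let ?S = "\<lambda>I. \<Sum>p\<in>pairings P lab. a p * of_bool (\<forall>t\<in>P. I (p t) = I t)"
  let ?c = "\<lambda>J. \<Prod>t\<in>P. h (lab t) (I t) (J t)"
  have "(\<Sum>J\<in>P \<rightarrow>\<^sub>E {..<n}. ?c J * ?S J) =
      (\<Sum>p\<in>pairings P lab. \<Sum>J\<in>P \<rightarrow>\<^sub>E {..<n}. a p * (?c J * of_bool (\<forall>t\<in>P. J (p t) = J t)))"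
    by (subst sum.swap) (simp add: sum_distrib_left mult_ac)
  also have "\<dots> = ?S I"
  proof (rule sum.cong[OF refl])
    fix p assume p: "p \<in> pairings P lab"
    have "(\<Sum>J\<in>P \<rightarrow>\<^sub>E {..<n}. a p * (?c J * of_bool (\<forall>t\<in>P. J (p t) = J t))) =
        a p * (\<Sum>J\<in>P \<rightarrow>\<^sub>E {..<n}. ?c J * of_bool (\<forall>t\<in>P. J (p t) = J t))"
      by (simp only: sum_distrib_left)
    then show "(\<Sum>J\<in>P \<rightarrow>\<^sub>E {..<n}. a p * (?c J * of_bool (\<forall>t\<in>P. J (p t) = J t))) =
        a p * of_bool (\<forall>t\<in>P. I (p t) = I t)"
      using sum_compatible_indices[OF assms(1) p, of n h I] h I by simp
  qed
  finally have "(\<Sum>J\<in>P \<rightarrow>\<^sub>E {..<n}. ?c J * ?S J) = ?S I" .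
  moreover have "T I = (\<Sum>J\<in>P \<rightarrow>\<^sub>E {..<n}. ?c J * T J)"
    using invariant_tensorD[OF assms(2), of h I] h I by auto
  ultimately show "T I - ?S I = (\<Sum>J\<in>P \<rightarrow>\<^sub>E {..<n}. ?c J * (T J - ?S J))"
    by (simp add: right_diff_distrib sum_subtractf)
qed

section \<open>Testing invariance on permutations, sign changes and a block in a coordinate
  plane\<close>

lemma extend_to_bij:
  assumes "finite S" "A \<subseteq> S" "inj_on f A" "f ` A \<subseteq> S"
  obtains \<sigma> where "bij_betw \<sigma> S S" "\<And>a. a \<in> A \<Longrightarrow> \<sigma> a = f a"
proof -
  have "card (S - A) = card (S - f ` A)"
    using assms by (simp add: card_Diff_subset finite_subset card_image)
  then obtain g where g: "bij_betw g (S - A) (S - f ` A)"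
    using assms(1) finite_same_card_bij[of "S - A" "S - f ` A"] by auto
  define \<sigma> where "\<sigma> a = (if a \<in> A then f a else g a)" for a
  have "bij_betw \<sigma> (A \<union> (S - A)) (f ` A \<union> (S - f ` A))"
    unfolding \<sigma>_def
    by (rule bij_betw_disjoint_Un) (use assms(3) g in \<open>auto simp: bij_betw_def\<close>)
  moreover have "A \<union> (S - A) = S" "f ` A \<union> (S - f ` A) = S" using assms by auto
  ultimately show thesis by (intro that[of \<sigma>]) (auto simp: \<sigma>_def)
qed

text \<open>Permutation matrices, one per label, carry \<open>I\<close> to \<open>I'\<close>. Hence
  \<open>T\<close> sees only which positions of a label share a value, not the values.\<close>

lemma invariant_tensor_kernel:
  assumes fin: "finite P" and T: "invariant_tensor P lab n T"
    and I: "I \<in> P \<rightarrow>\<^sub>E {..<n}" and I': "I' \<in> P \<rightarrow>\<^sub>E {..<n}"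
    and ker: "\<And>s t. s \<in> P \<Longrightarrow> t \<in> P \<Longrightarrow> lab s = lab t \<Longrightarrow> I s = I t \<longleftrightarrow> I' s = I' t"
  shows "T I = T I'"
proof -
  have "\<exists>\<sigma>. bij_betw \<sigma> {..<n} {..<n} \<and> (\<forall>t\<in>P. lab t = x \<longrightarrow> \<sigma> (I t) = I' t)" for x
  proof -
    let ?C = "{t \<in> P. lab t = x}"
    \<comment> \<open>\<open>f\<close> sends a value of \<open>I\<close> to the corresponding value
      of \<open>I'\<close>. By \<open>ker\<close> the choice of \<open>t\<close> is immaterial and
      \<open>f\<close> is injective, so it extends to a permutation of the coordinates.\<close>
    define f where "f a = I' (SOME t. t \<in> ?C \<and> I t = a)" for a
    have f: "f (I t) = I' t" if "t \<in> ?C" for t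
    proof -
      have "(SOME s. s \<in> ?C \<and> I s = I t) \<in> ?C \<and> I (SOME s. s \<in> ?C \<and> I s = I t) = I t"
        by (rule someI[of _ t]) (use that in auto)
      then show ?thesis using ker[of "SOME s. s \<in> ?C \<and> I s = I t" t] that by (auto simp: f_def)
    qed
    have "inj_on f (I ` ?C)" using f ker by (auto simp: inj_on_def)
    moreover have "f ` (I ` ?C) \<subseteq> {..<n}" using f I' by auto
    ultimately obtain \<sigma> where "bij_betw \<sigma> {..<n} {..<n}" "\<And>a. a \<in> I ` ?C \<Longrightarrow> \<sigma> a = f a"
      using extend_to_bij[of "{..<n}" "I ` ?C" f] I by (auto simp: image_subset_iff PiE_iff)
    then show ?thesis using f by (intro exI[of _ \<sigma>]) auto
  qed
  then obtain \<sigma> where \<sigma>: "\<And>x. bij_betw (\<sigma> x) {..<n} {..<n}" "\<And>t. t \<in> P \<Longrightarrow> \<sigma> (lab t) (I t) = I' t"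
    by metis
  define h :: "nat \<Rightarrow> nat \<Rightarrow> nat \<Rightarrow> real" where "h x i k = of_bool (k = \<sigma> x i)" for x i k
  have "row_orthonormal n (h x)" for x
    unfolding row_orthonormal_def
  proof (intro allI impI)
    fix i j assume ij: "i < n" "j < n"
    then have "\<sigma> x i < n" "\<sigma> x i = \<sigma> x j \<longleftrightarrow> i = j"
      using \<sigma>(1)[of x] by (auto simp: bij_betw_def inj_on_eq_iff)
    moreover have "(\<Sum>k<n. h x i k * h x j k) = (\<Sum>k<n. if k = \<sigma> x i then of_bool (\<sigma> x i = \<sigma> x j) else 0)"
      by (intro sum.cong) (auto simp: h_def)
    ultimately show "(\<Sum>k<n. h x i k * h x j k) = of_bool (i = j)" by simp
  qed
  from invariant_tensorD[OF T this I]
  have "T I = (\<Sum>J\<in>P \<rightarrow>\<^sub>E {..<n}. (\<Prod>t\<in>P. h (lab t) (I t) (J t)) * T J)" .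
  also have "\<dots> = (\<Sum>J\<in>P \<rightarrow>\<^sub>E {..<n}. if J = I' then T J else 0)"
  proof (rule sum.cong[OF refl])
    fix J assume J: "J \<in> P \<rightarrow>\<^sub>E {..<n}"
    have "(\<Prod>t\<in>P. h (lab t) (I t) (J t)) = of_bool (\<forall>t\<in>P. J t = I' t)"
      unfolding h_def by (subst prod_of_bool[OF fin]) (simp add: \<sigma>(2))
    also have "(\<forall>t\<in>P. J t = I' t) \<longleftrightarrow> J = I'" using PiE_ext[OF J I'] by auto
    finally show "(\<Prod>t\<in>P. h (lab t) (I t) (J t)) * T J = (if J = I' then T J else 0)" by simp
  qed
  also have "\<dots> = T I'" using I' fin by (simp add: finite_PiE)
  finally show ?thesis .
qed

text \<open>Changing the sign of coordinate \<open>a\<close> under label \<open>x\<close> multiplies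
  by \<open>- 1\<close> once for each position in the fiber, so here
  \<open>T I = - T I\<close>.\<close>

lemma invariant_tensor_odd:
  assumes fin: "finite P" and T: "invariant_tensor P lab n T" and I: "I \<in> P \<rightarrow>\<^sub>E {..<n}"
    and odd: "odd (card {t \<in> P. lab t = x \<and> I t = a})"
  shows "T I = 0"
proof -
  define h :: "nat \<Rightarrow> nat \<Rightarrow> nat \<Rightarrow> real"
    where "h y i k = of_bool (k = i) * (if y = x \<and> i = a then - 1 else 1)" for y i k
  have "row_orthonormal n (h y)" for y
    unfolding row_orthonormal_def
  proof (intro allI impI)
    fix i j assume ij: "i < n" "j < n"
    have "(\<Sum>k<n. h y i k * h y j k) = (\<Sum>k<n. if k = i then of_bool (i = j) else 0)"
      by (intro sum.cong) (auto simp: h_def)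
    then show "(\<Sum>k<n. h y i k * h y j k) = of_bool (i = j)" using ij by simp
  qed
  from invariant_tensorD[OF T this I]
  have "T I = (\<Sum>J\<in>P \<rightarrow>\<^sub>E {..<n}. (\<Prod>t\<in>P. h (lab t) (I t) (J t)) * T J)" .
  also have "\<dots> = (\<Sum>J\<in>P \<rightarrow>\<^sub>E {..<n}. if J = I then - T J else 0)"
  proof (rule sum.cong[OF refl])
    fix J assume J: "J \<in> P \<rightarrow>\<^sub>E {..<n}"
    have "(\<Prod>t\<in>P. h (lab t) (I t) (J t)) =
        of_bool (\<forall>t\<in>P. J t = I t) * (\<Prod>t\<in>P. if lab t = x \<and> I t = a then - 1 else 1)"
      unfolding h_def prod.distrib by (subst prod_of_bool[OF fin]) simp
    also have "(\<Prod>t\<in>P. if lab t = x \<and> I t = a then - 1 else 1) = (- 1 :: real)"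
      using odd by (subst prod.inter_filter[OF fin, symmetric]) simp
    also have "(\<forall>t\<in>P. J t = I t) \<longleftrightarrow> J = I" using PiE_ext[OF J I] by auto
    finally show "(\<Prod>t\<in>P. h (lab t) (I t) (J t)) * T J = (if J = I then - T J else 0)" by simp
  qed
  also have "\<dots> = - T I" using I fin by (simp add: finite_PiE)
  finally show ?thesis by simp
qed

lemma invariant_tensor_rotate:
  fixes c s :: real
  assumes fin: "finite P" and T: "invariant_tensor P lab n T" and I: "I \<in> P \<rightarrow>\<^sub>E {..<n}"
    and ab: "a < n" "b < n" "a \<noteq> b" and unused: "\<And>t. t \<in> P \<Longrightarrow> lab t = x \<Longrightarrow> I t \<noteq> b"
    and cs: "c\<^sup>2 + s\<^sup>2 = 1"
  defines "S \<equiv> {t \<in> P. lab t = x \<and> I t = a}"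
  shows "T I = (\<Sum>A\<in>Pow S. c ^ card (S - A) * s ^ card A * T (\<lambda>t. if t \<in> A then b else I t))"
proof -
  \<comment> \<open>In the coordinates \<open>a\<close> and \<open>b\<close> the block has rows
    \<open>(c, s)\<close> and \<open>(s, - c)\<close>, an orthogonal matrix of determinant
    \<open>- 1\<close>.\<close>
  define h :: "nat \<Rightarrow> nat \<Rightarrow> nat \<Rightarrow> real" where
    "h y i k = (if y = x \<and> i = a then (if k = a then c else if k = b then s else 0)
       else if y = x \<and> i = b then (if k = a then s else if k = b then - c else 0)
       else of_bool (k = i))" for y i k
  have "row_orthonormal n (h y)" for y
    unfolding row_orthonormal_def
  proof (intro allI impI)
    fix i j assume ij: "i < n" "j < n"
    have two: "(\<Sum>k<n. f k) = f a + f b" if "\<And>k. k \<noteq> a \<Longrightarrow> k \<noteq> b \<Longrightarrow> f k = 0" for f :: "nat \<Rightarrow> real"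
    proof -
      have "(\<Sum>k<n. f k) = (\<Sum>k\<in>{a, b}. f k)"
        by (rule sum.mono_neutral_right) (use ab that in auto)
      then show ?thesis using ab by simp
    qed
    show "(\<Sum>k<n. h y i k * h y j k) = of_bool (i = j)"
    proof (cases "y = x \<and> (i = a \<or> i = b)")
      case True
      then show ?thesis
        using ab cs by (subst two) (auto simp: h_def power2_eq_square algebra_simps)
    next
      case False
      then have "(\<Sum>k<n. h y i k * h y j k) = (\<Sum>k<n. if k = i then of_bool (i = j) else 0)"
        by (intro sum.cong) (auto simp: h_def)
      then show ?thesis using ij by simp
    qed
  qed
  from invariant_tensorD[OF T this I]
  have TI: "T I = (\<Sum>J\<in>P \<rightarrow>\<^sub>E {..<n}. (\<Prod>t\<in>P. h (lab t) (I t) (J t)) * T J)" .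
  let ?J = "\<lambda>A t. if t \<in> A then b else I t"
  have SP: "S \<subseteq> P" and finS: "finite S" using fin by (auto simp: S_def)
  have inj: "inj_on ?J (Pow S)"
  proof (rule inj_onI)
    fix A B assume AB: "A \<in> Pow S" "B \<in> Pow S" "?J A = ?J B"
    have "t \<in> A \<longleftrightarrow> t \<in> B" for t
      using fun_cong[OF AB(3), of t] AB(1,2) ab(3) by (auto simp: S_def split: if_splits)
    then show "A = B" by blast
  qed
  have coef: "(\<Prod>t\<in>P. h (lab t) (I t) (?J A t)) = c ^ card (S - A) * s ^ card A" if A: "A \<subseteq> S" for A
  proof -
    have "(\<Prod>t\<in>P. h (lab t) (I t) (?J A t)) = (\<Prod>t\<in>S. h (lab t) (I t) (?J A t))"
      by (rule prod.mono_neutral_right[OF fin SP])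
         (use A unused in \<open>auto simp: h_def S_def\<close>)
    also have "\<dots> = (\<Prod>t\<in>S - A. h (lab t) (I t) (?J A t)) * (\<Prod>t\<in>A. h (lab t) (I t) (?J A t))"
      by (rule prod.subset_diff[OF A finS])
    also have "(\<Prod>t\<in>S - A. h (lab t) (I t) (?J A t)) = (\<Prod>t\<in>S - A. c)"
      by (rule prod.cong) (auto simp: h_def S_def)
    also have "(\<Prod>t\<in>A. h (lab t) (I t) (?J A t)) = (\<Prod>t\<in>A. s)"
      using A ab(3) by (intro prod.cong) (auto simp: h_def S_def)
    finally show ?thesis by simp
  qed
  note TI
  also have "(\<Sum>J\<in>P \<rightarrow>\<^sub>E {..<n}. (\<Prod>t\<in>P. h (lab t) (I t) (J t)) * T J) =
      (\<Sum>J\<in>?J ` Pow S. (\<Prod>t\<in>P. h (lab t) (I t) (J t)) * T J)"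
  proof (rule sum.mono_neutral_right)
    show "finite (P \<rightarrow>\<^sub>E {..<n})" using fin by (simp add: finite_PiE)
    show "?J ` Pow S \<subseteq> P \<rightarrow>\<^sub>E {..<n}" using I ab(2) SP by (auto simp: PiE_iff extensional_def)
    show "\<forall>J\<in>(P \<rightarrow>\<^sub>E {..<n}) - ?J ` Pow S. (\<Prod>t\<in>P. h (lab t) (I t) (J t)) * T J = 0"
    proof
      fix J assume J: "J \<in> (P \<rightarrow>\<^sub>E {..<n}) - ?J ` Pow S"
      \<comment> \<open>A nonzero product forces \<open>J\<close> to agree with \<open>I\<close> off
        the fiber and to be \<open>a\<close> or \<open>b\<close> on it, so \<open>J\<close> comes
        from the subset where it is \<open>b\<close>.\<close>
      have "\<exists>t\<in>P. h (lab t) (I t) (J t) = 0"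
      proof (rule ccontr)
        assume "\<not> ?thesis"
        then have nz: "\<And>t. t \<in> P \<Longrightarrow> h (lab t) (I t) (J t) \<noteq> 0" by auto
        define A where "A = {t \<in> S. J t = b}"
        have "J t = ?J A t" if t: "t \<in> P" for t
        proof (cases "t \<in> S")
          case True
          then show ?thesis using nz[OF t] by (auto simp: A_def h_def S_def split: if_splits)
        next
          case False
          then show ?thesis
            using nz[OF t] unused[OF t] t by (auto simp: A_def h_def S_def split: if_splits)
        qed
        moreover have "J t = ?J A t" if t: "t \<notin> P" for t
          using t J I SP by (auto simp: PiE_iff extensional_def A_def)
        ultimately have "J = ?J A" by blast
        then have "J \<in> ?J ` Pow S" by (rule image_eqI) (auto simp: A_def)
        then show False using J by simp
      qed
      then have "(\<Prod>t\<in>P. h (lab t) (I t) (J t)) = 0" using fin by (subst prod_zero_iff) auto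
      then show "(\<Prod>t\<in>P. h (lab t) (I t) (J t)) * T J = 0" by simp
    qed
  qed
  also have "\<dots> = (\<Sum>A\<in>Pow S. (\<Prod>t\<in>P. h (lab t) (I t) (?J A t)) * T (?J A))"
    by (simp only: sum.reindex[OF inj] o_def)
  also have "\<dots> = (\<Sum>A\<in>Pow S. c ^ card (S - A) * s ^ card A * T (?J A))"
    by (intro sum.cong) (auto simp: coef)
  finally show ?thesis .
qed

text \<open>Every fiber of an index on which \<open>T\<close> does not vanish is even. If a fiber has at least four
  elements, some value \<open>b\<close> is unused, and a rotation in the plane of the fiber's value and \<open>b\<close>
  expresses \<open>T I\<close> by \<open>(c\<^sup>k + s\<^sup>k) T I\<close> and indices with one more value.\<close>

lemma invariant_tensor_eq_0:
  assumes fin: "finite P" and T: "invariant_tensor P lab n T"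
    and n: "\<And>x. card {t \<in> P. lab t = x} \<le> 2 * n"
    and pairs: "\<And>I. I \<in> P \<rightarrow>\<^sub>E {..<n} \<Longrightarrow>
      (\<And>t. t \<in> P \<Longrightarrow> card {s \<in> P. lab s = lab t \<and> I s = I t} = 2) \<Longrightarrow> T I = 0"
    and I: "I \<in> P \<rightarrow>\<^sub>E {..<n}"
  shows "T I = 0"
  using I
\<comment> \<open>The number of distinct pairs of label and value is at most \<open>card P\<close>
  and grows when a fiber is split, so this difference decreases.\<close>
proof (induction "card P - card ((\<lambda>t. (lab t, I t)) ` P)" arbitrary: I rule: less_induct)
  case less
  note I = less.prems
  define F where "F x a = {t \<in> P. lab t = x \<and> I t = a}" for x a
  have finF: "finite (F x a)" for x a using fin by (simp add: F_def)
  show ?case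
  proof (cases "(\<exists>x a. odd (card (F x a))) \<or> (\<forall>t\<in>P. card (F (lab t) (I t)) = 2)")
    case True
    then show ?thesis using invariant_tensor_odd[OF fin T I] pairs[OF I] by (auto simp: F_def)
  next
    case False
    then have even: "\<And>x a. even (card (F x a))" by auto
    from False obtain t0 where t0: "t0 \<in> P" "card (F (lab t0) (I t0)) \<noteq> 2" by auto
    define x a where "x = lab t0" and "a = I t0"
    have nz: "card (F x (I t)) \<ge> 2" if "t \<in> P" "lab t = x" for t
    proof -
      have "t \<in> F x (I t)" using that by (simp add: F_def)
      then have "card (F x (I t)) \<noteq> 0" using finF[of x "I t"] by auto
      then show ?thesis using even[of x "I t"] by (cases "card (F x (I t)) = 1") auto
    qed
    have card4: "card (F x a) \<ge> 4"
      using nz[OF t0(1)] t0(2) even[of x a] by (cases "card (F x a) = 3") (auto simp: x_def a_def)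
    let ?V = "I ` {t \<in> P. lab t = x}"
    have finV: "finite ?V" using fin by simp
    have "a \<in> ?V" using t0(1) by (auto simp: x_def a_def)
    \<comment> \<open>Counting with at least two positions per value and at least four for
      \<open>a\<close> gives \<open>2 * card ?V + 2 \<le> 2 * n\<close>, so fewer than
      \<open>n\<close> values occur. This is where the size of \<open>n\<close> enters.\<close>
    then have "2 * card ?V + 2 = (\<Sum>v\<in>?V. 2) + (\<Sum>v\<in>?V. if v = a then 2 else 0)"
      using finV by simp
    also have "\<dots> = (\<Sum>v\<in>?V. 2 + (if v = a then 2 else 0))" by (simp only: sum.distrib)
    also have "\<dots> \<le> (\<Sum>v\<in>?V. card (F x v))"
      using nz card4 by (intro sum_mono) (auto simp: numeral_2_eq_2)
    also have "\<dots> = card (\<Union>v\<in>?V. F x v)"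
      by (rule card_UN_disjoint[symmetric]) (use finV finF in \<open>auto simp: F_def\<close>)
    also have "(\<Union>v\<in>?V. F x v) = {t \<in> P. lab t = x}" by (auto simp: F_def)
    also have "card \<dots> \<le> 2 * n" by (rule n)
    finally have "card ?V < card {..<n}" by simp
    then have "\<not> {..<n} \<subseteq> ?V" using card_mono[OF finV, of "{..<n}"] by linarith
    then obtain b where b: "b < n" "b \<notin> ?V" by auto
    have an: "a < n" using I t0(1) by (auto simp: a_def)
    have ab: "a \<noteq> b" using b(2) t0(1) by (auto simp: x_def a_def)
    let ?J = "\<lambda>A t. if t \<in> A then b else I t"
    have FP: "F x a \<subseteq> P" by (auto simp: F_def)
    have J: "?J A \<in> P \<rightarrow>\<^sub>E {..<n}" if "A \<subseteq> F x a" for A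
      using I b(1) that FP by (auto simp: PiE_iff extensional_def)
    have T0: "T (?J A) = 0" if A: "A \<subseteq> F x a" "A \<noteq> {}" "A \<noteq> F x a" for A
    proof (rule less.hyps[OF _ J[OF A(1)]])
      obtain u v where uv: "u \<in> A" "v \<in> F x a" "v \<notin> A" using A by auto
      let ?f = "\<lambda>t. (lab t, I t)" and ?g = "\<lambda>t. (lab t, ?J A t)"
      have "?f t \<in> ?g ` P" if t: "t \<in> P" for t
      proof (cases "t \<in> A")
        case True
        then have "?f t = ?g v" using A(1) uv by (auto simp: F_def)
        then show ?thesis using uv(2) FP by blast
      qed (use t in auto)
      moreover have "(x, b) \<in> ?g ` P" using uv(1) A(1) FP by (intro image_eqI[of _ _ u]) (auto simp: F_def)
      moreover have "(x, b) \<notin> ?f ` P" using b(2) by auto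
      ultimately have "?f ` P \<subset> ?g ` P" by blast
      then have "card (?f ` P) < card (?g ` P)" using fin by (intro psubset_card_mono) auto
      moreover have "card (?g ` P) \<le> card P" by (rule card_image_le[OF fin])
      ultimately show "card P - card (?g ` P) < card P - card (?f ` P)" by linarith
    qed
    have TS: "T (?J (F x a)) = T I"
    proof (rule invariant_tensor_kernel[OF fin T J I])
      fix s t assume "s \<in> P" "t \<in> P" "lab s = lab t"
      then show "?J (F x a) s = ?J (F x a) t \<longleftrightarrow> I s = I t" using b(2) by (auto simp: F_def)
    qed simp
    define k where "k = card (F x a)"
    have "F x a \<noteq> {}" using card4 by auto
    have "T I = (\<Sum>A\<in>Pow (F x a). (3/5) ^ card (F x a - A) * (4/5) ^ card A * T (?J A))"
      unfolding F_def
      by (rule invariant_tensor_rotate[OF fin T I an b(1) ab]) (use b(2) in \<open>auto simp: power2_eq_square\<close>)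
    also have "\<dots> = (\<Sum>A\<in>{{}, F x a}. (3/5) ^ card (F x a - A) * (4/5) ^ card A * T (?J A))"
      by (rule sum.mono_neutral_right) (use finF T0 in auto)
    also have "\<dots> = ((3/5) ^ k + (4/5) ^ k) * T I"
      using \<open>F x a \<noteq> {}\<close> TS by (simp add: k_def algebra_simps)
    finally have eq: "T I = ((3/5) ^ k + (4/5) ^ k) * T I" .
    \<comment> \<open>3/5 and 4/5 are the coordinates of a rational point on the unit circle. For
      \<open>k \<ge> 3\<close> the sum of the powers is at most \<open>27/125 + 64/125 < 1\<close>,
      which forces \<open>T I = 0\<close>.\<close>
    have "(3/5 :: real) ^ k \<le> (3/5) ^ 3" "(4/5 :: real) ^ k \<le> (4/5) ^ 3"
      using card4 by (auto simp: k_def intro!: power_decreasing)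
    then have "(3/5 :: real) ^ k + (4/5) ^ k < 1" by (simp add: power3_eq_cube)
    then show ?thesis using eq by auto
  qed
qed

text \<open>Duality forces the coefficient of \<open>p\<close> to be the value of \<open>T\<close>
  at an index adapted to \<open>p\<close>. With these coefficients the difference vanishes at every
  index whose fibers are pairs, and \<open>invariant_tensor_eq_0\<close> extends this to all
  indices.\<close>

lemma invariant_tensor_in_span:
  assumes fin: "finite P" and T: "invariant_tensor P lab n T"
    and n: "\<And>x. card {t \<in> P. lab t = x} \<le> 2 * n"
  obtains a where "\<And>I. I \<in> P \<rightarrow>\<^sub>E {..<n} \<Longrightarrow>
    T I = (\<Sum>p\<in>pairings P lab. a p * of_bool (\<forall>t\<in>P. I (p t) = I t))"
proof -
  have "\<exists>I. I \<in> P \<rightarrow>\<^sub>E {..<n} \<and> adapted P lab p I" if "p \<in> pairings P lab" for p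
    using adapted_index_exists[OF fin that n] by blast
  then obtain K where K: "\<And>p. p \<in> pairings P lab \<Longrightarrow> K p \<in> P \<rightarrow>\<^sub>E {..<n}"
    "\<And>p. p \<in> pairings P lab \<Longrightarrow> adapted P lab p (K p)" by metis
  define T' where "T' I = T I - (\<Sum>p\<in>pairings P lab. T (K p) * of_bool (\<forall>t\<in>P. I (p t) = I t))" for I
  have T': "invariant_tensor P lab n T'"
    unfolding T'_def by (rule invariant_tensor_diff_sum[OF fin T])
  have "T' I = 0" if I: "I \<in> P \<rightarrow>\<^sub>E {..<n}" for I
  proof (rule invariant_tensor_eq_0[OF fin T' n _ I])
    fix I assume I: "I \<in> P \<rightarrow>\<^sub>E {..<n}"
      and two: "\<And>t. t \<in> P \<Longrightarrow> card {s \<in> P. lab s = lab t \<and> I s = I t} = 2"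
    \<comment> \<open>With fibers of size two each position has exactly one partner; the partners
      form the pairing to which \<open>I\<close> is adapted.\<close>
    have "\<exists>u. u \<noteq> t \<and> {s \<in> P. lab s = lab t \<and> I s = I t} = {t, u}" if t: "t \<in> P" for t
    proof -
      obtain u v where uv: "{s \<in> P. lab s = lab t \<and> I s = I t} = {u, v}" "u \<noteq> v"
        using two[OF t] by (auto simp: card_2_iff)
      moreover have "t \<in> {u, v}" unfolding uv(1)[symmetric] using t by simp
      ultimately show ?thesis by auto
    qed
    then obtain q0 where q0: "\<And>t. t \<in> P \<Longrightarrow> q0 t \<noteq> t"
      "\<And>t. t \<in> P \<Longrightarrow> {s \<in> P. lab s = lab t \<and> I s = I t} = {t, q0 t}" by metis
    define q where "q = restrict q0 P"
    have mem: "s \<in> P \<and> lab s = lab t \<and> I s = I t \<longleftrightarrow> s = t \<or> s = q t" if "t \<in> P" for s t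
      using q0(2)[OF that] that by (auto simp: q_def)
    have "q \<in> pairings P lab"
    proof -
      have "q t \<in> P \<and> q t \<noteq> t \<and> q (q t) = t \<and> lab (q t) = lab t" if t: "t \<in> P" for t
      proof -
        have qt: "q t \<in> P" "lab (q t) = lab t" "I (q t) = I t" "q t \<noteq> t"
          using mem[OF t, of "q t"] q0(1)[OF t] t by (auto simp: q_def)
        then have "t = q t \<or> t = q (q t)" using mem[OF qt(1), of t] t by auto
        then show ?thesis using qt by auto
      qed
      moreover have "q \<in> extensional P" by (simp add: q_def)
      ultimately show ?thesis by (auto simp: pairings_def PiE_iff)
    qed
    have ad: "adapted P lab q I" unfolding adapted_def using mem by blast
    have "T I = T (K q)"
      by (rule invariant_tensor_kernel[OF fin T I K(1)[OF \<open>q \<in> _\<close>]])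
         (use adaptedD[OF ad] adaptedD[OF K(2)[OF \<open>q \<in> _\<close>]] in auto)
    moreover have "(\<Sum>p\<in>pairings P lab. T (K p) * of_bool (\<forall>t\<in>P. I (p t) = I t)) =
        (\<Sum>p\<in>pairings P lab. if p = q then T (K p) else 0)"
      using adapted_compatible_iff[OF ad \<open>q \<in> _\<close>] by (intro sum.cong) auto
    moreover have "\<dots> = T (K q)" using \<open>q \<in> _\<close> finite_pairings[OF fin] by simp
    ultimately show "T' I = 0" by (simp add: T'_def)
  qed
  then show thesis by (intro that[of "\<lambda>p. T (K p)"]) (simp add: T'_def)
qed

subsection \<open>Traces of words as sums over indices\<close>

lemma mem_orthogonal_groupD:
  assumes "A \<in> carrier (orthogonal_group n)"
  shows "A \<in> carrier_mat n n" "transpose_mat A * A = 1\<^sub>m n" "A * transpose_mat A = 1\<^sub>m n"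
proof -
  show A: "A \<in> carrier_mat n n" and *: "transpose_mat A * A = 1\<^sub>m n"
    using assms by (auto simp: orthogonal_group_def)
  show "A * transpose_mat A = 1\<^sub>m n"
    by (rule mat_mult_left_right_inverse[OF _ A *]) (use A in simp)
qed

lemma transpose_mem_orthogonal_group:
  assumes "A \<in> carrier (orthogonal_group n)"
  shows "transpose_mat A \<in> carrier (orthogonal_group n)"
  using mem_orthogonal_groupD[OF assms] by (simp add: orthogonal_group_def)

lemma mult_mem_orthogonal_group:
  assumes "A \<in> carrier (orthogonal_group n)" "B \<in> carrier (orthogonal_group n)"
  shows "A * B \<in> carrier (orthogonal_group n)"
proof -
  note A = mem_orthogonal_groupD[OF assms(1)] and B = mem_orthogonal_groupD[OF assms(2)]
  have "transpose_mat (A * B) * (A * B) = transpose_mat B * (transpose_mat A * (A * B))"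
    using A(1) B(1) by (simp add: transpose_mult assoc_mult_mat[of _ n n _ n _ n])
  also have "transpose_mat A * (A * B) = (transpose_mat A * A) * B"
    using A(1) B(1) by (simp add: assoc_mult_mat[of _ n n _ n _ n])
  also have "\<dots> = B" using A B by simp
  finally show ?thesis using A(1) B by (simp add: orthogonal_group_def)
qed

lemma group_orthogonal_group: "group (orthogonal_group n)"
proof (rule groupI)
  fix A assume A: "A \<in> carrier (orthogonal_group n)"
  show "\<exists>B\<in>carrier (orthogonal_group n). B \<otimes>\<^bsub>orthogonal_group n\<^esub> A = \<one>\<^bsub>orthogonal_group n\<^esub>"
    by (rule bexI[OF _ transpose_mem_orthogonal_group[OF A]])
       (use mem_orthogonal_groupD(2)[OF A] in \<open>simp add: orthogonal_group_def\<close>)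
next
  fix A B assume "A \<in> carrier (orthogonal_group n)" "B \<in> carrier (orthogonal_group n)"
  from mult_mem_orthogonal_group[OF this]
  show "A \<otimes>\<^bsub>orthogonal_group n\<^esub> B \<in> carrier (orthogonal_group n)" by (simp add: orthogonal_group_def)
qed (auto simp: orthogonal_group_def assoc_mult_mat[of _ n n _ n _ n])

lemma inv_orthogonal_group:
  assumes "A \<in> carrier (orthogonal_group n)"
  shows "inv\<^bsub>orthogonal_group n\<^esub> A = transpose_mat A"
proof -
  interpret group "orthogonal_group n" by (rule group_orthogonal_group)
  show ?thesis
    by (rule inv_equality[OF _ assms transpose_mem_orthogonal_group[OF assms]])
       (use mem_orthogonal_groupD(2)[OF assms] in \<open>simp add: orthogonal_group_def\<close>)
qed

definition letter_mat :: "(nat \<Rightarrow> real mat) \<Rightarrow> letter \<Rightarrow> real mat" where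
  "letter_mat g a = (if snd a then g (fst a) else transpose_mat (g (fst a)))"

lemma word_eval_Nil: "word_eval (orthogonal_group n) g [] = 1\<^sub>m n"
  by (simp add: word_eval_def orthogonal_group_def)

lemma word_eval_Cons:
  assumes "g (fst a) \<in> carrier (orthogonal_group n)"
  shows "word_eval (orthogonal_group n) g (a # w) = letter_mat g a * word_eval (orthogonal_group n) g w"
  using inv_orthogonal_group[OF assms]
  by (cases a) (simp add: word_eval_def letter_mat_def orthogonal_group_def)

lemma letter_mat_carrier:
  "g (fst a) \<in> carrier (orthogonal_group n) \<Longrightarrow> letter_mat g a \<in> carrier_mat n n"
  using mem_orthogonal_groupD(1)[of "g (fst a)" n] by (simp add: letter_mat_def)

lemma word_eval_carrier:
  "\<forall>a\<in>set w. g (fst a) \<in> carrier (orthogonal_group n) \<Longrightarrow>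
    word_eval (orthogonal_group n) g w \<in> carrier_mat n n"
  by (induction w) (auto simp: word_eval_Nil word_eval_Cons intro: mult_carrier_mat letter_mat_carrier)

lemma word_eval_snoc:
  assumes "\<forall>a\<in>set (w @ [b]). g (fst a) \<in> carrier (orthogonal_group n)"
  shows "word_eval (orthogonal_group n) g (w @ [b]) = word_eval (orthogonal_group n) g w * letter_mat g b"
  using assms
proof (induction w)
  case Nil
  then show ?case using letter_mat_carrier[of g b n] by (simp add: word_eval_Cons word_eval_Nil)
next
  case (Cons a w)
  then show ?case
    using word_eval_carrier[of w g n] letter_mat_carrier[of g a n] letter_mat_carrier[of g b n]
    by (simp add: word_eval_Cons assoc_mult_mat[of _ n n _ n _ n])
qed

section \<open>Words, traces and products of traces as sums over index functions\<close>

lemma sum_PiE_insert: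
  assumes "x \<notin> S"
  shows "(\<Sum>i\<in>insert x S \<rightarrow>\<^sub>E B. F i) = (\<Sum>c\<in>B. \<Sum>i\<in>S \<rightarrow>\<^sub>E B. F (i(x := c)))"
proof -
  have "(\<Sum>i\<in>insert x S \<rightarrow>\<^sub>E B. F i) = (\<Sum>(c, i)\<in>B \<times> (S \<rightarrow>\<^sub>E B). F (i(x := c)))"
    unfolding PiE_insert_eq
    by (subst sum.reindex) (use inj_combinator[OF assms] in \<open>auto simp: case_prod_unfold o_def\<close>)
  then show ?thesis by (simp add: sum.cartesian_product)
qed

text \<open>A sum over paths from \<open>a\<close> to \<open>b\<close> with interior vertices
  \<open>1\<close> to \<open>length w - 1\<close>. Appending a letter turns the old end into a new
  interior vertex, hence the induction from the right.\<close>

lemma word_eval_entry: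
  assumes "\<forall>a\<in>set w. g (fst a) \<in> carrier (orthogonal_group n)" "w \<noteq> []" "a < n" "b < n"
  shows "word_eval (orthogonal_group n) g w $$ (a, b) =
    (\<Sum>i\<in>{1..<length w} \<rightarrow>\<^sub>E {..<n}. \<Prod>k<length w.
      letter_mat g (w ! k) $$ (if k = 0 then a else i k, if Suc k < length w then i (Suc k) else b))"
  using assms
proof (induction w arbitrary: b rule: rev_induct)
  case (snoc x w)
  have x: "letter_mat g x \<in> carrier_mat n n" using snoc.prems(1) by (intro letter_mat_carrier) auto
  show ?case
  proof (cases "w = []")
    case True
    then show ?thesis using x snoc.prems word_eval_snoc[of w x g n]
      by (simp add: word_eval_Nil)
  next
    case False
    define l where "l = length w"
    have l: "l > 0" using False by (simp add: l_def)
    have w: "word_eval (orthogonal_group n) g w \<in> carrier_mat n n"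
      using snoc.prems(1) by (intro word_eval_carrier) auto
    have "word_eval (orthogonal_group n) g (w @ [x]) $$ (a, b) =
        (\<Sum>c<n. word_eval (orthogonal_group n) g w $$ (a, c) * letter_mat g x $$ (c, b))"
      using word_eval_snoc[OF snoc.prems(1)] w x snoc.prems(3,4)
      by (auto simp: scalar_prod_def atLeast0LessThan intro!: sum.cong)
    also have "\<dots> = (\<Sum>c<n. \<Sum>i\<in>{1..<l} \<rightarrow>\<^sub>E {..<n}. (\<Prod>k<l.
        letter_mat g (w ! k) $$ (if k = 0 then a else i k, if Suc k < l then i (Suc k) else c)) * letter_mat g x $$ (c, b))"
      using snoc.IH[of _] snoc.prems False
      by (intro sum.cong) (auto simp: sum_distrib_right l_def)
    also have "\<dots> = (\<Sum>c<n. \<Sum>i\<in>{1..<l} \<rightarrow>\<^sub>E {..<n}. \<Prod>k<Suc l.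
        letter_mat g ((w @ [x]) ! k) $$ (if k = 0 then a else (i(l := c)) k,
          if Suc k < Suc l then (i(l := c)) (Suc k) else b))"
    proof (intro sum.cong refl)
      fix c i
      have "(\<Prod>k<l. letter_mat g (w ! k) $$ (if k = 0 then a else i k, if Suc k < l then i (Suc k) else c)) =
        (\<Prod>k<l. letter_mat g ((w @ [x]) ! k) $$ (if k = 0 then a else (i(l := c)) k,
          if Suc k < Suc l then (i(l := c)) (Suc k) else b))"
        by (intro prod.cong) (auto simp: l_def nth_append)
      then show "(\<Prod>k<l. letter_mat g (w ! k) $$ (if k = 0 then a else i k, if Suc k < l then i (Suc k) else c)) * letter_mat g x $$ (c, b)
        = (\<Prod>k<Suc l. letter_mat g ((w @ [x]) ! k) $$ (if k = 0 then a else (i(l := c)) k,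
          if Suc k < Suc l then (i(l := c)) (Suc k) else b))"
        using l by (simp add: l_def)
    qed
    also have "\<dots> = (\<Sum>i\<in>insert l {1..<l} \<rightarrow>\<^sub>E {..<n}. \<Prod>k<Suc l.
        letter_mat g ((w @ [x]) ! k) $$ (if k = 0 then a else i k, if Suc k < Suc l then i (Suc k) else b))"
      by (rule sum_PiE_insert[symmetric]) simp
    also have "insert l {1..<l} = {1..<Suc l}" using l by auto
    finally show ?thesis by (simp add: l_def)
  qed
qed simp

text \<open>The trace closes the path: both ends become vertex \<open>0\<close>, which is the
  wrap-around in the column index.\<close>

lemma mat_trace_word_eval:
  assumes "\<forall>a\<in>set w. g (fst a) \<in> carrier (orthogonal_group n)" "w \<noteq> []"
  shows "mat_trace (word_eval (orthogonal_group n) g w) =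
    (\<Sum>i\<in>{..<length w} \<rightarrow>\<^sub>E {..<n}. \<Prod>k<length w.
      letter_mat g (w ! k) $$ (i k, i (if Suc k < length w then Suc k else 0)))"
proof -
  have "insert 0 {1..<length w} = {..<length w}" using assms(2) by (auto simp: Suc_le_eq)
  then have "(\<Sum>i\<in>{..<length w} \<rightarrow>\<^sub>E {..<n}. \<Prod>k<length w.
      letter_mat g (w ! k) $$ (i k, i (if Suc k < length w then Suc k else 0))) =
    (\<Sum>i\<in>insert 0 {1..<length w} \<rightarrow>\<^sub>E {..<n}. \<Prod>k<length w.
      letter_mat g (w ! k) $$ (i k, i (if Suc k < length w then Suc k else 0)))"
    by simp
  also have "\<dots> = (\<Sum>a<n. \<Sum>i\<in>{1..<length w} \<rightarrow>\<^sub>E {..<n}. \<Prod>k<length w.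
      letter_mat g (w ! k) $$ ((i(0 := a)) k, (i(0 := a)) (if Suc k < length w then Suc k else 0)))"
    by (rule sum_PiE_insert) simp
  also have "\<dots> = (\<Sum>a<n. word_eval (orthogonal_group n) g w $$ (a, a))"
  proof (rule sum.cong[OF refl])
    fix a assume "a \<in> {..<n}"
    then have a: "a < n" by simp
    show "(\<Sum>i\<in>{1..<length w} \<rightarrow>\<^sub>E {..<n}. \<Prod>k<length w.
        letter_mat g (w ! k) $$ ((i(0 := a)) k, (i(0 := a)) (if Suc k < length w then Suc k else 0))) =
      word_eval (orthogonal_group n) g w $$ (a, a)"
      unfolding word_eval_entry[OF assms a a] by (intro sum.cong prod.cong refl) auto
  qed
  also have "\<dots> = mat_trace (word_eval (orthogonal_group n) g w)"
    using word_eval_carrier[of w g n] assms(1) by (simp add: mat_trace_def)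
  finally show ?thesis by simp
qed

text \<open>Each occurrence of a letter gets a single number from its word and its place, the same
  number that the coded computation uses.\<close>

definition word_positions :: "word list \<Rightarrow> nat set" where
  "word_positions ws = {t. pfst t < length ws \<and> psnd t < length (ws ! pfst t)}"

definition next_position :: "word list \<Rightarrow> nat \<Rightarrow> nat" where
  "next_position ws t = pair (pfst t) (if Suc (psnd t) < length (ws ! pfst t) then Suc (psnd t) else 0)"

definition letter_at :: "word list \<Rightarrow> nat \<Rightarrow> letter" where
  "letter_at ws t = ws ! pfst t ! psnd t"

lemma word_positions_eq:
  "word_positions ws = prod_encode ` (SIGMA j:{..<length ws}. {..<length (ws ! j)})"
proof -
  have "t \<in> prod_encode ` (SIGMA j:{..<length ws}. {..<length (ws ! j)})" if "t \<in> word_positions ws" for t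
    using that by (intro image_eqI[of _ _ "(pfst t, psnd t)"]) (auto simp: word_positions_def)
  then show ?thesis by (auto simp: word_positions_def)
qed

lemma prod_word_positions:
  "(\<Prod>t\<in>word_positions ws. f t) = (\<Prod>j<length ws. \<Prod>k<length (ws ! j). f (pair j k))"
proof -
  have "(\<Prod>t\<in>word_positions ws. f t) = (\<Prod>z\<in>(SIGMA j:{..<length ws}. {..<length (ws ! j)}). f (prod_encode z))"
    unfolding word_positions_eq by (subst prod.reindex) (auto intro: inj_on_subset[OF inj_prod_encode])
  then show ?thesis by (simp add: prod.Sigma case_prod_unfold)
qed

text \<open>Distributing the product over the sums gives one index function per word;
  \<open>pair\<close> flattens such a family to one function on all positions.\<close>

lemma prod_traces_eq_sum:
  assumes g: "\<And>w a. w \<in> set ws \<Longrightarrow> a \<in> set w \<Longrightarrow> g (fst a) \<in> carrier (orthogonal_group n)"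
    and ne: "\<And>w. w \<in> set ws \<Longrightarrow> w \<noteq> []"
  shows "(\<Prod>w\<leftarrow>ws. mat_trace (word_eval (orthogonal_group n) g w)) =
    (\<Sum>i\<in>word_positions ws \<rightarrow>\<^sub>E {..<n}. \<Prod>t\<in>word_positions ws.
      letter_mat g (letter_at ws t) $$ (i t, i (next_position ws t)))"
proof -
  let ?K = "\<lambda>j. {..<length (ws ! j)} \<rightarrow>\<^sub>E {..<n}"
  let ?nx = "\<lambda>j k. if Suc k < length (ws ! j) then Suc k else 0"
  let ?f = "\<lambda>j i. \<Prod>k<length (ws ! j). letter_mat g (ws ! j ! k) $$ (i k, i (?nx j k))"
  have "(\<Prod>w\<leftarrow>ws. mat_trace (word_eval (orthogonal_group n) g w)) =
      (\<Prod>j<length ws. mat_trace (word_eval (orthogonal_group n) g (ws ! j)))"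
    by (subst prod.list_conv_set_nth) (simp add: atLeast0LessThan)
  also have "\<dots> = (\<Prod>j<length ws. \<Sum>i\<in>?K j. ?f j i)"
    using g ne nth_mem by (intro prod.cong refl mat_trace_word_eval ballI) blast+
  also have "\<dots> = (\<Sum>G\<in>PiE {..<length ws} ?K. \<Prod>j<length ws. ?f j (G j))"
    by (rule prod_sum_PiE) (auto intro: finite_PiE)
  also have "\<dots> = (\<Sum>i\<in>word_positions ws \<rightarrow>\<^sub>E {..<n}. \<Prod>t\<in>word_positions ws.
      letter_mat g (letter_at ws t) $$ (i t, i (next_position ws t)))"
  proof (rule sum.reindex_bij_witness[of _
        "\<lambda>i. \<lambda>j\<in>{..<length ws}. \<lambda>k\<in>{..<length (ws ! j)}. i (pair j k)"
        "\<lambda>G. \<lambda>t\<in>word_positions ws. G (pfst t) (psnd t)"])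
    fix G assume G: "G \<in> PiE {..<length ws} ?K"
    have GK: "G j k < n" if "j < length ws" "k < length (ws ! j)" for j k
      using PiE_mem[OF PiE_mem[OF G, of j], of k] that by simp
    let ?i = "\<lambda>t\<in>word_positions ws. G (pfst t) (psnd t)"
    have ij: "(\<lambda>k\<in>{..<length (ws ! j)}. ?i (pair j k)) = G j" if j: "j < length ws" for j
    proof (rule PiE_ext[of _ "{..<length (ws ! j)}" "\<lambda>_. {..<n}"])
      show "G j \<in> ?K j" using PiE_mem[OF G, of j] j by simp
    qed (use j GK in \<open>simp_all add: word_positions_def restrict_PiE_iff\<close>)
    show "(\<lambda>j\<in>{..<length ws}. \<lambda>k\<in>{..<length (ws ! j)}. ?i (pair j k)) = G"
      by (rule extensionalityI[of _ "{..<length ws}"]) (use G ij in \<open>auto simp: PiE_iff\<close>)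
    show "?i \<in> word_positions ws \<rightarrow>\<^sub>E {..<n}"
      unfolding restrict_PiE_iff using GK by (simp add: word_positions_def)
    show "(\<Prod>t\<in>word_positions ws. letter_mat g (letter_at ws t) $$
        ((\<lambda>t\<in>word_positions ws. G (pfst t) (psnd t)) t,
         (\<lambda>t\<in>word_positions ws. G (pfst t) (psnd t)) (next_position ws t))) =
      (\<Prod>j<length ws. ?f j (G j))"
      unfolding prod_word_positions
      by (intro prod.cong refl) (auto simp: word_positions_def next_position_def letter_at_def)
  next
    fix i assume i: "i \<in> word_positions ws \<rightarrow>\<^sub>E {..<n}"
    show "(\<lambda>t\<in>word_positions ws. (\<lambda>j\<in>{..<length ws}. \<lambda>k\<in>{..<length (ws ! j)}. i (pair j k)) (pfst t) (psnd t)) = i"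
      by (rule extensionalityI[of _ "word_positions ws"]) (use i in \<open>auto simp: word_positions_def PiE_iff\<close>)
    show "(\<lambda>j\<in>{..<length ws}. \<lambda>k\<in>{..<length (ws ! j)}. i (pair j k)) \<in> PiE {..<length ws} ?K"
      unfolding restrict_PiE_iff using PiE_mem[OF i] by (simp add: word_positions_def)
  qed
  finally show ?thesis .
qed

subsection \<open>Moments of matrix entries\<close>

lemma measurable_entry_orthogonal_group:
  assumes "i < n" "j < n"
  shows "(\<lambda>A. A $$ (i, j)) \<in> borel_measurable (borel_orthogonal_group n)"
proof -
  have "(\<lambda>A. \<lambda>p\<in>{..<n} \<times> {..<n}. A $$ p) \<in>
      measurable (borel_orthogonal_group n) (\<Pi>\<^sub>M p\<in>{..<n} \<times> {..<n}. borel :: real measure)"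
    unfolding borel_orthogonal_group_def by (rule measurable_vimage_algebra1) (auto simp: space_PiM)
  moreover have "(\<lambda>f. f (i, j)) \<in> measurable (\<Pi>\<^sub>M p\<in>{..<n} \<times> {..<n}. borel :: real measure) borel"
    using assms by (intro measurable_component_singleton) auto
  ultimately have "(\<lambda>A. (\<lambda>p\<in>{..<n} \<times> {..<n}. A $$ p) (i, j)) \<in> borel_measurable (borel_orthogonal_group n)"
    by (rule measurable_compose)
  then show ?thesis using assms by simp
qed

lemma space_borel_orthogonal_group [simp]: "space (borel_orthogonal_group n) = carrier (orthogonal_group n)"
  by (simp add: borel_orthogonal_group_def)

lemma measurable_left_mult_orthogonal_group:
  assumes g: "g \<in> carrier (orthogonal_group n)"
  shows "(\<lambda>h. g * h) \<in> measurable (borel_orthogonal_group n) (borel_orthogonal_group n)"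
proof -
  have *: "(\<lambda>h. \<lambda>p\<in>{..<n} \<times> {..<n}. (g * h) $$ p) \<in>
      measurable (borel_orthogonal_group n) (\<Pi>\<^sub>M p\<in>{..<n} \<times> {..<n}. borel :: real measure)"
  proof (rule measurable_restrict)
    fix p :: "nat \<times> nat" assume "p \<in> {..<n} \<times> {..<n}"
    then obtain i j where p: "p = (i, j)" "i < n" "j < n" by auto
    have "(\<lambda>h. \<Sum>k<n. g $$ (i, k) * h $$ (k, j)) \<in> borel_measurable (borel_orthogonal_group n)"
      using p by (intro borel_measurable_sum borel_measurable_times measurable_entry_orthogonal_group) auto
    moreover have "(g * h) $$ p = (\<Sum>k<n. g $$ (i, k) * h $$ (k, j))"
      if "h \<in> space (borel_orthogonal_group n)" for h
      using that mem_orthogonal_groupD(1)[OF g] mem_orthogonal_groupD(1)[of h n] p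
      by (auto simp: scalar_prod_def atLeast0LessThan intro!: sum.cong)
    ultimately show "(\<lambda>h. (g * h) $$ p) \<in> borel_measurable (borel_orthogonal_group n)"
      using measurable_cong[of "borel_orthogonal_group n" "\<lambda>h. (g * h) $$ p"
        "\<lambda>h. \<Sum>k<n. g $$ (i, k) * h $$ (k, j)" borel] by simp
  qed
  have "(\<lambda>h. g * h) \<in> space (borel_orthogonal_group n) \<rightarrow> carrier (orthogonal_group n)"
    using mult_mem_orthogonal_group[OF g] by auto
  from measurable_vimage_algebra2[OF this, of "\<lambda>A. \<lambda>p\<in>{..<n} \<times> {..<n}. A $$ p", OF *]
  show ?thesis by (fold borel_orthogonal_group_def)
qed

lemma sum_column_products_orthogonal_group:
  assumes "A \<in> carrier (orthogonal_group n)" "i < n" "j < n"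
  shows "(\<Sum>k<n. A $$ (k, i) * A $$ (k, j)) = of_bool (i = j)"
proof -
  have "(\<Sum>k<n. A $$ (k, i) * A $$ (k, j)) = (transpose_mat A * A) $$ (i, j)"
    using mem_orthogonal_groupD(1)[OF assms(1)] assms
    by (auto simp: scalar_prod_def atLeast0LessThan intro!: sum.cong)
  then show ?thesis using mem_orthogonal_groupD(2)[OF assms(1)] assms by simp
qed

text \<open>Columns are unit vectors. The bound makes monomials in the entries integrable.\<close>

lemma abs_entry_orthogonal_group_le_1:
  assumes "A \<in> carrier (orthogonal_group n)" "i < n" "j < n"
  shows "\<bar>A $$ (i, j)\<bar> \<le> 1"
proof -
  have "(A $$ (i, j))\<^sup>2 \<le> (\<Sum>k<n. (A $$ (k, j))\<^sup>2)"
    by (rule member_le_sum) (use assms in auto)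
  also have "\<dots> = 1"
    using sum_column_products_orthogonal_group[OF assms(1,3,3)] by (simp add: power2_eq_square)
  finally show ?thesis by (simp add: abs_square_le_1)
qed

text \<open>Orthonormal rows make the transpose a right inverse, while membership asks for a left
  inverse; for square matrices one gives the other.\<close>

lemma row_orthonormal_mat_orthogonal:
  assumes "row_orthonormal n h"
  shows "mat n n (\<lambda>(i, k). h i k) \<in> carrier (orthogonal_group n)"
proof -
  let ?A = "mat n n (\<lambda>(i, k). h i k)"
  have "?A * transpose_mat ?A = 1\<^sub>m n"
    by (rule eq_matI) (use assms in \<open>auto simp: row_orthonormal_def scalar_prod_def atLeast0LessThan\<close>)
  then have "transpose_mat ?A * ?A = 1\<^sub>m n"
    by (rule mat_mult_left_right_inverse[rotated 2]) auto
  then show ?thesis by (simp add: orthogonal_group_def)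
qed

lemma distr_PiM_preserving:
  assumes fin: "finite I" and M: "prob_space M"
    and f: "\<And>i. i \<in> I \<Longrightarrow> f i \<in> measurable M M" "\<And>i. i \<in> I \<Longrightarrow> distr M M (f i) = M"
  shows "distr (\<Pi>\<^sub>M i\<in>I. M) (\<Pi>\<^sub>M i\<in>I. M) (\<lambda>g. \<lambda>i\<in>I. f i (g i)) = (\<Pi>\<^sub>M i\<in>I. M)"
proof -
  interpret M: prob_space M by (rule M)
  interpret product_sigma_finite "\<lambda>_. M" by unfold_locales
  let ?F = "\<lambda>g. \<lambda>i\<in>I. f i (g i)"
  have F: "?F \<in> measurable (\<Pi>\<^sub>M i\<in>I. M) (\<Pi>\<^sub>M i\<in>I. M)"
    using f(1) by (intro measurable_restrict measurable_compose[OF measurable_component_singleton]) auto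
  show ?thesis
  proof (rule PiM_eqI[OF fin])
    fix A assume A: "\<And>i. i \<in> I \<Longrightarrow> A i \<in> sets M"
    have "emeasure (distr (\<Pi>\<^sub>M i\<in>I. M) (\<Pi>\<^sub>M i\<in>I. M) ?F) (Pi\<^sub>E I A) =
        emeasure (\<Pi>\<^sub>M i\<in>I. M) (?F -` Pi\<^sub>E I A \<inter> space (\<Pi>\<^sub>M i\<in>I. M))"
      by (rule emeasure_distr[OF F]) (use A fin in \<open>auto intro: sets_PiM_I_finite\<close>)
    also have "?F -` Pi\<^sub>E I A \<inter> space (\<Pi>\<^sub>M i\<in>I. M) = Pi\<^sub>E I (\<lambda>i. f i -` A i \<inter> space M)"
      by (auto simp: space_PiM PiE_iff)
    also have "emeasure (\<Pi>\<^sub>M i\<in>I. M) \<dots> = (\<Prod>i\<in>I. emeasure M (f i -` A i \<inter> space M))"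
      by (rule emeasure_PiM[OF fin]) (use f(1) A in \<open>auto intro: measurable_sets\<close>)
    also have "\<dots> = (\<Prod>i\<in>I. emeasure M (A i))"
    proof (rule prod.cong[OF refl])
      fix i assume i: "i \<in> I"
      show "emeasure M (f i -` A i \<inter> space M) = emeasure M (A i)"
        using emeasure_distr[OF f(1)[OF i] A[OF i]] f(2)[OF i] by simp
    qed
    finally show "emeasure (distr (\<Pi>\<^sub>M i\<in>I. M) (\<Pi>\<^sub>M i\<in>I. M) ?F) (Pi\<^sub>E I A) = (\<Prod>i\<in>I. emeasure M (A i))" .
  qed simp
qed

text \<open>\<open>dim\<close> is the form in which the lower bound on the dimension enters: no
  label occupies more than \<open>2 * n\<close> positions.\<close>

locale haar_moments =
  fixes n r :: nat and \<mu> :: "real mat measure" and P :: "nat set" and lab :: "nat \<Rightarrow> nat"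
  assumes haar: "haar_prob_orthogonal n \<mu>" and finP: "finite P"
    and lab: "\<And>t. t \<in> P \<Longrightarrow> lab t < r"
    and dim: "\<And>x. card {t \<in> P. lab t = x} \<le> 2 * n"
begin

abbreviation \<Omega> :: "(nat \<Rightarrow> real mat) measure" where "\<Omega> \<equiv> \<Pi>\<^sub>M i\<in>{..<r}. \<mu>"

definition monomial :: "(nat \<Rightarrow> nat) \<Rightarrow> (nat \<Rightarrow> nat) \<Rightarrow> (nat \<Rightarrow> real mat) \<Rightarrow> real" where
  "monomial I J g = (\<Prod>t\<in>P. g (lab t) $$ (I t, J t))"

abbreviation moment :: "(nat \<Rightarrow> nat) \<Rightarrow> (nat \<Rightarrow> nat) \<Rightarrow> real" where
  "moment I J \<equiv> integral\<^sup>L \<Omega> (monomial I J)"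

lemma prob_space_\<mu>: "prob_space \<mu>" and space_\<mu>: "space \<mu> = carrier (orthogonal_group n)"
  and sets_\<mu>: "sets \<mu> = sets (borel_orthogonal_group n)"
  and distr_\<mu>: "g \<in> carrier (orthogonal_group n) \<Longrightarrow> distr \<mu> \<mu> (\<lambda>h. g * h) = \<mu>"
  using haar by (auto simp: haar_prob_orthogonal_def orthogonal_group_def)

lemma prob_space_\<Omega>: "prob_space \<Omega>"
  using prob_space_\<mu> by (intro prob_space_PiM)

lemma space_\<Omega>D: "g \<in> space \<Omega> \<Longrightarrow> x < r \<Longrightarrow> g x \<in> carrier (orthogonal_group n)"
  using space_\<mu> by (auto simp: space_PiM)

lemma measurable_monomial:
  assumes "I \<in> P \<rightarrow>\<^sub>E {..<n}" "J \<in> P \<rightarrow>\<^sub>E {..<n}"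
  shows "monomial I J \<in> borel_measurable \<Omega>"
  unfolding monomial_def
proof (rule borel_measurable_prod)
  fix t assume t: "t \<in> P"
  have "(\<lambda>A. A $$ (I t, J t)) \<in> borel_measurable \<mu>"
    using measurable_entry_orthogonal_group[of "I t" n "J t"] PiE_mem[OF assms(1) t] PiE_mem[OF assms(2) t]
    by (simp add: measurable_cong_sets[OF sets_\<mu> refl])
  moreover have "(\<lambda>g. g (lab t)) \<in> measurable \<Omega> \<mu>"
    using lab[OF t] by (intro measurable_component_singleton) simp
  ultimately show "(\<lambda>g. g (lab t) $$ (I t, J t)) \<in> borel_measurable \<Omega>"
    by (rule measurable_compose[rotated])
qed

lemma integrable_monomial:
  assumes "I \<in> P \<rightarrow>\<^sub>E {..<n}" "J \<in> P \<rightarrow>\<^sub>E {..<n}"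
  shows "integrable \<Omega> (monomial I J)"
proof -
  interpret prob_space \<Omega> by (rule prob_space_\<Omega>)
  have "\<bar>monomial I J g\<bar> \<le> 1" if g: "g \<in> space \<Omega>" for g
    unfolding monomial_def abs_prod
  proof (rule prod_le_1)
    fix t assume t: "t \<in> P"
    show "0 \<le> \<bar>g (lab t) $$ (I t, J t)\<bar> \<and> \<bar>g (lab t) $$ (I t, J t)\<bar> \<le> 1"
      using abs_entry_orthogonal_group_le_1[OF space_\<Omega>D[OF g lab[OF t]]]
        PiE_mem[OF assms(1) t] PiE_mem[OF assms(2) t] by simp
  qed
  then show ?thesis
    by (intro integrable_const_bound[of _ 1] measurable_monomial assms) auto
qed

text \<open>A left factor mixes only the row indices, so \<open>J\<close> stays fixed. The product
  measure admits a separate left factor in each coordinate, as the definition of invariance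
  requires.\<close>

lemma moment_invariant:
  assumes J: "J \<in> P \<rightarrow>\<^sub>E {..<n}"
  shows "invariant_tensor P lab n (\<lambda>I. moment I J)"
  unfolding invariant_tensor_def
proof (intro allI impI ballI)
  fix h :: "nat \<Rightarrow> nat \<Rightarrow> nat \<Rightarrow> real" and I
  assume h: "\<forall>x. row_orthonormal n (h x)" and I: "I \<in> P \<rightarrow>\<^sub>E {..<n}"
  define H where "H x = mat n n (\<lambda>(i, k). h x i k)" for x
  have H: "H x \<in> carrier (orthogonal_group n)" for x
    unfolding H_def using h by (intro row_orthonormal_mat_orthogonal) simp
  let ?F = "\<lambda>g. \<lambda>x\<in>{..<r}. H x * g x"
  have Hm: "(\<lambda>A. H x * A) \<in> measurable \<mu> \<mu>" for x
    using measurable_left_mult_orthogonal_group[OF H, of x]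
    by (simp add: measurable_cong_sets[OF sets_\<mu> sets_\<mu>])
  have F: "?F \<in> measurable \<Omega> \<Omega>"
    using Hm by (intro measurable_restrict measurable_compose[OF measurable_component_singleton]) auto
  have "distr \<Omega> \<Omega> ?F = \<Omega>"
    by (rule distr_PiM_preserving) (use prob_space_\<mu> Hm distr_\<mu>[OF H] in auto)
  then have "moment I J = integral\<^sup>L (distr \<Omega> \<Omega> ?F) (monomial I J)" by simp
  also have "\<dots> = (\<integral>g. monomial I J (?F g) \<partial>\<Omega>)"
    by (rule integral_distr[OF F measurable_monomial[OF I J]])
  also have "\<dots> = (\<integral>g. (\<Sum>K\<in>P \<rightarrow>\<^sub>E {..<n}. (\<Prod>t\<in>P. h (lab t) (I t) (K t)) * monomial K J g) \<partial>\<Omega>)"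
  proof (rule Bochner_Integration.integral_cong[OF refl])
    fix g assume g: "g \<in> space \<Omega>"
    have "monomial I J (?F g) = (\<Prod>t\<in>P. \<Sum>k<n. h (lab t) (I t) k * g (lab t) $$ (k, J t))"
      unfolding monomial_def
    proof (rule prod.cong[OF refl])
      fix t assume t: "t \<in> P"
      have "g (lab t) \<in> carrier_mat n n"
        by (rule mem_orthogonal_groupD(1)[OF space_\<Omega>D[OF g lab[OF t]]])
      then show "?F g (lab t) $$ (I t, J t) = (\<Sum>k<n. h (lab t) (I t) k * g (lab t) $$ (k, J t))"
        using lab[OF t] PiE_mem[OF I t] PiE_mem[OF J t]
        by (auto simp: H_def scalar_prod_def atLeast0LessThan intro!: sum.cong)
    qed
    also have "\<dots> = (\<Sum>K\<in>P \<rightarrow>\<^sub>E {..<n}. \<Prod>t\<in>P. h (lab t) (I t) (K t) * g (lab t) $$ (K t, J t))"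
      by (rule prod_sum_PiE) (use finP in auto)
    finally show "monomial I J (?F g) =
        (\<Sum>K\<in>P \<rightarrow>\<^sub>E {..<n}. (\<Prod>t\<in>P. h (lab t) (I t) (K t)) * monomial K J g)"
      by (simp add: monomial_def prod.distrib)
  qed
  also have "\<dots> = (\<Sum>K\<in>P \<rightarrow>\<^sub>E {..<n}. \<integral>g. (\<Prod>t\<in>P. h (lab t) (I t) (K t)) * monomial K J g \<partial>\<Omega>)"
    by (rule Bochner_Integration.integral_sum)
       (auto intro!: integrable_monomial J)
  also have "\<dots> = (\<Sum>K\<in>P \<rightarrow>\<^sub>E {..<n}. (\<Prod>t\<in>P. h (lab t) (I t) (K t)) * moment K J)"
    by (rule sum.cong) auto
  finally show "moment I J = (\<Sum>K\<in>P \<rightarrow>\<^sub>E {..<n}. (\<Prod>t\<in>P. h (lab t) (I t) (K t)) * moment K J)" .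
qed

text \<open>The sum is already constant before integration: contracting paired row indices leaves
  inner products of columns of orthogonal matrices.\<close>

lemma sum_moments_compatible:
  assumes J: "J \<in> P \<rightarrow>\<^sub>E {..<n}" and q: "q \<in> pairings P lab"
  shows "(\<Sum>I\<in>P \<rightarrow>\<^sub>E {..<n}. of_bool (\<forall>t\<in>P. I (q t) = I t) * moment I J) = of_bool (\<forall>t\<in>P. J (q t) = J t)"
proof -
  interpret prob_space \<Omega> by (rule prob_space_\<Omega>)
  have "(\<Sum>I\<in>P \<rightarrow>\<^sub>E {..<n}. of_bool (\<forall>t\<in>P. I (q t) = I t) * moment I J) =
      (\<Sum>I\<in>P \<rightarrow>\<^sub>E {..<n}. \<integral>g. of_bool (\<forall>t\<in>P. I (q t) = I t) * monomial I J g \<partial>\<Omega>)"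
    by (rule sum.cong) auto
  also have "\<dots> = (\<integral>g. (\<Sum>I\<in>P \<rightarrow>\<^sub>E {..<n}. of_bool (\<forall>t\<in>P. I (q t) = I t) * monomial I J g) \<partial>\<Omega>)"
    by (rule Bochner_Integration.integral_sum[symmetric]) (auto intro!: integrable_monomial J)
  also have "\<dots> = (\<integral>g. of_bool (\<forall>t\<in>P. J (q t) = J t) \<partial>\<Omega>)"
  proof (rule Bochner_Integration.integral_cong[OF refl])
    fix g assume g: "g \<in> space \<Omega>"
    \<comment> \<open>The matrices are transposed, so that rows of \<open>h x\<close> are columns of
      \<open>g x\<close>. Labels from \<open>r\<close> on have no matrix in \<open>g\<close> and get
      the identity.\<close>
    define h :: "nat \<Rightarrow> nat \<Rightarrow> nat \<Rightarrow> real" where "h x i k = (if x < r then g x $$ (k, i) else of_bool (i = k))" for x i k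
    have "row_orthonormal n (h x)" for x
    proof (cases "x < r")
      case True
      then show ?thesis
        using sum_column_products_orthogonal_group[OF space_\<Omega>D[OF g True]]
        by (simp add: row_orthonormal_def h_def)
    next
      case False
      have "(\<Sum>k<n. of_bool (i = k) * of_bool (j = k) :: real) = of_bool (i = j)" if "i < n" for i j
      proof -
        have "(\<Sum>k<n. of_bool (i = k) * of_bool (j = k) :: real) = (\<Sum>k<n. if k = i then of_bool (i = j) else 0)"
          by (intro sum.cong) auto
        then show ?thesis using that by simp
      qed
      then show ?thesis using False by (simp add: row_orthonormal_def h_def)
    qed
    from sum_compatible_indices[OF finP q, where h = h, OF this J]
    show "(\<Sum>I\<in>P \<rightarrow>\<^sub>E {..<n}. of_bool (\<forall>t\<in>P. I (q t) = I t) * monomial I J g) = of_bool (\<forall>t\<in>P. J (q t) = J t)"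
      using lab by (simp add: monomial_def h_def mult.commute)
  qed
  also have "\<dots> = of_bool (\<forall>t\<in>P. J (q t) = J t)" by (simp add: prob_space)
  finally show ?thesis .
qed

text \<open>Contracting the expansion of the moments with every pairing gives a linear system with
  the Gram matrix, which \<open>V\<close> solves up to the factor \<open>D\<close>. Division is
  postponed until \<open>D\<close> is known to be nonzero.\<close>

lemma moment_formula:
  fixes D :: real and V :: "(nat \<Rightarrow> nat) \<Rightarrow> (nat \<Rightarrow> nat) \<Rightarrow> real"
  assumes V: "\<And>p s. p \<in> pairings P lab \<Longrightarrow> s \<in> pairings P lab \<Longrightarrow>
      (\<Sum>q\<in>pairings P lab. V p q * real (gram P n q s)) = (if p = s then D else 0)"
    and I: "I \<in> P \<rightarrow>\<^sub>E {..<n}" and J: "J \<in> P \<rightarrow>\<^sub>E {..<n}"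
  shows "D * moment I J = (\<Sum>p\<in>pairings P lab. \<Sum>q\<in>pairings P lab.
    V p q * (of_bool (\<forall>t\<in>P. I (p t) = I t) * of_bool (\<forall>t\<in>P. J (q t) = J t)))"
proof -
  let ?X = "pairings P lab"
  let ?\<delta> = "\<lambda>p I. of_bool (\<forall>t\<in>P. I (p t) = I t) :: real"
  have finX: "finite ?X" by (rule finite_pairings[OF finP])
  obtain a where a: "\<And>I. I \<in> P \<rightarrow>\<^sub>E {..<n} \<Longrightarrow> moment I J = (\<Sum>p\<in>?X. a p * ?\<delta> p I)"
    using invariant_tensor_in_span[OF finP moment_invariant[OF J] dim] by blast
  have G: "(\<Sum>s\<in>?X. real (gram P n q s) * a s) = ?\<delta> q J" if q: "q \<in> ?X" for q
  proof -
    have "(\<Sum>s\<in>?X. real (gram P n q s) * a s) =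
        (\<Sum>s\<in>?X. \<Sum>K\<in>P \<rightarrow>\<^sub>E {..<n}. ?\<delta> q K * (a s * ?\<delta> s K))"
      unfolding index_count_eq_sum[OF finP] sum_distrib_right by (simp only: mult_ac)
    also have "\<dots> = (\<Sum>K\<in>P \<rightarrow>\<^sub>E {..<n}. ?\<delta> q K * (\<Sum>s\<in>?X. a s * ?\<delta> s K))"
      by (subst sum.swap) (simp only: sum_distrib_left)
    also have "\<dots> = (\<Sum>K\<in>P \<rightarrow>\<^sub>E {..<n}. ?\<delta> q K * moment K J)"
      by (rule sum.cong) (simp_all only: a)
    also have "\<dots> = ?\<delta> q J" by (rule sum_moments_compatible[OF J q])
    finally show ?thesis .
  qed
  have Da: "D * a p = (\<Sum>q\<in>?X. V p q * ?\<delta> q J)" if p: "p \<in> ?X" for p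
  proof -
    have "D * a p = (\<Sum>s\<in>?X. (if p = s then D else 0) * a s)"
      using p finX by (simp add: if_distrib[of "\<lambda>x. x * _"] cong: if_cong)
    also have "\<dots> = (\<Sum>s\<in>?X. (\<Sum>q\<in>?X. V p q * real (gram P n q s)) * a s)"
      using V[OF p] by (intro sum.cong) auto
    also have "\<dots> = (\<Sum>q\<in>?X. V p q * (\<Sum>s\<in>?X. real (gram P n q s) * a s))"
      unfolding sum_distrib_right sum_distrib_left by (subst sum.swap) (simp add: mult.assoc)
    also have "\<dots> = (\<Sum>q\<in>?X. V p q * ?\<delta> q J)" by (intro sum.cong) (simp_all only: G)
    finally show ?thesis .
  qed
  have "D * moment I J = (\<Sum>p\<in>?X. (D * a p) * ?\<delta> p I)"
    unfolding a[OF I] by (simp add: sum_distrib_left mult.assoc)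
  also have "\<dots> = (\<Sum>p\<in>?X. (\<Sum>q\<in>?X. V p q * ?\<delta> q J) * ?\<delta> p I)"
    by (intro sum.cong) (simp_all only: Da)
  also have "\<dots> = (\<Sum>p\<in>?X. \<Sum>q\<in>?X. V p q * (?\<delta> p I * ?\<delta> q J))"
    unfolding sum_distrib_right by (simp only: mult_ac)
  finally show ?thesis .
qed

text \<open>Row and column indices are both read off one index \<open>i\<close>. Exchanging the sums
  leaves, for each two pairings, the number of \<open>i\<close> compatible with both.\<close>

lemma sum_moments_formula:
  fixes D :: real and V :: "(nat \<Rightarrow> nat) \<Rightarrow> (nat \<Rightarrow> nat) \<Rightarrow> real"
  assumes V: "\<And>p s. p \<in> pairings P lab \<Longrightarrow> s \<in> pairings P lab \<Longrightarrow>
      (\<Sum>q\<in>pairings P lab. V p q * real (gram P n q s)) = (if p = s then D else 0)"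
    and \<rho>: "\<rho> ` P \<subseteq> P" and \<kappa>: "\<kappa> ` P \<subseteq> P"
  shows "D * (\<integral>g. (\<Sum>i\<in>P \<rightarrow>\<^sub>E {..<n}. \<Prod>t\<in>P. g (lab t) $$ (i (\<rho> t), i (\<kappa> t))) \<partial>\<Omega>) =
    (\<Sum>p\<in>pairings P lab. \<Sum>q\<in>pairings P lab. V p q * real (index_count P \<rho> \<kappa> n p q))"
proof -
  let ?X = "pairings P lab"
  let ?R = "\<lambda>i. \<lambda>t\<in>P. i (\<rho> t)" and ?C = "\<lambda>i. \<lambda>t\<in>P. i (\<kappa> t)"
  have R: "?R i \<in> P \<rightarrow>\<^sub>E {..<n}" and C: "?C i \<in> P \<rightarrow>\<^sub>E {..<n}" if "i \<in> P \<rightarrow>\<^sub>E {..<n}" for i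
    using \<rho> \<kappa> PiE_mem[OF that] by (auto simp: restrict_PiE_iff)
  have mono: "(\<Prod>t\<in>P. g (lab t) $$ (i (\<rho> t), i (\<kappa> t))) = monomial (?R i) (?C i) g" for i g
    by (simp add: monomial_def)
  have "(\<integral>g. (\<Sum>i\<in>P \<rightarrow>\<^sub>E {..<n}. \<Prod>t\<in>P. g (lab t) $$ (i (\<rho> t), i (\<kappa> t))) \<partial>\<Omega>) =
      (\<Sum>i\<in>P \<rightarrow>\<^sub>E {..<n}. moment (?R i) (?C i))"
    unfolding mono by (rule Bochner_Integration.integral_sum) (intro integrable_monomial R C)
  then have "D * (\<integral>g. (\<Sum>i\<in>P \<rightarrow>\<^sub>E {..<n}. \<Prod>t\<in>P. g (lab t) $$ (i (\<rho> t), i (\<kappa> t))) \<partial>\<Omega>) =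
      (\<Sum>i\<in>P \<rightarrow>\<^sub>E {..<n}. D * moment (?R i) (?C i))"
    by (simp add: sum_distrib_left)
  also have "\<dots> = (\<Sum>i\<in>P \<rightarrow>\<^sub>E {..<n}. \<Sum>p\<in>?X. \<Sum>q\<in>?X. V p q *
      (of_bool (\<forall>t\<in>P. i (\<rho> (p t)) = i (\<rho> t)) * of_bool (\<forall>t\<in>P. i (\<kappa> (q t)) = i (\<kappa> t))))"
  proof (rule sum.cong[OF refl])
    fix i assume i: "i \<in> P \<rightarrow>\<^sub>E {..<n}"
    have eq: "(\<forall>t\<in>P. ?R i (p t) = ?R i t) \<longleftrightarrow> (\<forall>t\<in>P. i (\<rho> (p t)) = i (\<rho> t))"
      "(\<forall>t\<in>P. ?C i (p t) = ?C i t) \<longleftrightarrow> (\<forall>t\<in>P. i (\<kappa> (p t)) = i (\<kappa> t))" if "p \<in> ?X" for p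
      using pairingsD(1)[OF that] by auto
    have "D * moment (?R i) (?C i) = (\<Sum>p\<in>?X. \<Sum>q\<in>?X. V p q *
      (of_bool (\<forall>t\<in>P. ?R i (p t) = ?R i t) * of_bool (\<forall>t\<in>P. ?C i (q t) = ?C i t)))"
      by (rule moment_formula[OF V R[OF i] C[OF i]])
    also have "\<dots> = (\<Sum>p\<in>?X. \<Sum>q\<in>?X. V p q *
      (of_bool (\<forall>t\<in>P. i (\<rho> (p t)) = i (\<rho> t)) * of_bool (\<forall>t\<in>P. i (\<kappa> (q t)) = i (\<kappa> t))))"
      by (intro sum.cong refl) (simp only: eq)
    finally show "D * moment (?R i) (?C i) = (\<Sum>p\<in>?X. \<Sum>q\<in>?X. V p q *
      (of_bool (\<forall>t\<in>P. i (\<rho> (p t)) = i (\<rho> t)) * of_bool (\<forall>t\<in>P. i (\<kappa> (q t)) = i (\<kappa> t))))" .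
  qed
  also have "\<dots> = (\<Sum>p\<in>?X. \<Sum>q\<in>?X. \<Sum>i\<in>P \<rightarrow>\<^sub>E {..<n}. V p q *
      (of_bool (\<forall>t\<in>P. i (\<rho> (p t)) = i (\<rho> t)) * of_bool (\<forall>t\<in>P. i (\<kappa> (q t)) = i (\<kappa> t))))"
    by (subst sum.swap, rule sum.cong[OF refl], rule sum.swap)
  finally show ?thesis unfolding index_count_eq_sum[OF finP] by (simp only: sum_distrib_left)
qed

end

subsection \<open>Digit expansions\<close>

lemma digit_0: "digit b c 0 = c mod b"
  by (simp add: digit_def)

lemma digit_Suc: "digit b c (Suc t) = digit b (c div b) t"
  by (simp add: digit_def div_mult2_eq)

lemma digit_less: "0 < b \<Longrightarrow> digit b c t < b"
  by (simp add: digit_def)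

lemma digits_determine:
  "c < b ^ B \<Longrightarrow> d < b ^ B \<Longrightarrow> (\<And>t. t < B \<Longrightarrow> digit b c t = digit b d t) \<Longrightarrow> c = d"
proof (induction B arbitrary: c d)
  case (Suc B)
  have "c div b < b ^ B" "d div b < b ^ B"
    using Suc.prems(1,2) by (simp_all add: less_mult_imp_div_less mult.commute)
  moreover have "digit b (c div b) t = digit b (d div b) t" if "t < B" for t
    using Suc.prems(3)[of "Suc t"] that by (simp add: digit_Suc)
  ultimately have "c div b = d div b" by (rule Suc.IH)
  moreover have "c mod b = d mod b" using Suc.prems(3)[of 0] by (simp add: digit_0)
  ultimately show ?case by (metis div_mult_mod_eq)
qed simp

lemma digits_exist:
  "(\<And>t. t < B \<Longrightarrow> f t < b) \<Longrightarrow> \<exists>c<b ^ B. \<forall>t<B. digit b c t = f t"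
proof (induction B arbitrary: f)
  case (Suc B)
  from Suc.IH[of "\<lambda>t. f (Suc t)"] Suc.prems
  obtain c where c: "c < b ^ B" "\<And>t. t < B \<Longrightarrow> digit b c t = f (Suc t)" by auto
  have f0: "f 0 < b" using Suc.prems by simp
  have "digit b (f 0 + b * c) t = f t" if "t < Suc B" for t
    using that f0 c(2) by (cases t) (simp_all add: digit_0 digit_Suc)
  moreover have "f 0 + b * c < b ^ Suc B"
  proof -
    have "f 0 + b * c < b * (c + 1)" using f0 by simp
    also have "\<dots> \<le> b * b ^ B" using c(1) by (intro mult_left_mono) auto
    finally show ?thesis by simp
  qed
  ultimately show ?case by blast
qed simp

text \<open>Requiring the digit \<open>0\<close> outside \<open>P\<close> makes the code of a
  function on \<open>P\<close> unique, so that sums over codes count each function once.\<close>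

lemma bij_betw_digits:
  assumes "0 < b" "P \<subseteq> {..<B}"
  shows "bij_betw (\<lambda>c. restrict (digit b c) P)
    {c. c < b ^ B \<and> (\<forall>t<B. t \<notin> P \<longrightarrow> digit b c t = 0)} (P \<rightarrow>\<^sub>E {..<b})"
proof (rule bij_betwI')
  let ?C = "{c. c < b ^ B \<and> (\<forall>t<B. t \<notin> P \<longrightarrow> digit b c t = 0)}"
  fix c d assume cd: "c \<in> ?C" "d \<in> ?C"
  show "restrict (digit b c) P = restrict (digit b d) P \<longleftrightarrow> c = d"
  proof
    assume eq: "restrict (digit b c) P = restrict (digit b d) P"
    show "c = d"
    proof (rule digits_determine)
      fix t assume "t < B"
      then show "digit b c t = digit b d t"
        using cd fun_cong[OF eq, of t] by (cases "t \<in> P") auto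
    qed (use cd in auto)
  qed simp
next
  fix c show "restrict (digit b c) P \<in> P \<rightarrow>\<^sub>E {..<b}" using digit_less[OF assms(1)] by auto
next
  fix f assume f: "f \<in> P \<rightarrow>\<^sub>E {..<b}"
  have "\<exists>c<b ^ B. \<forall>t<B. digit b c t = (if t \<in> P then f t else 0)"
    by (rule digits_exist) (use f assms(1) in \<open>auto simp: PiE_iff\<close>)
  then obtain c where c: "c < b ^ B" "\<And>t. t < B \<Longrightarrow> digit b c t = (if t \<in> P then f t else 0)" by blast
  have "f = restrict (digit b c) P"
    by (rule extensionalityI[of _ P]) (use f c(2) assms(2) in \<open>auto simp: PiE_iff subset_iff\<close>)
  then show "\<exists>c\<in>{c. c < b ^ B \<and> (\<forall>t<B. t \<notin> P \<longrightarrow> digit b c t = 0)}. f = restrict (digit b c) P"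
    using c by (intro bexI[of _ c]) auto
qed

subsection \<open>Coded words\<close>

text \<open>A nonzero remaining code means that a letter is left. Every number decodes to a list of
  lists, so positions make sense for every \<open>x\<close>.\<close>

definition is_position :: "nat \<Rightarrow> nat \<Rightarrow> bool" where
  "is_position x t \<longleftrightarrow> drop_code (nth_code x (pfst t)) (psnd t) \<noteq> 0"

definition code_letter :: "nat \<Rightarrow> nat \<Rightarrow> nat" where
  "code_letter x t = nth_code (nth_code x (pfst t)) (psnd t)"

definition code_label :: "nat \<Rightarrow> nat \<Rightarrow> nat" where
  "code_label x t = pfst (code_letter x t)"

definition code_next :: "nat \<Rightarrow> nat \<Rightarrow> nat" where
  "code_next x t = pair (pfst t)
    (if drop_code (nth_code x (pfst t)) (Suc (psnd t)) \<noteq> 0 then Suc (psnd t) else 0)"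

text \<open>The flag \<open>m = 0\<close> selects the identity, so that Gram matrix entries (\<open>m = 0\<close>) and the numbers
  of indices contributing to the trace integral (\<open>m = 1\<close>) are counted by one function.\<close>

definition code_row :: "nat \<Rightarrow> nat \<Rightarrow> nat \<Rightarrow> nat" where
  "code_row m x t = (if m = 0 \<or> psnd (code_letter x t) \<noteq> 0 then t else code_next x t)"

text \<open>An inverse letter, marked by second component \<open>0\<close>, contributes a transposed
  matrix: its column index sits at its own position and its row index at the next one.\<close>

definition code_col :: "nat \<Rightarrow> nat \<Rightarrow> nat \<Rightarrow> nat" where
  "code_col m x t = (if m = 0 \<or> psnd (code_letter x t) = 0 then t else code_next x t)"

text \<open>Word number and place are both at most \<open>x\<close>, and \<open>pair\<close> is
  monotone.\<close>

definition position_bound :: "nat \<Rightarrow> nat" where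
  "position_bound x = Suc (pair x x)"

definition code_pairing :: "nat \<Rightarrow> nat \<Rightarrow> bool" where
  "code_pairing x p \<longleftrightarrow> (\<forall>t<position_bound x.
    if is_position x t
    then is_position x (digit (position_bound x) p t) \<and> digit (position_bound x) p t \<noteq> t
      \<and> digit (position_bound x) p (digit (position_bound x) p t) = t
      \<and> code_label x (digit (position_bound x) p t) = code_label x t
    else digit (position_bound x) p t = 0)"

text \<open>Two bases occur: pairings have positions as digits, whereas the index \<open>i\<close>
  is written in base \<open>n\<close> and has matrix indices as digits.\<close>

definition code_compatible :: "nat \<Rightarrow> nat \<Rightarrow> nat \<Rightarrow> nat \<Rightarrow> nat \<Rightarrow> nat \<Rightarrow> bool" where
  "code_compatible m x n p q i \<longleftrightarrow> (\<forall>t<position_bound x.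
    if is_position x t
    then digit n i (code_row m x (digit (position_bound x) p t)) = digit n i (code_row m x t)
      \<and> digit n i (code_col m x (digit (position_bound x) q t)) = digit n i (code_col m x t)
    else digit n i t = 0)"

definition code_count :: "nat \<Rightarrow> nat \<Rightarrow> nat \<Rightarrow> nat \<Rightarrow> nat \<Rightarrow> nat" where
  "code_count m x n p q = (\<Sum>i<n ^ position_bound x. of_bool (code_compatible m x n p q i))"

lemma decidable_is_position [rec_intros]:
  "total_recursive f \<Longrightarrow> total_recursive g \<Longrightarrow> decidable (\<lambda>x. is_position (f x) (g x))"
  unfolding is_position_def by (intro rec_intros)

lemma total_recursive_code_letter [rec_intros]:
  "total_recursive f \<Longrightarrow> total_recursive g \<Longrightarrow> total_recursive (\<lambda>x. code_letter (f x) (g x))"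
  unfolding code_letter_def by (intro rec_intros)

lemma total_recursive_code_label [rec_intros]:
  "total_recursive f \<Longrightarrow> total_recursive g \<Longrightarrow> total_recursive (\<lambda>x. code_label (f x) (g x))"
  unfolding code_label_def by (intro rec_intros)

lemma total_recursive_code_next [rec_intros]:
  "total_recursive f \<Longrightarrow> total_recursive g \<Longrightarrow> total_recursive (\<lambda>x. code_next (f x) (g x))"
  unfolding code_next_def by (intro rec_intros)

lemma total_recursive_code_row [rec_intros]:
  "total_recursive m \<Longrightarrow> total_recursive f \<Longrightarrow> total_recursive g \<Longrightarrow>
    total_recursive (\<lambda>x. code_row (m x) (f x) (g x))"
  unfolding code_row_def by (intro rec_intros)

lemma total_recursive_code_col [rec_intros]:
  "total_recursive m \<Longrightarrow> total_recursive f \<Longrightarrow> total_recursive g \<Longrightarrow>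
    total_recursive (\<lambda>x. code_col (m x) (f x) (g x))"
  unfolding code_col_def by (intro rec_intros)

lemma total_recursive_position_bound [rec_intros]:
  "total_recursive f \<Longrightarrow> total_recursive (\<lambda>x. position_bound (f x))"
  unfolding position_bound_def by (intro rec_intros)

lemma decidable_code_pairing [rec_intros]:
  assumes "total_recursive f" "total_recursive g"
  shows "decidable (\<lambda>x. code_pairing (f x) (g x))"
  unfolding code_pairing_def by (intro rec_intros assms assms[THEN total_recursive_comp])

lemma decidable_code_compatible [rec_intros]:
  assumes "total_recursive m" "total_recursive f" "total_recursive n" "total_recursive p"
    "total_recursive q" "total_recursive i"
  shows "decidable (\<lambda>x. code_compatible (m x) (f x) (n x) (p x) (q x) (i x))"
  unfolding code_compatible_def by (intro rec_intros assms assms[THEN total_recursive_comp])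

lemma total_recursive_code_count [rec_intros]:
  assumes "total_recursive m" "total_recursive f" "total_recursive n" "total_recursive p" "total_recursive q"
  shows "total_recursive (\<lambda>x. code_count (m x) (f x) (n x) (p x) (q x))"
  unfolding code_count_def by (intro rec_intros assms assms[THEN total_recursive_comp])

section \<open>Codes of positions, pairings and indices against the sets that they represent\<close>

definition code_positions :: "nat \<Rightarrow> nat set" where
  "code_positions x = {t. is_position x t}"

lemma pair_mono: "a \<le> c \<Longrightarrow> b \<le> d \<Longrightarrow> pair a b \<le> pair c d"
proof -
  have mono: "triangle a \<le> triangle b" if "a \<le> b" for a b
    using that by (induction rule: dec_induct) auto
  show "a \<le> c \<Longrightarrow> b \<le> d \<Longrightarrow> pair a b \<le> pair c d"
    using mono[of "a + b" "c + d"] by (simp add: prod_encode_def)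
qed

lemma is_position_iff:
  "is_position x t \<longleftrightarrow> pfst t < length (list_decode x) \<and>
    psnd t < length (list_decode (list_decode x ! pfst t))"
  unfolding is_position_def drop_code_neq_0_iff nth_code_eq by auto

lemma is_position_less: "is_position x t \<Longrightarrow> t < position_bound x"
proof -
  assume "is_position x t"
  then have "pfst t < length (list_decode x)" "psnd t < length (list_decode (nth_code x (pfst t)))"
    by (auto simp: is_position_iff nth_code_eq)
  then have "pfst t \<le> x" "psnd t \<le> x"
    using length_list_decode_le[of x] length_list_decode_le[of "nth_code x (pfst t)"] nth_code_le[of x "pfst t"]
    by linarith+
  then have "pair (pfst t) (psnd t) \<le> pair x x" by (rule pair_mono)
  then show ?thesis by (simp add: position_bound_def)
qed

lemma code_positions_subset: "code_positions x \<subseteq> {..<position_bound x}"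
  using is_position_less by (auto simp: code_positions_def)

lemma finite_code_positions: "finite (code_positions x)"
  by (rule finite_subset[OF code_positions_subset]) simp

lemma card_code_positions: "card (code_positions x) \<le> position_bound x"
  using card_mono[OF _ code_positions_subset] by simp

lemma code_next_position: "t \<in> code_positions x \<Longrightarrow> code_next x t \<in> code_positions x"
  by (auto simp: code_positions_def is_position_iff code_next_def drop_code_eq_0_iff nth_code_eq)

lemma code_row_positions: "code_row m x ` code_positions x \<subseteq> code_positions x"
  and code_col_positions: "code_col m x ` code_positions x \<subseteq> code_positions x"
  using code_next_position by (auto simp: code_row_def code_col_def)

definition pairing_codes :: "nat \<Rightarrow> nat set" where
  "pairing_codes x = {p. p < position_bound x ^ position_bound x \<and> code_pairing x p}"

definition decode_pairing :: "nat \<Rightarrow> nat \<Rightarrow> nat \<Rightarrow> nat" where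
  "decode_pairing x p = restrict (digit (position_bound x) p) (code_positions x)"

lemma bij_betw_decode_pairing:
  "bij_betw (decode_pairing x) (pairing_codes x) (pairings (code_positions x) (code_label x))"
proof -
  let ?B = "position_bound x" and ?P = "code_positions x"
  let ?C = "{c. c < ?B ^ ?B \<and> (\<forall>t<?B. t \<notin> ?P \<longrightarrow> digit ?B c t = 0)}"
  have bij: "bij_betw (decode_pairing x) ?C (?P \<rightarrow>\<^sub>E {..<?B})"
    unfolding decode_pairing_def
    by (rule bij_betw_digits[OF _ code_positions_subset]) (simp add: position_bound_def)
  have eq: "decode_pairing x p \<in> pairings ?P (code_label x) \<longleftrightarrow> p \<in> pairing_codes x" if p: "p \<in> ?C" for p
  proof -
    have "decode_pairing x p \<in> pairings ?P (code_label x) \<longleftrightarrow>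
      (\<forall>t\<in>?P. digit ?B p t \<in> ?P \<and> digit ?B p t \<noteq> t \<and> digit ?B p (digit ?B p t) = t
        \<and> code_label x (digit ?B p t) = code_label x t)"
      unfolding pairings_def decode_pairing_def by (auto simp: restrict_PiE_iff)
    also have "\<dots> \<longleftrightarrow> code_pairing x p"
      using p is_position_less unfolding code_pairing_def code_positions_def by auto
    finally show ?thesis using p by (auto simp: pairing_codes_def)
  qed
  have sub: "pairings ?P (code_label x) \<subseteq> ?P \<rightarrow>\<^sub>E {..<?B}"
    using PiE_mono[of ?P "\<lambda>_. ?P" "\<lambda>_. {..<?B}"] code_positions_subset[of x] unfolding pairings_def by blast
  have sub': "pairing_codes x \<subseteq> ?C"
    by (auto simp: pairing_codes_def code_pairing_def code_positions_def)
  have "decode_pairing x ` pairing_codes x = pairings ?P (code_label x)"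
  proof (intro equalityI subsetI)
    fix p assume p: "p \<in> pairings ?P (code_label x)"
    then have "p \<in> decode_pairing x ` ?C" unfolding bij_betw_imp_surj_on[OF bij] using sub by blast
    then obtain c where "c \<in> ?C" "p = decode_pairing x c" by blast
    then show "p \<in> decode_pairing x ` pairing_codes x" using eq p by auto
  qed (use sub' eq in auto)
  then show ?thesis using bij_betw_subset[OF bij sub'] by simp
qed

text \<open>Reading digits in base \<open>n\<close> matches codes with indices. The base must be
  positive, which is why counts are later evaluated at successors.\<close>

lemma code_count_eq:
  assumes n: "0 < n" and p: "p \<in> pairing_codes x" and q: "q \<in> pairing_codes x"
  shows "code_count m x n p q = index_count (code_positions x) (code_row m x) (code_col m x) n
    (decode_pairing x p) (decode_pairing x q)"
proof -
  let ?B = "position_bound x" and ?P = "code_positions x"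
  let ?C = "{c. c < n ^ ?B \<and> (\<forall>t<?B. t \<notin> ?P \<longrightarrow> digit n c t = 0)}"
  let ?r = "\<lambda>c. restrict (digit n c) ?P"
  have bij: "bij_betw ?r ?C (?P \<rightarrow>\<^sub>E {..<n})"
    by (rule bij_betw_digits[OF n code_positions_subset])
  let ?S = "{i. i < n ^ ?B \<and> code_compatible m x n p q i}"
  let ?T = "{i \<in> ?P \<rightarrow>\<^sub>E {..<n}. \<forall>t\<in>?P.
      i (code_row m x (decode_pairing x p t)) = i (code_row m x t) \<and>
      i (code_col m x (decode_pairing x q t)) = i (code_col m x t)}"
  have mem: "decode_pairing x p t \<in> ?P" "decode_pairing x p t = digit ?B p t"
    if "t \<in> ?P" "p \<in> pairing_codes x" for t p
    using that pairingsD(1)[of "decode_pairing x p" ?P "code_label x" t] bij_betw_decode_pairing[of x]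
    by (auto simp: bij_betw_def decode_pairing_def)
  have row: "code_row m x t \<in> ?P" "code_col m x t \<in> ?P" if "t \<in> ?P" for t
    using that code_row_positions[of m x] code_col_positions[of m x] by auto
  have compat: "code_compatible m x n p q c \<longleftrightarrow> ?r c \<in> ?T" if c: "c \<in> ?C" for c
  proof -
    have "?r c \<in> ?T \<longleftrightarrow> (\<forall>t\<in>?P.
        digit n c (code_row m x (digit ?B p t)) = digit n c (code_row m x t) \<and>
        digit n c (code_col m x (digit ?B q t)) = digit n c (code_col m x t))"
      using mem p q row digit_less[OF n] by (simp add: restrict_PiE_iff)
    also have "\<dots> \<longleftrightarrow> code_compatible m x n p q c"
      using c is_position_less unfolding code_compatible_def code_positions_def by auto
    finally show ?thesis by simp
  qed
  have sub: "?S \<subseteq> ?C" by (auto simp: code_compatible_def code_positions_def)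
  have "?r ` ?S = ?T"
  proof (intro equalityI subsetI)
    fix i assume i: "i \<in> ?T"
    then have "i \<in> ?P \<rightarrow>\<^sub>E {..<n}" by simp
    then have "i \<in> ?r ` ?C" unfolding bij_betw_imp_surj_on[OF bij] .
    then obtain c where "c \<in> ?C" "i = ?r c" by blast
    then show "i \<in> ?r ` ?S" using compat i by blast
  next
    fix i assume "i \<in> ?r ` ?S"
    then obtain c where "c \<in> ?S" "i = ?r c" by blast
    then show "i \<in> ?T" using compat[of c] sub by blast
  qed
  then have "bij_betw ?r ?S ?T" using bij_betw_subset[OF bij sub] by simp
  then have "card ?S = card ?T" by (rule bij_betw_same_card)
  moreover have "code_count m x n p q = card ?S"
    unfolding code_count_def by (subst sum_of_bool_eq) (auto intro: arg_cong[where f = card])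
  ultimately show ?thesis by (simp add: index_count_def)
qed

subsection \<open>Coded polynomials\<close>

definition code_poly :: "nat \<Rightarrow> int poly" where
  "code_poly c = (\<Sum>k<c. monom (int_decode (nth_code c k)) k)"

lemma poly_code_poly: "poly (code_poly c) (int n) = poly_code c n"
  by (simp add: code_poly_def poly_code_def poly_sum poly_monom)

lemma degree_code_poly: "degree (code_poly c) \<le> c"
  unfolding code_poly_def by (rule degree_sum_le) (auto intro: order.trans[OF degree_monom_le])

lemma int_decode_0 [simp]: "int_decode 0 = 0"
  by (simp add: int_decode_def sum_decode_def)

lemma coeff_code_poly: "coeff (code_poly c) k = int_decode (nth_code c k)"
proof -
  have "nth_code c k = 0" if "c \<le> k"
    using that length_list_decode_le[of c] by (simp add: nth_code_eq)
  then show ?thesis by (cases "k < c") (simp_all add: code_poly_def coeff_sum)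
qed

definition encode_poly :: "int poly \<Rightarrow> nat" where
  "encode_poly f = list_encode (map int_encode (coeffs f))"

lemma code_poly_encode_poly [simp]: "code_poly (encode_poly f) = f"
proof (rule poly_eqI)
  fix k
  show "coeff (code_poly (encode_poly f)) k = coeff f k"
    using fun_cong[OF nth_default_coeffs_eq[of f], of k]
    by (auto simp: coeff_code_poly encode_poly_def nth_code_list_encode nth_default_def split: if_splits)
qed

lemma poly_code_encode_poly [simp]: "poly_code (encode_poly f) n = poly f (int n)"
  by (simp flip: poly_code_poly)

lemma decode_int_poly_eq: "decode_int_poly c = map_poly of_int (code_poly c)"
  by (rule poly_eqI)
     (auto simp: decode_int_poly_def coeff_map_poly coeff_code_poly nth_code_eq nth_default_def)

lemma poly_map_of_int: "poly (map_poly of_int f) (of_nat n :: rat) = of_int (poly f (int n))"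
  by (induction f) (simp_all add: map_poly_pCons)

text \<open>The \<open>m + 1\<close> sample points start at \<open>1\<close>, where coded counts are
  available.\<close>

lemma poly_eqI_consecutive:
  fixes f g :: "int poly"
  assumes "degree f \<le> m" "degree g \<le> m"
    and "\<And>n. n < Suc m \<Longrightarrow> poly f (int (Suc n)) = poly g (int (Suc n))"
  shows "f = g"
proof (rule poly_eqI_degree)
  have "card ((\<lambda>n. int (Suc n)) ` {..<Suc m}) = Suc m"
    by (subst card_image) (auto simp: inj_on_def)
  then show "card ((\<lambda>n. int (Suc n)) ` {..<Suc m}) > degree f" "card ((\<lambda>n. int (Suc n)) ` {..<Suc m}) > degree g"
    using assms(1,2) by linarith+
qed (use assms(3) in auto)

subsection \<open>Index counts as polynomials in the dimension\<close>

text \<open>The exponent counts components of a constraint graph and does not depend on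
  \<open>n\<close>; \<open>index_count_eq_power\<close> supplies its existence, so it is taken by
  choice.\<close>

definition index_poly :: "nat set \<Rightarrow> (nat \<Rightarrow> nat) \<Rightarrow> (nat \<Rightarrow> nat) \<Rightarrow> (nat \<Rightarrow> nat) \<Rightarrow> (nat \<Rightarrow> nat) \<Rightarrow> int poly" where
  "index_poly P \<rho> \<kappa> p q = monom 1 (SOME k. k \<le> card P \<and> (\<forall>n. index_count P \<rho> \<kappa> n p q = n ^ k))"

lemma
  assumes "finite P" "\<rho> ` P \<subseteq> P" "\<kappa> ` P \<subseteq> P" "p \<in> pairings P lab" "q \<in> pairings P lab"
  shows poly_index_poly: "poly (index_poly P \<rho> \<kappa> p q) (int n) = int (index_count P \<rho> \<kappa> n p q)"
    and degree_index_poly: "degree (index_poly P \<rho> \<kappa> p q) \<le> card P"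
proof -
  define k where "k = (SOME k. k \<le> card P \<and> (\<forall>n. index_count P \<rho> \<kappa> n p q = n ^ k))"
  have "k \<le> card P \<and> (\<forall>n. index_count P \<rho> \<kappa> n p q = n ^ k)"
    unfolding k_def by (rule someI_ex) (use index_count_eq_power[OF assms] in blast)
  moreover have "index_poly P \<rho> \<kappa> p q = monom 1 k" by (simp only: index_poly_def k_def)
  ultimately show "poly (index_poly P \<rho> \<kappa> p q) (int n) = int (index_count P \<rho> \<kappa> n p q)"
    "degree (index_poly P \<rho> \<kappa> p q) \<le> card P"
    by (simp_all add: poly_monom degree_monom_eq)
qed

text \<open>\<open>D\<close> is the determinant of the Gram matrix as a polynomial. A zero at an
  admissible dimension would give a kernel vector, against
  \<open>gram_nondegenerate\<close>.\<close>

lemma gram_inverse_exists: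
  assumes fin: "finite P"
  obtains D V where
    "\<And>p s. p \<in> pairings P lab \<Longrightarrow> s \<in> pairings P lab \<Longrightarrow>
      (\<Sum>q\<in>pairings P lab. V p q * index_poly P (\<lambda>t. t) (\<lambda>t. t) q s) = (if p = s then D else 0)"
    "\<And>p s. p \<in> pairings P lab \<Longrightarrow> s \<in> pairings P lab \<Longrightarrow>
      (\<Sum>q\<in>pairings P lab. index_poly P (\<lambda>t. t) (\<lambda>t. t) p q * V q s) = (if p = s then D else 0)"
    "\<And>n. \<forall>x. card {t \<in> P. lab t = x} \<le> 2 * n \<Longrightarrow> poly D (int n) \<noteq> 0"
proof -
  let ?X = "pairings P lab" and ?M = "index_poly P (\<lambda>t. t) (\<lambda>t. t)"
  obtain D V where DV:
    "\<And>p s. p \<in> ?X \<Longrightarrow> s \<in> ?X \<Longrightarrow> (\<Sum>q\<in>?X. V p q * ?M q s) = (if p = s then D else 0)"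
    "\<And>p s. p \<in> ?X \<Longrightarrow> s \<in> ?X \<Longrightarrow> (\<Sum>q\<in>?X. ?M p q * V q s) = (if p = s then D else 0)"
    "\<And>n. poly D n = 0 \<Longrightarrow>
      \<exists>v. (\<exists>p\<in>?X. v p \<noteq> 0) \<and> (\<forall>p\<in>?X. (\<Sum>q\<in>?X. poly (?M p q) n * v q) = 0)"
    by (rule adjugate_finite_index[OF finite_pairings[OF fin, of lab], of ?M]) (rule that)
  have D: "poly D (int n) \<noteq> 0" if n: "\<forall>x. card {t \<in> P. lab t = x} \<le> 2 * n" for n
  proof
    assume "poly D (int n) = 0"
    from DV(3)[OF this] obtain v where
      v0: "(\<exists>p\<in>?X. v p \<noteq> 0) \<and> (\<forall>p\<in>?X. (\<Sum>q\<in>?X. poly (?M p q) (int n) * v q) = 0)" ..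
    from v0 obtain p where v: "p \<in> ?X" "v p \<noteq> 0" by blast
    have "(\<Sum>q\<in>?X. int (gram P n p q) * v q) = 0" if p: "p \<in> ?X" for p
    proof -
      have "(\<Sum>q\<in>?X. int (gram P n p q) * v q) = (\<Sum>q\<in>?X. poly (?M p q) (int n) * v q)"
      proof (rule sum.cong[OF refl])
        fix q assume "q \<in> ?X"
        from poly_index_poly[OF fin _ _ p this, of "\<lambda>t. t" "\<lambda>t. t" n]
        show "int (gram P n p q) * v q = poly (?M p q) (int n) * v q" by simp
      qed
      then show ?thesis using v0 p by simp
    qed
    from gram_nondegenerate[OF fin spec[OF n], of v, OF this v(1)] v(2) show False by simp
  qed
  show thesis by (rule that[where D = D and V = V, OF DV(1,2) D])
qed

subsection \<open>Certificates\<close>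

text \<open>A certificate lists a denominator \<open>D\<close>, a numerator \<open>A\<close> and a matrix \<open>V\<close> of polynomials with
  \<open>V G = D\<close> for the Gram matrix \<open>G\<close> of the pairings. The code \<open>c\<close> bounds the degrees of its entries,
  so that it suffices to test the polynomial identities at finitely many points.\<close>

definition code_matrix :: "nat \<Rightarrow> nat \<Rightarrow> nat \<Rightarrow> nat" where
  "code_matrix c p q = nth_code (nth_code c 2) (pair p q)"

text \<open>The number of test points also allows for the degree of the index polynomials, at most
  \<open>position_bound x\<close>. The first clause makes \<open>D\<close> nonzero as a polynomial
  only; it says nothing about its value at a given dimension.\<close>

definition certifies :: "nat \<Rightarrow> nat \<Rightarrow> bool" where
  "certifies x c \<longleftrightarrow>
    (\<exists>n<Suc (c + position_bound x). poly_code (nth_code c 0) (Suc n) \<noteq> 0) \<and>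
    (\<forall>n<Suc (c + position_bound x). \<forall>p<position_bound x ^ position_bound x. code_pairing x p \<longrightarrow>
      (\<forall>s<position_bound x ^ position_bound x. code_pairing x s \<longrightarrow>
        (\<Sum>q<position_bound x ^ position_bound x. of_bool (code_pairing x q) *
          (poly_code (code_matrix c p q) (Suc n) * int (code_count 0 x (Suc n) q s))) =
        of_bool (p = s) * poly_code (nth_code c 0) (Suc n))) \<and>
    (\<forall>n<Suc (c + position_bound x). poly_code (nth_code c 1) (Suc n) =
      (\<Sum>p<position_bound x ^ position_bound x. of_bool (code_pairing x p) *
        (\<Sum>q<position_bound x ^ position_bound x. of_bool (code_pairing x q) *
          (poly_code (code_matrix c p q) (Suc n) * int (code_count 1 x (Suc n) p q)))))"

lemma decidable_certifies:
  "decidable (\<lambda>z. certifies (pfst z) (psnd z))"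
  unfolding certifies_def code_matrix_def by (intro rec_intros)

lemma sum_pairing_codes:
  fixes F :: "nat \<Rightarrow> int"
  shows "(\<Sum>q<position_bound x ^ position_bound x. of_bool (code_pairing x q) * F q) =
    (\<Sum>q\<in>pairing_codes x. F q)"
  by (rule sum.mono_neutral_cong_right) (auto simp: pairing_codes_def)

lemma certifies_iff:
  "certifies x c \<longleftrightarrow>
    (\<exists>n<Suc (c + position_bound x). poly_code (nth_code c 0) (Suc n) \<noteq> 0) \<and>
    (\<forall>n<Suc (c + position_bound x). \<forall>p\<in>pairing_codes x. \<forall>s\<in>pairing_codes x.
        (\<Sum>q\<in>pairing_codes x. poly_code (code_matrix c p q) (Suc n) * int (code_count 0 x (Suc n) q s)) =
        of_bool (p = s) * poly_code (nth_code c 0) (Suc n)) \<and>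
    (\<forall>n<Suc (c + position_bound x). poly_code (nth_code c 1) (Suc n) =
      (\<Sum>p\<in>pairing_codes x. \<Sum>q\<in>pairing_codes x.
          poly_code (code_matrix c p q) (Suc n) * int (code_count 1 x (Suc n) p q)))"
  unfolding certifies_def sum_pairing_codes by (auto simp: pairing_codes_def)

lemma decode_pairing_mem:
  "p \<in> pairing_codes x \<Longrightarrow> decode_pairing x p \<in> pairings (code_positions x) (code_label x)"
  using bij_betw_decode_pairing[of x] by (auto simp: bij_betw_def)

lemma code_row_0: "code_row 0 x = (\<lambda>t. t)" and code_col_0: "code_col 0 x = (\<lambda>t. t)"
  by (auto simp: code_row_def code_col_def)

lemma int_code_count:
  assumes "p \<in> pairing_codes x" "q \<in> pairing_codes x"
  shows "int (code_count m x (Suc n) p q) =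
    poly (index_poly (code_positions x) (code_row m x) (code_col m x) (decode_pairing x p) (decode_pairing x q))
      (int (Suc n))"
  using poly_index_poly[OF finite_code_positions code_row_positions code_col_positions
      assms[THEN decode_pairing_mem]] code_count_eq[OF _ assms, of "Suc n"]
  by (simp del: of_nat_Suc)

lemma degree_code_matrix_mult_index_poly:
  assumes "p \<in> pairing_codes x" "q \<in> pairing_codes x"
  shows "degree (code_poly (code_matrix c u v) * index_poly (code_positions x) (code_row m x) (code_col m x)
    (decode_pairing x p) (decode_pairing x q)) \<le> c + position_bound x"
proof (rule order.trans[OF degree_mult_le add_mono])
  have "degree (code_poly (code_matrix c u v)) \<le> code_matrix c u v" by (rule degree_code_poly)
  also have "\<dots> \<le> nth_code c 2" unfolding code_matrix_def by (rule nth_code_le)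
  also have "\<dots> \<le> c" by (rule nth_code_le)
  finally show "degree (code_poly (code_matrix c u v)) \<le> c" .
  show "degree (index_poly (code_positions x) (code_row m x) (code_col m x)
      (decode_pairing x p) (decode_pairing x q)) \<le> position_bound x"
    using degree_index_poly[OF finite_code_positions code_row_positions code_col_positions
      assms[THEN decode_pairing_mem]] card_code_positions[of x] by (rule order.trans)
qed

lemma finite_pairing_codes: "finite (pairing_codes x)"
  by (simp add: pairing_codes_def)

lemma degree_code_poly_nth_code: "degree (code_poly (nth_code c k)) \<le> c + b"
  using degree_code_poly[of "nth_code c k"] nth_code_le[of c k] by linarith

text \<open>The degree bounds turn agreement at the test points into equality of polynomials, and
  the inverse \<open>e\<close> of decoding carries the matrix from codes to pairings.\<close>

lemma certifies_sound:
  assumes "certifies x c"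
  obtains V where "code_poly (nth_code c 0) \<noteq> 0"
    "\<And>p s. p \<in> pairings (code_positions x) (code_label x) \<Longrightarrow> s \<in> pairings (code_positions x) (code_label x) \<Longrightarrow>
      (\<Sum>q\<in>pairings (code_positions x) (code_label x). V p q * index_poly (code_positions x) (\<lambda>t. t) (\<lambda>t. t) q s) =
        (if p = s then code_poly (nth_code c 0) else 0)"
    "code_poly (nth_code c 1) = (\<Sum>p\<in>pairings (code_positions x) (code_label x).
      \<Sum>q\<in>pairings (code_positions x) (code_label x).
        V p q * index_poly (code_positions x) (code_row 1 x) (code_col 1 x) p q)"
proof -
  let ?P = "code_positions x" and ?C = "pairing_codes x" and ?d = "decode_pairing x"
  let ?X = "pairings ?P (code_label x)"
  let ?I = "\<lambda>m. index_poly ?P (code_row m x) (code_col m x)"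
  let ?M = "\<lambda>p q. code_poly (code_matrix c p q)"
  define e where "e = inv_into ?C ?d"
  note bij = bij_betw_decode_pairing[of x]
  have e: "e p \<in> ?C" "?d (e p) = p" if "p \<in> ?X" for p
    using that bij_betw_inv_into_right[OF bij] bij_betw_imp_surj_on[OF bij_betw_inv_into[OF bij]]
    by (auto simp: e_def)
  have ed: "e (?d p) = p" if "p \<in> ?C" for p
    unfolding e_def by (rule bij_betw_inv_into_left[OF bij that])
  have reindex: "(\<Sum>p\<in>?X. F p) = (\<Sum>p\<in>?C. F (?d p))" for F :: "(nat \<Rightarrow> nat) \<Rightarrow> int poly"
    by (rule sum.reindex_bij_betw[OF bij, symmetric])
  note cert = assms[unfolded certifies_iff]
  have 0: "code_poly (nth_code c 0) \<noteq> 0" using cert by (auto simp flip: poly_code_poly)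
  have 1: "(\<Sum>q\<in>?C. ?M p q * ?I 0 (?d q) (?d s)) = (if p = s then code_poly (nth_code c 0) else 0)"
    if ps: "p \<in> ?C" "s \<in> ?C" for p s
  proof (rule poly_eqI_consecutive)
    show "degree (\<Sum>q\<in>?C. ?M p q * ?I 0 (?d q) (?d s)) \<le> c + position_bound x"
      by (intro degree_sum_le finite_pairing_codes degree_code_matrix_mult_index_poly ps)
    show "degree (if p = s then code_poly (nth_code c 0) else 0) \<le> c + position_bound x"
      using degree_code_poly_nth_code by simp
    fix n assume n: "n < Suc (c + position_bound x)"
    have "poly (\<Sum>q\<in>?C. ?M p q * ?I 0 (?d q) (?d s)) (int (Suc n)) =
        (\<Sum>q\<in>?C. poly_code (code_matrix c p q) (Suc n) * int (code_count 0 x (Suc n) q s))"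
      unfolding poly_sum poly_mult by (intro sum.cong refl) (simp only: poly_code_poly int_code_count ps(2))
    also have "\<dots> = of_bool (p = s) * poly_code (nth_code c 0) (Suc n)" using cert n ps by blast
    finally show "poly (\<Sum>q\<in>?C. ?M p q * ?I 0 (?d q) (?d s)) (int (Suc n)) =
        poly (if p = s then code_poly (nth_code c 0) else 0) (int (Suc n))"
      by (simp only: poly_code_poly[symmetric]) simp
  qed
  have 2: "code_poly (nth_code c 1) = (\<Sum>p\<in>?C. \<Sum>q\<in>?C. ?M p q * ?I 1 (?d p) (?d q))"
  proof (rule poly_eqI_consecutive)
    show "degree (\<Sum>p\<in>?C. \<Sum>q\<in>?C. ?M p q * ?I 1 (?d p) (?d q)) \<le> c + position_bound x"
      by (intro degree_sum_le finite_pairing_codes degree_code_matrix_mult_index_poly)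
    show "degree (code_poly (nth_code c 1)) \<le> c + position_bound x" by (rule degree_code_poly_nth_code)
    fix n assume n: "n < Suc (c + position_bound x)"
    have "poly (\<Sum>p\<in>?C. \<Sum>q\<in>?C. ?M p q * ?I 1 (?d p) (?d q)) (int (Suc n)) =
        (\<Sum>p\<in>?C. \<Sum>q\<in>?C. poly_code (code_matrix c p q) (Suc n) * int (code_count 1 x (Suc n) p q))"
      unfolding poly_sum poly_mult by (intro sum.cong refl) (simp only: poly_code_poly int_code_count)
    also have "\<dots> = poly_code (nth_code c 1) (Suc n)"
      by (rule sym, rule cert[THEN conjunct2, THEN conjunct2, rule_format, OF n])
    finally show "poly (code_poly (nth_code c 1)) (int (Suc n)) =
        poly (\<Sum>p\<in>?C. \<Sum>q\<in>?C. ?M p q * ?I 1 (?d p) (?d q)) (int (Suc n))"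
      by (simp only: poly_code_poly)
  qed
  show thesis
  proof (rule that[of "\<lambda>p q. ?M (e p) (e q)", OF 0])
    fix p s assume ps: "p \<in> ?X" "s \<in> ?X"
    have "(\<Sum>q\<in>?X. ?M (e p) (e q) * ?I 0 q s) = (\<Sum>q\<in>?C. ?M (e p) q * ?I 0 (?d q) (?d (e s)))"
      unfolding reindex by (intro sum.cong refl) (simp only: ed e(2)[OF ps(2)])
    also have "\<dots> = (if e p = e s then code_poly (nth_code c 0) else 0)" by (intro 1 e ps)
    also have "e p = e s \<longleftrightarrow> p = s" using e(2)[OF ps(1)] e(2)[OF ps(2)] by metis
    finally show "(\<Sum>q\<in>?X. ?M (e p) (e q) * index_poly ?P (\<lambda>t. t) (\<lambda>t. t) q s) =
        (if p = s then code_poly (nth_code c 0) else 0)"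
      by (simp only: code_row_0 code_col_0)
  next
    show "code_poly (nth_code c 1) = (\<Sum>p\<in>?X. \<Sum>q\<in>?X. ?M (e p) (e q) * ?I 1 p q)"
      unfolding reindex 2 by (intro sum.cong refl) (simp only: ed)
  qed
qed

text \<open>Stated for every number \<open>x\<close>, because the search must be total. The adjugate
  of the Gram matrix is the witness.\<close>

lemma certificate_exists: "\<exists>c. certifies x c"
proof -
  let ?P = "code_positions x" and ?C = "pairing_codes x" and ?d = "decode_pairing x"
  let ?X = "pairings ?P (code_label x)"
  let ?I = "\<lambda>m. index_poly ?P (code_row m x) (code_col m x)"
  note bij = bij_betw_decode_pairing[of x]
  have reindex: "(\<Sum>p\<in>?X. F p) = (\<Sum>p\<in>?C. F (?d p))" for F :: "(nat \<Rightarrow> nat) \<Rightarrow> int poly"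
    by (rule sum.reindex_bij_betw[OF bij, symmetric])
  obtain D V where V0: "\<And>p s. p \<in> ?X \<Longrightarrow> s \<in> ?X \<Longrightarrow>
      (\<Sum>q\<in>?X. V p q * index_poly ?P (\<lambda>t. t) (\<lambda>t. t) q s) = (if p = s then D else 0)"
    and D: "\<And>n. \<forall>y. card {t \<in> ?P. code_label x t = y} \<le> 2 * n \<Longrightarrow> poly D (int n) \<noteq> 0"
    by (rule gram_inverse_exists[OF finite_code_positions[of x], of "code_label x"]) blast
  have V: "(\<Sum>q\<in>?X. V p q * ?I 0 q s) = (if p = s then D else 0)" if "p \<in> ?X" "s \<in> ?X" for p s
    unfolding code_row_0 code_col_0 by (rule V0[OF that])
  \<comment> \<open>In dimension \<open>card ?P\<close> the condition on the labels holds trivially,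
    so \<open>D\<close> has a nonzero value there.\<close>
  have "card {t \<in> ?P. code_label x t = y} \<le> card ?P" for y
    by (rule card_mono[OF finite_code_positions]) auto
  then have "\<forall>y. card {t \<in> ?P. code_label x t = y} \<le> 2 * card ?P" by (simp add: trans_le_add1 mult_2)
  from D[OF this] have "D \<noteq> 0" by auto
  define A where "A = (\<Sum>p\<in>?X. \<Sum>q\<in>?X. V p q * ?I 1 p q)"
  \<comment> \<open>\<open>K\<close> exceeds all codes of pairs of pairings, so a list of length
    \<open>K\<close> holds the whole matrix; its other entries are filler.\<close>
  have "finite ((\<lambda>(p, q). pair p q) ` (?C \<times> ?C))" using finite_pairing_codes by blast
  then obtain K where K: "\<And>p q. p \<in> ?C \<Longrightarrow> q \<in> ?C \<Longrightarrow> pair p q < K"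
    unfolding finite_nat_set_iff_bounded by fastforce
  define c where "c = list_encode [encode_poly D, encode_poly A,
    list_encode (map (\<lambda>z. encode_poly (V (?d (pfst z)) (?d (psnd z)))) [0..<K])]"
  have c: "nth_code c 0 = encode_poly D" "nth_code c 1 = encode_poly A"
    by (simp_all add: c_def nth_code_list_encode del: list_encode.simps)
  have M: "code_matrix c p q = encode_poly (V (?d p) (?d q))" if "p \<in> ?C" "q \<in> ?C" for p q
    using K[OF that] by (simp add: c_def code_matrix_def nth_code_list_encode del: list_encode.simps)
  have dinj: "?d p = ?d s \<longleftrightarrow> p = s" if "p \<in> ?C" "s \<in> ?C" for p s
    using bij that by (auto simp: bij_betw_def inj_on_eq_iff)
  have "certifies x c" unfolding certifies_iff
  proof (intro conjI allI impI ballI)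
    show "\<exists>n<Suc (c + position_bound x). poly_code (nth_code c 0) (Suc n) \<noteq> 0"
    proof (rule ccontr)
      assume "\<not> ?thesis"
      then have "code_poly (nth_code c 0) = 0"
        by (intro poly_eqI_consecutive[OF degree_code_poly_nth_code[of _ _ "position_bound x"]])
           (auto simp: poly_code_poly simp del: of_nat_Suc)
      then show False using c \<open>D \<noteq> 0\<close> by simp
    qed
  next
    fix n p s assume ps: "p \<in> ?C" "s \<in> ?C"
    have "(\<Sum>q\<in>?C. poly_code (code_matrix c p q) (Suc n) * int (code_count 0 x (Suc n) q s)) =
        (\<Sum>q\<in>?C. poly (V (?d p) (?d q) * ?I 0 (?d q) (?d s)) (int (Suc n)))"
      by (intro sum.cong refl) (simp only: M ps int_code_count poly_mult poly_code_encode_poly)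
    also have "\<dots> = poly (\<Sum>q\<in>?C. V (?d p) (?d q) * ?I 0 (?d q) (?d s)) (int (Suc n))"
      by (simp only: poly_sum)
    also have "(\<Sum>q\<in>?C. V (?d p) (?d q) * ?I 0 (?d q) (?d s)) = (if ?d p = ?d s then D else 0)"
      by (rule V[OF ps[THEN decode_pairing_mem], unfolded reindex])
    finally show "(\<Sum>q\<in>?C. poly_code (code_matrix c p q) (Suc n) * int (code_count 0 x (Suc n) q s)) =
        of_bool (p = s) * poly_code (nth_code c 0) (Suc n)"
      using dinj[OF ps] by (simp add: c del: of_nat_Suc)
  next
    fix n
    have "(\<Sum>p\<in>?C. \<Sum>q\<in>?C. poly_code (code_matrix c p q) (Suc n) * int (code_count 1 x (Suc n) p q)) =
        (\<Sum>p\<in>?C. \<Sum>q\<in>?C. poly (V (?d p) (?d q) * ?I 1 (?d p) (?d q)) (int (Suc n)))"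
      by (intro sum.cong refl) (simp only: M int_code_count poly_mult poly_code_encode_poly)
    also have "\<dots> = poly A (int (Suc n))" unfolding A_def reindex by (simp only: poly_sum)
    finally show "poly_code (nth_code c 1) (Suc n) =
        (\<Sum>p\<in>?C. \<Sum>q\<in>?C. poly_code (code_matrix c p q) (Suc n) * int (code_count 1 x (Suc n) p q))"
      unfolding c by simp
  qed
  then show ?thesis ..
qed

subsection \<open>The trace integral\<close>

text \<open>The denominator in lowest terms divides any other denominator, by coprimality. A
  representation with nonzero denominator at \<open>x\<close> therefore decides both definedness and
  value.\<close>

lemma ratfun_Fract:
  assumes "poly b x \<noteq> 0"
  shows "ratfun_defined_at (Fract a b) x" "ratfun_eval (Fract a b) x = poly a x / poly b x"
proof -
  obtain u v where uv: "quot_of_fract (Fract a b) = (u, v)" by (cases "quot_of_fract (Fract a b)")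
  have b: "b \<noteq> 0" using assms by auto
  have v: "v \<noteq> 0" using snd_quot_of_fract_nonzero[of "Fract a b"] uv by simp
  have "Fract u v = Fract a b" using Fract_quot_of_fract[of "Fract a b"] uv by simp
  then have eq: "u * b = a * v" using v b by (simp add: eq_fract)
  have "coprime u v" using coprime_quot_of_fract[of "Fract a b"] uv by simp
  moreover have "v dvd u * b" unfolding eq by simp
  ultimately have "v dvd b" by (simp add: coprime_commute coprime_dvd_mult_right_iff)
  then have vx: "poly v x \<noteq> 0" using assms by (auto elim!: dvdE)
  then show "ratfun_defined_at (Fract a b) x" by (simp add: ratfun_defined_at_def uv)
  have "poly u x * poly b x = poly a x * poly v x" using arg_cong[OF eq, of "\<lambda>p. poly p x"] by simp
  then show "ratfun_eval (Fract a b) x = poly a x / poly b x"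
    using vx assms by (simp add: ratfun_eval_def uv divide_simps)
qed

lemma list_decode_encode_words:
  "list_decode (encode_words ws) = map (\<lambda>w. list_encode (map encode_letter w)) ws"
  by (simp add: encode_words_def)

lemma code_positions_encode_words: "code_positions (encode_words ws) = word_positions ws"
  by (auto simp: code_positions_def word_positions_def is_position_iff list_decode_encode_words)

lemma code_letter_encode_words:
  "t \<in> word_positions ws \<Longrightarrow> code_letter (encode_words ws) t = encode_letter (letter_at ws t)"
  by (simp add: code_letter_def nth_code_eq list_decode_encode_words word_positions_def letter_at_def)

lemma code_label_encode_words:
  "t \<in> word_positions ws \<Longrightarrow> code_label (encode_words ws) t = fst (letter_at ws t)"
  by (simp add: code_label_def code_letter_encode_words encode_letter_def)

lemma code_next_encode_words:
  "t \<in> word_positions ws \<Longrightarrow> code_next (encode_words ws) t = next_position ws t"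
  by (auto simp: code_next_def next_position_def drop_code_eq_0_iff nth_code_eq
      list_decode_encode_words word_positions_def)

lemma card_word_positions_label:
  "card {t \<in> word_positions ws. fst (letter_at ws t) = y} = total_unsigned_exponent y ws"
proof -
  let ?K = "\<lambda>j. {k. k < length (ws ! j) \<and> fst (ws ! j ! k) = y}"
  have "{t \<in> word_positions ws. fst (letter_at ws t) = y} = prod_encode ` (SIGMA j:{..<length ws}. ?K j)"
    unfolding word_positions_eq by (auto simp: letter_at_def image_iff)
  then have "card {t \<in> word_positions ws. fst (letter_at ws t) = y} = card (SIGMA j:{..<length ws}. ?K j)"
    by (simp only: card_image[OF inj_prod_encode])
  also have "\<dots> = (\<Sum>j<length ws. card (?K j))" by (rule card_SigmaI) auto
  also have "\<dots> = total_unsigned_exponent y ws"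
    by (simp add: total_unsigned_exponent_def sum_list_sum_nth length_filter_conv_card atLeast0LessThan)
  finally show ?thesis .
qed

text \<open>Translates the coded positions, labels and row and column maps back to the words; the
  polynomial identity for \<open>V\<close>, evaluated at \<open>n\<close>, then feeds
  \<open>sum_moments_formula\<close>.\<close>

lemma trace_integral_eq:
  fixes V :: "(nat \<Rightarrow> nat) \<Rightarrow> (nat \<Rightarrow> nat) \<Rightarrow> int poly"
  assumes ws: "\<forall>w\<in>set ws. w \<in> carrier (free_group r) \<and> w \<noteq> \<one>\<^bsub>free_group r\<^esub>"
    and haar: "haar_prob_orthogonal n \<mu>"
    and dim: "\<And>y. total_unsigned_exponent y ws \<le> 2 * n"
  defines "x \<equiv> encode_words ws"
  defines "X \<equiv> pairings (code_positions x) (code_label x)"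
  assumes V: "\<And>p s. p \<in> X \<Longrightarrow> s \<in> X \<Longrightarrow>
    (\<Sum>q\<in>X. V p q * index_poly (code_positions x) (\<lambda>t. t) (\<lambda>t. t) q s) = (if p = s then D else 0)"
  shows "of_int (poly D (int n)) * trace_integral r ws n \<mu> = of_int (poly
    (\<Sum>p\<in>X. \<Sum>q\<in>X. V p q * index_poly (code_positions x) (code_row 1 x) (code_col 1 x) p q) (int n))"
proof -
  let ?P = "code_positions x" and ?\<rho> = "code_row 1 x" and ?\<kappa> = "code_col 1 x"
  have P: "?P = word_positions ws" by (simp add: x_def code_positions_encode_words)
  have label: "code_label x t = fst (letter_at ws t)" if "t \<in> ?P" for t
    using that unfolding P by (simp add: x_def code_label_encode_words)
  have letter: "letter_at ws t \<in> set (ws ! pfst t) \<and> ws ! pfst t \<in> set ws" if "t \<in> ?P" for t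
    using that unfolding P by (auto simp: word_positions_def letter_at_def)
  have letter_r: "fst a < r" if "w \<in> set ws" "a \<in> set w" for w a
    using ws that by (auto simp: free_group_def)
  have label_r: "code_label x t < r" if "t \<in> ?P" for t
    using letter_r[of "ws ! pfst t" "letter_at ws t"] letter[OF that] label[OF that] by simp
  have cardP: "card {t \<in> ?P. code_label x t = y} \<le> 2 * n" for y
  proof -
    have "{t \<in> ?P. code_label x t = y} = {t \<in> word_positions ws. fst (letter_at ws t) = y}"
      using label P by auto
    then show ?thesis using dim[of y] by (simp add: card_word_positions_label)
  qed
  interpret haar_moments n r \<mu> ?P "code_label x"
  proof
    show "haar_prob_orthogonal n \<mu>" by (rule haar)
    show "finite ?P" by (rule finite_code_positions)
    show "code_label x t < r" if "t \<in> ?P" for t by (rule label_r[OF that])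
  qed (rule cardP)
  have "trace_integral r ws n \<mu> =
    (\<integral>g. (\<Sum>i\<in>?P \<rightarrow>\<^sub>E {..<n}. \<Prod>t\<in>?P. g (code_label x t) $$ (i (?\<rho> t), i (?\<kappa> t))) \<partial>\<Omega>)"
    unfolding trace_integral_def
  proof (rule Bochner_Integration.integral_cong[OF refl])
    fix g assume g: "g \<in> space \<Omega>"
    have "(\<Prod>w\<leftarrow>ws. mat_trace (word_eval (orthogonal_group n) g w)) =
        (\<Sum>i\<in>?P \<rightarrow>\<^sub>E {..<n}. \<Prod>t\<in>?P. letter_mat g (letter_at ws t) $$ (i t, i (next_position ws t)))"
      unfolding P
    proof (rule prod_traces_eq_sum)
      show "g (fst a) \<in> carrier (orthogonal_group n)" if "w \<in> set ws" "a \<in> set w" for w a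
        using space_\<Omega>D[OF g letter_r[OF that]] .
      show "w \<noteq> []" if "w \<in> set ws" for w using ws that by (auto simp: free_group_def)
    qed
    also have "\<dots> = (\<Sum>i\<in>?P \<rightarrow>\<^sub>E {..<n}. \<Prod>t\<in>?P. g (code_label x t) $$ (i (?\<rho> t), i (?\<kappa> t)))"
    proof (intro sum.cong prod.cong refl)
      fix i t assume i: "i \<in> ?P \<rightarrow>\<^sub>E {..<n}" and t: "t \<in> ?P"
      have nx: "code_next x t = next_position ws t" using t unfolding P by (simp add: x_def code_next_encode_words)
      have it: "i t < n" "i (next_position ws t) < n"
        using PiE_mem[OF i] t code_next_position[OF t] by (auto simp: nx)
      have "g (code_label x t) \<in> carrier_mat n n"
        by (rule mem_orthogonal_groupD(1)[OF space_\<Omega>D[OF g label_r[OF t]]])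
      moreover have "psnd (code_letter x t) \<noteq> 0 \<longleftrightarrow> snd (letter_at ws t)"
        using t unfolding P by (simp add: x_def code_letter_encode_words encode_letter_def)
      ultimately show "letter_mat g (letter_at ws t) $$ (i t, i (next_position ws t)) =
          g (code_label x t) $$ (i (?\<rho> t), i (?\<kappa> t))"
        using it label[OF t] nx by (auto simp: letter_mat_def code_row_def code_col_def)
    qed
    finally show "(\<Prod>w\<leftarrow>ws. mat_trace (word_eval (orthogonal_group n) g w)) =
        (\<Sum>i\<in>?P \<rightarrow>\<^sub>E {..<n}. \<Prod>t\<in>?P. g (code_label x t) $$ (i (?\<rho> t), i (?\<kappa> t)))" .
  qed
  moreover have "of_int (poly D (int n)) *
      (\<integral>g. (\<Sum>i\<in>?P \<rightarrow>\<^sub>E {..<n}. \<Prod>t\<in>?P. g (code_label x t) $$ (i (?\<rho> t), i (?\<kappa> t))) \<partial>\<Omega>) =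
    (\<Sum>p\<in>X. \<Sum>q\<in>X. of_int (poly (V p q) (int n)) * real (index_count ?P ?\<rho> ?\<kappa> n p q))"
    unfolding X_def
  proof (rule sum_moments_formula[OF _ code_row_positions code_col_positions], fold X_def)
    fix p s assume ps: "p \<in> X" "s \<in> X"
    have "(\<Sum>q\<in>X. of_int (poly (V p q) (int n)) * real (gram ?P n q s)) =
        of_int (poly (\<Sum>q\<in>X. V p q * index_poly ?P (\<lambda>t. t) (\<lambda>t. t) q s) (int n))"
      unfolding poly_sum of_int_sum poly_mult of_int_mult
    proof (rule sum.cong[OF refl])
      fix q assume "q \<in> X"
      from poly_index_poly[OF finP _ _ this[unfolded X_def] ps(2)[unfolded X_def], of "\<lambda>t. t" "\<lambda>t. t" n]
      show "of_int (poly (V p q) (int n)) * real (gram ?P n q s) =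
          of_int (poly (V p q) (int n)) * of_int (poly (index_poly ?P (\<lambda>t. t) (\<lambda>t. t) q s) (int n))" by simp
    qed
    then show "(\<Sum>q\<in>X. of_int (poly (V p q) (int n)) * real (gram ?P n q s)) =
        (if p = s then of_int (poly D (int n)) else 0)"
      using V[OF ps] by simp
  qed
  moreover have "(\<Sum>p\<in>X. \<Sum>q\<in>X. of_int (poly (V p q) (int n)) * real (index_count ?P ?\<rho> ?\<kappa> n p q)) =
      of_int (poly (\<Sum>p\<in>X. \<Sum>q\<in>X. V p q * index_poly ?P ?\<rho> ?\<kappa> p q) (int n))"
    unfolding poly_sum of_int_sum poly_mult of_int_mult
  proof (intro sum.cong refl)
    fix p q assume "p \<in> X" "q \<in> X"
    from poly_index_poly[OF finP code_row_positions code_col_positions this[unfolded X_def], of 1 1 n]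
    show "of_int (poly (V p q) (int n)) * real (index_count ?P ?\<rho> ?\<kappa> n p q) =
        of_int (poly (V p q) (int n)) * of_int (poly (index_poly ?P ?\<rho> ?\<kappa> p q) (int n))" by simp
  qed
  ultimately show ?thesis by simp
qed

text \<open>Evenness makes the halving exact for the letters of the basis; letters with index from
  \<open>r\<close> on do not occur.\<close>

lemma total_unsigned_exponent_le:
  assumes ws: "\<forall>w\<in>set ws. w \<in> carrier (free_group r)"
    and even: "\<forall>i<r. even (total_unsigned_exponent i ws)"
    and n: "n \<ge> max_half_exponent r ws"
  shows "total_unsigned_exponent y ws \<le> 2 * n"
proof (cases "y < r")
  case True
  then have "total_unsigned_exponent y ws div 2 \<le> max_half_exponent r ws"
    unfolding max_half_exponent_def by (intro Max_ge) auto
  moreover have "2 * (total_unsigned_exponent y ws div 2) = total_unsigned_exponent y ws"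
    using even True by simp
  ultimately show ?thesis using n by linarith
next
  case False
  then have "filter (\<lambda>a. fst a = y) w = []" if "w \<in> set ws" for w
    using ws that by (auto simp: filter_empty_conv free_group_def)
  then have "total_unsigned_exponent y ws = 0"
    by (simp add: total_unsigned_exponent_def)
  then show ?thesis by simp
qed

text \<open>Entry \<open>1\<close> of a certificate is the numerator and entry \<open>0\<close> the
  denominator.\<close>

definition trace_ratfun_code :: "nat \<Rightarrow> nat" where
  "trace_ratfun_code x = (let c = LEAST c. certifies x c in pair (nth_code c 1) (nth_code c 0))"

lemma total_recursive_trace_ratfun_code: "total_recursive trace_ratfun_code"
proof -
  have r: "total_recursive (\<lambda>x. LEAST c. certifies x c)"
    by (rule total_recursive_LEAST[OF decidable_certifies certificate_exists])
  have "total_recursive (\<lambda>x. pair (nth_code (LEAST c. certifies x c) 1) (nth_code (LEAST c. certifies x c) 0))"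
    by (intro rec_intros r)
  then show ?thesis by (simp add: trace_ratfun_code_def[abs_def] Let_def)
qed

text \<open>The denominator found by the search may vanish at admissible dimensions; the determinant of
  the Gram matrix does not, and the two representations define the same rational function.\<close>

lemma decode_trace_ratfun_code:
  obtains A D V where
    "decode_ratfun (trace_ratfun_code x) = Fract (map_poly of_int A) (map_poly of_int D)"
    "\<And>p s. p \<in> pairings (code_positions x) (code_label x) \<Longrightarrow> s \<in> pairings (code_positions x) (code_label x) \<Longrightarrow>
      (\<Sum>q\<in>pairings (code_positions x) (code_label x).
        V p q * index_poly (code_positions x) (\<lambda>t. t) (\<lambda>t. t) q s) = (if p = s then D else 0)"
    "A = (\<Sum>p\<in>pairings (code_positions x) (code_label x). \<Sum>q\<in>pairings (code_positions x) (code_label x).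
        V p q * index_poly (code_positions x) (code_row 1 x) (code_col 1 x) p q)"
    "\<And>n. \<forall>y. card {t \<in> code_positions x. code_label x t = y} \<le> 2 * n \<Longrightarrow> poly D (int n) \<noteq> 0"
proof -
  let ?P = "code_positions x"
  let ?X = "pairings ?P (code_label x)" and ?M = "index_poly ?P (\<lambda>t. t) (\<lambda>t. t)"
  let ?H = "index_poly ?P (code_row 1 x) (code_col 1 x)"
  have finX: "finite ?X" by (rule finite_pairings[OF finite_code_positions])
  define c where "c = (LEAST c. certifies x c)"
  have "certifies x c" unfolding c_def using certificate_exists by (rule LeastI_ex)
  then obtain U where E0: "code_poly (nth_code c 0) \<noteq> 0"
    and U: "\<And>p s. p \<in> ?X \<Longrightarrow> s \<in> ?X \<Longrightarrow> (\<Sum>q\<in>?X. U p q * ?M q s) = (if p = s then code_poly (nth_code c 0) else 0)"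
    and B: "code_poly (nth_code c 1) = (\<Sum>p\<in>?X. \<Sum>q\<in>?X. U p q * ?H p q)"
    by (rule certifies_sound) (rule that)
  define E where "E = code_poly (nth_code c 0)"
  obtain D V where V1: "\<And>p s. p \<in> ?X \<Longrightarrow> s \<in> ?X \<Longrightarrow> (\<Sum>q\<in>?X. V p q * ?M q s) = (if p = s then D else 0)"
    and V2: "\<And>p s. p \<in> ?X \<Longrightarrow> s \<in> ?X \<Longrightarrow> (\<Sum>q\<in>?X. ?M p q * V q s) = (if p = s then D else 0)"
    and D: "\<And>n. \<forall>y. card {t \<in> ?P. code_label x t = y} \<le> 2 * n \<Longrightarrow> poly D (int n) \<noteq> 0"
    by (rule gram_inverse_exists[OF finite_code_positions[of x], of "code_label x"]) (rule that)
  have "card {t \<in> ?P. code_label x t = y} \<le> card ?P" for y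
    by (rule card_mono[OF finite_code_positions]) auto
  then have "\<forall>y. card {t \<in> ?P. code_label x t = y} \<le> 2 * card ?P" by (simp add: trans_le_add1 mult_2)
  from D[OF this] have D0: "D \<noteq> 0" by auto
  define A where "A = (\<Sum>p\<in>?X. \<Sum>q\<in>?X. V p q * ?H p q)"
  \<comment> \<open>Both sides are the product of \<open>U\<close>, the Gram matrix and
    \<open>V\<close>, bracketed in two ways. This replaces the inversion of matrices over rational
    functions.\<close>
  have UV: "U p s * D = E * V p s" if ps: "p \<in> ?X" "s \<in> ?X" for p s
  proof -
    have "U p s * D = (\<Sum>q\<in>?X. U p q * (if q = s then D else 0))"
      using ps finX by (simp add: if_distrib[of "\<lambda>z. _ * z"] cong: if_cong)
    also have "\<dots> = (\<Sum>q\<in>?X. U p q * (\<Sum>t\<in>?X. ?M q t * V t s))"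
      using V2[OF _ ps(2)] by (intro sum.cong) auto
    also have "\<dots> = (\<Sum>t\<in>?X. (\<Sum>q\<in>?X. U p q * ?M q t) * V t s)"
      unfolding sum_distrib_left sum_distrib_right by (subst sum.swap) (simp only: mult.assoc)
    also have "\<dots> = (\<Sum>t\<in>?X. (if p = t then E else 0) * V t s)"
      using U[OF ps(1)] by (intro sum.cong) (auto simp: E_def)
    also have "\<dots> = E * V p s"
      using ps finX by (simp add: if_distrib[of "\<lambda>z. z * _"] cong: if_cong)
    finally show ?thesis .
  qed
  have "code_poly (nth_code c 1) * D = (\<Sum>p\<in>?X. \<Sum>q\<in>?X. (U p q * D) * ?H p q)"
    unfolding B sum_distrib_right by (simp only: mult_ac)
  also have "\<dots> = (\<Sum>p\<in>?X. \<Sum>q\<in>?X. E * (V p q * ?H p q))"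
    by (intro sum.cong refl) (simp only: UV mult.assoc)
  also have "\<dots> = A * E" unfolding A_def sum_distrib_right by (simp only: mult_ac)
  finally have eq: "code_poly (nth_code c 1) * D = A * E" .
  have inj: "map_poly (of_int :: int \<Rightarrow> rat) f = 0 \<longleftrightarrow> f = 0" for f
    by (auto simp: poly_eq_iff coeff_map_poly)
  have mult: "map_poly (of_int :: int \<Rightarrow> rat) (f * g) = map_poly of_int f * map_poly of_int g" for f g
    by (rule poly_eqI) (simp add: coeff_map_poly coeff_mult)
  have "decode_ratfun (trace_ratfun_code x) =
      Fract (map_poly of_int (code_poly (nth_code c 1))) (map_poly of_int E)"
    by (simp add: decode_ratfun_def trace_ratfun_code_def c_def[symmetric] decode_int_poly_eq E_def)
  also have "\<dots> = Fract (map_poly of_int A) (map_poly of_int D)"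
    using E0 D0 by (simp add: eq_fract inj E_def[symmetric] mult[symmetric] eq del: One_nat_def)
  finally show thesis by (rule that[OF _ V1 A_def D])
qed

theorem corollary3p5:
  shows "\<exists>Trbar :: word list \<Rightarrow> rat poly fract.
    computable_from_words Trbar \<and>
    (\<forall>(r::nat) (ws::word list).
      (\<forall>w\<in>set ws. w \<in> carrier (free_group r) \<and> w \<noteq> \<one>\<^bsub>free_group r\<^esub>) \<longrightarrow>
      (\<forall>i<r. even (total_unsigned_exponent i ws)) \<longrightarrow>
      (\<forall>n\<ge>max_half_exponent r ws.
        ratfun_defined_at (Trbar ws) (of_nat n) \<and>
        (\<forall>\<mu>. haar_prob_orthogonal n \<mu> \<longrightarrow>
          trace_integral r ws n \<mu> = of_rat (ratfun_eval (Trbar ws) (of_nat n)))))"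
proof (intro exI conjI allI impI)
  \<comment> \<open>Only the words are coded; their letters carry the labels, so one algorithm
    serves all ranks \<open>r\<close>.\<close>
  let ?T = "\<lambda>ws. decode_ratfun (trace_ratfun_code (encode_words ws))"
  show "computable_from_words ?T"
    unfolding computable_from_words_def using total_recursive_trace_ratfun_code by blast
  fix r n :: nat and ws :: "word list"
  assume ws: "\<forall>w\<in>set ws. w \<in> carrier (free_group r) \<and> w \<noteq> \<one>\<^bsub>free_group r\<^esub>"
    and even: "\<forall>i<r. even (total_unsigned_exponent i ws)" and n: "n \<ge> max_half_exponent r ws"
  define x where "x = encode_words ws"
  have dim: "total_unsigned_exponent y ws \<le> 2 * n" for y
    using ws even n by (intro total_unsigned_exponent_le) auto
  have "{t \<in> code_positions x. code_label x t = y} = {t \<in> word_positions ws. fst (letter_at ws t) = y}" for y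
    by (auto simp: x_def code_positions_encode_words code_label_encode_words)
  then have card: "card {t \<in> code_positions x. code_label x t = y} \<le> 2 * n" for y
    using dim[of y] by (simp add: card_word_positions_label)
  obtain A D V where T: "decode_ratfun (trace_ratfun_code x) = Fract (map_poly of_int A) (map_poly of_int D)"
    and V: "\<And>p s. p \<in> pairings (code_positions x) (code_label x) \<Longrightarrow> s \<in> pairings (code_positions x) (code_label x) \<Longrightarrow>
      (\<Sum>q\<in>pairings (code_positions x) (code_label x).
        V p q * index_poly (code_positions x) (\<lambda>t. t) (\<lambda>t. t) q s) = (if p = s then D else 0)"
    and A: "A = (\<Sum>p\<in>pairings (code_positions x) (code_label x). \<Sum>q\<in>pairings (code_positions x) (code_label x).
        V p q * index_poly (code_positions x) (code_row 1 x) (code_col 1 x) p q)"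
    and D: "\<And>n. \<forall>y. card {t \<in> code_positions x. code_label x t = y} \<le> 2 * n \<Longrightarrow> poly D (int n) \<noteq> 0"
    by (rule decode_trace_ratfun_code[of x]) (rule that)
  have Dn: "poly D (int n) \<noteq> 0" by (rule D) (use card in blast)
  then have "poly (map_poly of_int D) (of_nat n :: rat) \<noteq> 0" by (simp add: poly_map_of_int)
  note rat = ratfun_Fract[OF this, of "map_poly of_int A", folded T, unfolded x_def]
  show "ratfun_defined_at (?T ws) (of_nat n)" by (rule rat(1))
  fix \<mu> assume haar: "haar_prob_orthogonal n \<mu>"
  have "of_int (poly D (int n)) * trace_integral r ws n \<mu> = of_int (poly A (int n))"
    unfolding A x_def by (rule trace_integral_eq[OF ws haar dim V[unfolded x_def]])
  then have "trace_integral r ws n \<mu> = of_int (poly A (int n)) / of_int (poly D (int n))"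
    using Dn by (simp add: eq_divide_eq mult.commute)
  also have "\<dots> = of_rat (ratfun_eval (?T ws) (of_nat n))"
    unfolding rat(2) by (simp add: poly_map_of_int of_rat_divide)
  finally show "trace_integral r ws n \<mu> = of_rat (ratfun_eval (?T ws) (of_nat n))" .
qed

end
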